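(* Let $M,N$ be oriented Riemannian manifolds with $\dim N<\dim M$, let $\rho\in C^m(M,N)$ be a submersion and let $f\in C_c^r(M)$, with $1\leq r\leq m$. For $\lambda\in N$ let $M_\lambda=\rho^{-1}(\lambda)$ and $\mu_\lambda=J^{-1}\eta_\lambda$, where $\eta_\lambda$ is the volume form on $M_\lambda$ induced by its Riemannian structure. Then the map $F:N\to\mathbb R$ defined by $$F(\lambda)=\int_{M_\lambda} f\,d\mu_\lambda$$ is $r$ times differentiable. Moreover, if $X$ is a vector field on $N$, then $$XF(\lambda)=\int_{M_\lambda}\Big(\check X(f)+\big(\operatorname{div}(\check X)-\operatorname{div}X(\lambda)\big)f\Big)\,\mu_\lambda ,$$ where the divergence $\operatorname{div}(\check X)$ is computed with respect to the Riemannian volume form on $M$, while the divergence $\operatorname{div}(X)$ is computed with respect to the Riemannian volume form on $N$.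
   Context: Here $m$ denotes the order of differentiability of $\rho$ (not a dimension), and $C_c^r(M)$ is the space of compactly supported functions of class $C^r$ on $M$ (real-valued, since $F$ takes values in $\mathbb R$). Each $M_\lambda=\rho^{-1}(\lambda)$ is a submanifold of $M$, carrying the Riemannian structure induced from $M$, with $T_xM_{\rho(x)}=\ker D\rho(x)$, and $D\rho(x)$ restricts to an isomorphism from the orthogonal complement $T_x^\perp M_{\rho(x)}$ of $T_xM_{\rho(x)}$ in $T_xM$ onto $T_{\rho(x)}N$. The function $J$ is $J(x)=\det\big[D\rho(x)|_{T_x^\perp M_{\rho(x)}}\big]$, i.e. $J(x)=[\det(D\rho(x)D\rho(x)^* )]^{1/2}$. For a vector field $X$ on $N$, $\check X$ is the unique vector field on $M$ normal to each $M_\lambda$ such that $D\rho(\check X)=X$, i.e. $\check X(q)=(D\rho(q)|_{T_q^\perp M_{\rho(q)}})^{-1}(X(\rho(q)))$ for $q\in M$. The divergence of a vector field $Y$ with respect to a volume form $\eta$ is defined by $\mathcal L_Y\eta=\operatorname{div}(Y)\,\eta$, where $\mathcal L$ is the Lie derivative. Vector fields $X$ on $N$ are smooth.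
   Formalization: F is shown to be of class C^min(r,m-1) instead of r times differentiable (this differs only for r = m finite, where the claim is false: ρ(x,y)=k(x) with k only C^m), and the formula for XF is stated for m ≥ 2, since for m = 1 the divergence of the lift of X need not exist. *)

theory Defs
  imports "HOL-Analysis.Analysis" "HOL-Library.Extended_Nat"
begin

section \<open>Maps of class $C^k$ between Euclidean spaces\<close>

primrec Cn_on :: "nat \<Rightarrow> 'a::euclidean_space set \<Rightarrow> ('a \<Rightarrow> 'b::euclidean_space) \<Rightarrow> bool" where
  "Cn_on 0 S f \<longleftrightarrow> continuous_on S f"
| "Cn_on (Suc n) S f \<longleftrightarrow>
     (\<forall>x\<in>S. f differentiable (at x)) \<and> (\<forall>v. Cn_on n S (\<lambda>x. frechet_derivative f (at x) v))"

text \<open>Only used for open \<open>S\<close>; \<open>k = \<infinity>\<close> means smooth.\<close>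

definition Ck_on :: "enat \<Rightarrow> 'a::euclidean_space set \<Rightarrow> ('a \<Rightarrow> 'b::euclidean_space) \<Rightarrow> bool" where
  "Ck_on k S f \<longleftrightarrow> (\<forall>n. enat n \<le> k \<longrightarrow> Cn_on n S f)"

section \<open>Oriented smooth manifolds\<close>

text \<open>
  The manifold is the whole type \<open>'a\<close>, a second countable Hausdorff space; its dimension is the
  cardinality of the index type \<open>'m\<close>. A chart is a domain together with a coordinate map, whose
  values outside the domain are irrelevant.
\<close>

type_synonym ('a, 'm) chart = "'a set \<times> ('a \<Rightarrow> real ^ 'm)"

abbreviation chart_dom :: "('a, 'm::finite) chart \<Rightarrow> 'a set" where
  "chart_dom c \<equiv> fst c"

abbreviation coord :: "('a, 'm::finite) chart \<Rightarrow> 'a \<Rightarrow> real ^ 'm" where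
  "coord c \<equiv> snd c"

definition chart_inv :: "('a, 'm::finite) chart \<Rightarrow> real ^ 'm \<Rightarrow> 'a" where
  "chart_inv c = inv_into (chart_dom c) (coord c)"

definition is_chart :: "('a::topological_space, 'm::finite) chart \<Rightarrow> bool" where
  "is_chart c \<longleftrightarrow> open (chart_dom c) \<and> open (coord c ` chart_dom c) \<and>
     homeomorphism (chart_dom c) (coord c ` chart_dom c) (coord c) (chart_inv c)"

text \<open>The differential at \<open>p\<close> of a map between manifolds, expressed in the charts \<open>c\<close> and \<open>d\<close>.\<close>

definition differential ::
  "('a, 'm::finite) chart \<Rightarrow> ('b, 'n::finite) chart \<Rightarrow> ('a \<Rightarrow> 'b) \<Rightarrow> 'a \<Rightarrow> real ^ 'm \<Rightarrow> real ^ 'n" where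
  "differential c d \<rho> p = frechet_derivative (coord d \<circ> \<rho> \<circ> chart_inv c) (at (coord c p))"

text \<open>The orientation is the one for which all charts of the atlas are positively oriented.\<close>

definition oriented_atlas ::
  "('a::{t2_space, second_countable_topology}, 'm::finite) chart set \<Rightarrow> bool" where
  "oriented_atlas A \<longleftrightarrow>
     (\<forall>c\<in>A. is_chart c) \<and> (\<Union>c\<in>A. chart_dom c) = UNIV \<and>
     (\<forall>c\<in>A. \<forall>d\<in>A. Ck_on \<infinity> (coord c ` (chart_dom c \<inter> chart_dom d)) (coord d \<circ> chart_inv c)) \<and>
     (\<forall>c\<in>A. \<forall>d\<in>A. \<forall>p\<in>chart_dom c \<inter> chart_dom d. det (matrix (differential c d (\<lambda>x. x) p)) > 0)"

text \<open>
  Some chart around \<open>p\<close>. All notions below which are evaluated in this chart are independent of the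
  choice, by the transformation laws required of metrics and vector fields.
\<close>

definition chart_at :: "('a, 'm::finite) chart set \<Rightarrow> 'a \<Rightarrow> ('a, 'm) chart" where
  "chart_at A p = (SOME c. c \<in> A \<and> p \<in> chart_dom c)"

definition Ck_fun :: "enat \<Rightarrow> ('a, 'm::finite) chart set \<Rightarrow> ('a \<Rightarrow> real) \<Rightarrow> bool" where
  "Ck_fun k A f \<longleftrightarrow> (\<forall>c\<in>A. Ck_on k (coord c ` chart_dom c) (f \<circ> chart_inv c))"

definition Ck_map :: "enat \<Rightarrow> ('a::topological_space, 'm::finite) chart set \<Rightarrow>
    ('b::topological_space, 'n::finite) chart set \<Rightarrow> ('a \<Rightarrow> 'b) \<Rightarrow> bool" where
  "Ck_map k A B \<rho> \<longleftrightarrow> continuous_on UNIV \<rho> \<and>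
     (\<forall>c\<in>A. \<forall>d\<in>B. Ck_on k (coord c ` (chart_dom c \<inter> \<rho> -` chart_dom d))
        (coord d \<circ> \<rho> \<circ> chart_inv c))"

definition submersion ::
  "('a, 'm::finite) chart set \<Rightarrow> ('b, 'n::finite) chart set \<Rightarrow> ('a \<Rightarrow> 'b) \<Rightarrow> bool" where
  "submersion A B \<rho> \<longleftrightarrow>
     (\<forall>c\<in>A. \<forall>d\<in>B. \<forall>p\<in>chart_dom c \<inter> \<rho> -` chart_dom d. surj (differential c d \<rho> p))"

definition compactly_supported :: "('a::topological_space \<Rightarrow> real) \<Rightarrow> bool" where
  "compactly_supported f \<longleftrightarrow> compact (closure {x. f x \<noteq> 0})"

section \<open>Riemannian metrics and vector fields\<close>

text \<open>
  A tangent vector at \<open>p\<close> is represented by its components with respect to the charts around \<open>p\<close>,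
  which are related by the differentials of the transition maps. Thus a metric assigns to a
  chart \<open>c\<close> and a point \<open>p\<close> an inner product of component vectors, and a vector field assigns to
  them a component vector.
\<close>

type_synonym ('a, 'm) metric = "('a, 'm) chart \<Rightarrow> 'a \<Rightarrow> real ^ 'm \<Rightarrow> real ^ 'm \<Rightarrow> real"

type_synonym ('a, 'm) vfield = "('a, 'm) chart \<Rightarrow> 'a \<Rightarrow> real ^ 'm"

definition riemannian_metric ::
  "('a, 'm::finite) chart set \<Rightarrow> ('a, 'm) metric \<Rightarrow> bool" where
  "riemannian_metric A g \<longleftrightarrow>
     (\<forall>c\<in>A. \<forall>p\<in>chart_dom c. bilinear (g c p) \<and> (\<forall>v w. g c p v w = g c p w v) \<and>
        (\<forall>v. v \<noteq> 0 \<longrightarrow> g c p v v > 0)) \<and>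
     (\<forall>c\<in>A. \<forall>v w. Ck_on \<infinity> (coord c ` chart_dom c) (\<lambda>x. g c (chart_inv c x) v w)) \<and>
     (\<forall>c\<in>A. \<forall>d\<in>A. \<forall>p\<in>chart_dom c \<inter> chart_dom d. \<forall>v w.
        g c p v w = g d p (differential c d (\<lambda>x. x) p v) (differential c d (\<lambda>x. x) p w))"

definition smooth_vector_field ::
  "('a, 'm::finite) chart set \<Rightarrow> ('a, 'm) vfield \<Rightarrow> bool" where
  "smooth_vector_field A X \<longleftrightarrow>
     (\<forall>c\<in>A. Ck_on \<infinity> (coord c ` chart_dom c) (\<lambda>x. X c (chart_inv c x))) \<and>
     (\<forall>c\<in>A. \<forall>d\<in>A. \<forall>p\<in>chart_dom c \<inter> chart_dom d. X d p = differential c d (\<lambda>x. x) p (X c p))"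

text \<open>The function \<open>X f\<close>.\<close>

definition derivative_along ::
  "('a, 'm::finite) chart set \<Rightarrow> ('a, 'm) vfield \<Rightarrow> ('a \<Rightarrow> real) \<Rightarrow> 'a \<Rightarrow> real" where
  "derivative_along A X f p =
     (let c = chart_at A p in frechet_derivative (f \<circ> chart_inv c) (at (coord c p)) (X c p))"

section \<open>Volume form and divergence\<close>

text \<open>
  A top degree form is given in each chart by its values on frames of constant component
  vectors, a frame being encoded as the matrix whose rows are its members. The charts being
  positively oriented, the Riemannian volume form is $\sqrt{\det (g_{ij})}\, dx_1 \wedge \dots \wedge dx_m$.
\<close>

type_synonym ('a, 'm) top_form = "('a, 'm) chart \<Rightarrow> 'a \<Rightarrow> real ^ 'm ^ 'm \<Rightarrow> real"

definition volume_form :: "('a, 'm::finite) metric \<Rightarrow> ('a, 'm) top_form" where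
  "volume_form g c p V = sqrt (det (\<chi> i j. g c p (axis i 1) (axis j 1))) * det V"

text \<open>
  The Lie derivative of a form,
  $(\mathcal{L}_Y \eta)(V_1, \dots, V_m) = Y(\eta(V_1, \dots, V_m)) -
    \sum_j \eta(V_1, \dots, [Y, V_j], \dots, V_m)$,
  where for the fields $V_j$ with constant components in the chart $[Y, V_j] = - DY(V_j)$.
\<close>

definition lie_derivative ::
  "('a, 'm::finite) vfield \<Rightarrow> ('a, 'm) top_form \<Rightarrow> ('a, 'm) top_form" where
  "lie_derivative Y \<eta> c p V =
     frechet_derivative (\<lambda>x. \<eta> c (chart_inv c x) V) (at (coord c p)) (Y c p) +
     (\<Sum>j\<in>UNIV. \<eta> c p (\<chi> i. if i = j
        then frechet_derivative (\<lambda>x. Y c (chart_inv c x)) (at (coord c p)) (V $ j)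
        else V $ i))"

definition divergence ::
  "('a, 'm::finite) chart set \<Rightarrow> ('a, 'm) top_form \<Rightarrow> ('a, 'm) vfield \<Rightarrow> 'a \<Rightarrow> real" where
  "divergence A \<eta> Y p =
     (let c = chart_at A p in THE a. \<forall>V. lie_derivative Y \<eta> c p V = a * \<eta> c p V)"

section \<open>Normal lift and normal Jacobian of a submersion\<close>

text \<open>
  The lift of \<open>X\<close> is the field which is orthogonal to the kernel of the differential, that is,
  to the tangent spaces of the fibres, and which is mapped to \<open>X\<close> by the differential.
\<close>

definition normal_lift :: "('a, 'm::finite) metric \<Rightarrow> ('b, 'n::finite) chart set \<Rightarrow>
    ('a \<Rightarrow> 'b) \<Rightarrow> ('b, 'n) vfield \<Rightarrow> ('a, 'm) vfield" where
  "normal_lift g B \<rho> X c p =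
     (let d = chart_at B (\<rho> p) in
      THE v. (\<forall>w. differential c d \<rho> p w = 0 \<longrightarrow> g c p v w = 0) \<and>
             differential c d \<rho> p v = X d (\<rho> p))"

definition adjoint_wrt :: "(real ^ 'm \<Rightarrow> real ^ 'm \<Rightarrow> real) \<Rightarrow> (real ^ 'n \<Rightarrow> real ^ 'n \<Rightarrow> real) \<Rightarrow>
    (real ^ 'm \<Rightarrow> real ^ 'n) \<Rightarrow> real ^ 'n \<Rightarrow> real ^ 'm" where
  "adjoint_wrt \<alpha> \<beta> L = (THE L'. \<forall>v w. \<beta> (L v) w = \<alpha> v (L' w))"

definition normal_jacobian :: "('a, 'm::finite) chart set \<Rightarrow> ('a, 'm) metric \<Rightarrow>
    ('b, 'n::finite) chart set \<Rightarrow> ('b, 'n) metric \<Rightarrow> ('a \<Rightarrow> 'b) \<Rightarrow> 'a \<Rightarrow> real" where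
  "normal_jacobian A g B h \<rho> p =
     (let c = chart_at A p; d = chart_at B (\<rho> p); L = differential c d \<rho> p in
      sqrt (det (matrix (L \<circ> adjoint_wrt (g c p) (h d (\<rho> p)) L))))"

section \<open>Riemannian volume of submanifolds\<close>

text \<open>\<open>\<sigma>\<close> on the open set \<open>W\<close> is a $C^1$ parametrization of a relatively open subset of \<open>S\<close>.\<close>

definition local_parametrization :: "('a::topological_space, 'm::finite) chart set \<Rightarrow> 'a set \<Rightarrow>
    (real ^ 'k::finite) set \<Rightarrow> (real ^ 'k \<Rightarrow> 'a) \<Rightarrow> bool" where
  "local_parametrization A S W \<sigma> \<longleftrightarrow>
     open W \<and> openin (top_of_set S) (\<sigma> ` W) \<and> (\<exists>\<tau>. homeomorphism W (\<sigma> ` W) \<sigma> \<tau>) \<and>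
     (\<forall>c\<in>A. Ck_on 1 (W \<inter> \<sigma> -` chart_dom c) (coord c \<circ> \<sigma>) \<and>
        (\<forall>u\<in>W \<inter> \<sigma> -` chart_dom c. inj (frechet_derivative (coord c \<circ> \<sigma>) (at u))))"

text \<open>
  The value of the induced Riemannian volume on the coordinate frame of the parametrization:
  the square root of the Gram determinant of the partial derivatives of \<open>\<sigma>\<close>.
\<close>

definition volume_density :: "('a, 'm::finite) chart set \<Rightarrow> ('a, 'm) metric \<Rightarrow>
    (real ^ 'k::finite \<Rightarrow> 'a) \<Rightarrow> real ^ 'k \<Rightarrow> real" where
  "volume_density A g \<sigma> u =
     (let c = chart_at A (\<sigma> u); D = frechet_derivative (coord c \<circ> \<sigma>) (at u) in
      sqrt (det (\<chi> i j. g c (\<sigma> u) (D (axis i 1)) (D (axis j 1)))))"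

text \<open>
  The measure on the submanifold \<open>S\<close> defined by its Riemannian volume form. The type argument
  \<open>'k\<close> carries the dimension of \<open>S\<close>.
\<close>

definition riemannian_volume :: "'k::finite itself \<Rightarrow>
    ('a::topological_space, 'm::finite) chart set \<Rightarrow> ('a, 'm) metric \<Rightarrow> 'a set \<Rightarrow> 'a measure" where
  "riemannian_volume K A g S =
     (THE \<eta>. sets \<eta> = sets (restrict_space borel S) \<and>
        (\<forall>W (\<sigma> :: real ^ 'k \<Rightarrow> 'a). local_parametrization A S W \<sigma> \<longrightarrow>
           (\<forall>E\<in>sets borel. emeasure \<eta> (E \<inter> \<sigma> ` W) =
              (\<integral>\<^sup>+u\<in>W \<inter> \<sigma> -` E. ennreal (volume_density A g \<sigma> u) \<partial>lborel))))"

text \<open>The measure $\mu_\lambda = J^{-1} \eta_\lambda$ on the fibre over $\lambda$.\<close>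

definition fibre_measure :: "'k::finite itself \<Rightarrow>
    ('a::topological_space, 'm::finite) chart set \<Rightarrow> ('a, 'm) metric \<Rightarrow>
    ('b, 'n::finite) chart set \<Rightarrow> ('b, 'n) metric \<Rightarrow> ('a \<Rightarrow> 'b) \<Rightarrow> 'b \<Rightarrow> 'a measure" where
  "fibre_measure K A g B h \<rho> l =
     density (riemannian_volume K A g (\<rho> -` {l})) (\<lambda>x. ennreal (inverse (normal_jacobian A g B h \<rho> x)))"

end

theory Submission
  imports Defs
begin

text \<open>
  Near any point the base coordinates of the image under \<open>\<rho>\<close> can be completed to coordinates of the
  total space by a linear function of the given coordinates (\<open>patch_exists\<close>). In such adapted
  coordinates $(y, t)$ the map \<open>\<rho>\<close> is the projection to \<open>y\<close>, and a fibre is parametrized by \<open>t\<close>. If $Q$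
  is the Gram matrix of the metric in these coordinates and $G$ that of the base, then the density
  of the fibre volume is the square root of the minor of $Q$ for the fibre indices. The square of
  the normal Jacobian is the complementary minor of $Q^{-1}$ times $\det G$. By Jacobi's formula for
  complementary minors (\<open>fibre_density\<close>) the measure $\mu_\lambda$ therefore has the density
  $(\det Q)^{1/2} / (\det G)^{1/2}$ with respect to $dt$. If the support of \<open>f\<close> lies in
  the patch, then
  \[ F(y) = (\det G(y))^{-1/2} \int f(y,t)\, (\det Q(y,t))^{1/2}\, dt , \]
  an integral of a compactly supported function over a fixed space. Here the adapted coordinates are
  of the same class as \<open>\<rho>\<close>, while $\det Q$ contains their first derivatives, and this is the reason
  for the order $\min(r, m - 1)$. Differentiation under the integral sign (\<open>Cn_on_param_integral\<close>)
  gives the regularity of \<open>F\<close>.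

  In the same coordinates the lift of \<open>X\<close> is $U = (X(y), Z(y,t))$. With
  $\phi = f (\det Q)^{1/2}$, the product of $U(f) + \operatorname{div}(U) f$ with the density
  $(\det Q)^{1/2}$ is the Euclidean divergence of $\phi U$, which is
  $\partial_X \phi + \phi \operatorname{tr} DX + \operatorname{div}_t(\phi Z)$. The last term integrates
  to zero over the fibre. So the integral of the left hand side is
  $\partial_X \int \phi\, dt + \operatorname{tr} DX \int \phi\, dt$, and differentiating the factor
  $(\det G)^{-1/2}$ turns the trace into the divergence of \<open>X\<close> (\<open>patch_derivative\<close>). That the divergence
  of the lift may be computed in adapted coordinates, although they are only of class $C^m$, is
  \<open>coord_div_pullback\<close>.

  The general case follows with a partition of unity of class $C^n$ on the support of \<open>f\<close>
  (\<open>patch_decomposition\<close>). It remains to see that the measures on the fibres are well defined: by the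
  change of variables theorem different parametrizations induce the same measure, and
  countably many of them can be glued to a unique measure on the fibre (\<open>is_volume_ex1\<close>).
\<close>

section \<open>Calculus of $C^n$ maps\<close>

lemma Cn_on_has_derivative:
  assumes "Cn_on (Suc n) S f" "x \<in> S"
  shows "(f has_derivative frechet_derivative f (at x)) (at x)"
  using assms frechet_derivative_works by auto

lemma Cn_on_subset:
  "Cn_on n S f \<Longrightarrow> T \<subseteq> S \<Longrightarrow> Cn_on n T f"
  by (induction n arbitrary: f) (auto intro: continuous_on_subset)

lemma Cn_on_cong:
  fixes f g :: "'a::euclidean_space \<Rightarrow> 'b::euclidean_space"
  assumes "open S" "\<And>x. x \<in> S \<Longrightarrow> f x = g x" "Cn_on n S f"
  shows "Cn_on n S g"
  using assms(2,3)
proof (induction n arbitrary: f g)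
  case 0
  then show ?case by (simp cong: continuous_on_cong)
next
  case (Suc n)
  have d: "(g has_derivative frechet_derivative f (at x)) (at x)" if "x \<in> S" for x
    using Cn_on_has_derivative[OF Suc.prems(2) that] has_derivative_transform_within_open assms(1) that Suc.prems(1)
    by blast
  then have e: "frechet_derivative g (at x) = frechet_derivative f (at x)" if "x \<in> S" for x
    using frechet_derivative_at that by metis
  have "Cn_on n S (\<lambda>x. frechet_derivative g (at x) v)" for v
    using Suc.IH[of "\<lambda>x. frechet_derivative f (at x) v" "\<lambda>x. frechet_derivative g (at x) v"] e Suc.prems(2) by simp
  with d show ?case by (auto simp: differentiable_def)
qed

lemma Cn_on_SucI:
  fixes f :: "'a::euclidean_space \<Rightarrow> 'b::euclidean_space"
  assumes "open S" "\<And>x. x \<in> S \<Longrightarrow> (f has_derivative f' x) (at x)" "\<And>v. Cn_on n S (\<lambda>x. f' x v)"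
  shows "Cn_on (Suc n) S f"
proof -
  have e: "frechet_derivative f (at x) = f' x" if "x \<in> S" for x
    using frechet_derivative_at[OF assms(2)[OF that]] by simp
  have "Cn_on n S (\<lambda>x. frechet_derivative f (at x) v)" for v
    by (rule Cn_on_cong[OF assms(1) _ assms(3)[of v]]) (simp add: e)
  with assms(2) show ?thesis by (auto simp: differentiable_def)
qed

lemma Cn_on_SucD:
  "Cn_on (Suc n) S f \<Longrightarrow> Cn_on n S f"
  by (induction n arbitrary: f) (auto intro!: continuous_at_imp_continuous_on differentiable_imp_continuous_within)

lemma Cn_on_le: "Cn_on n S f \<Longrightarrow> k \<le> n \<Longrightarrow> Cn_on k S f"
  by (induction n) (auto simp: le_Suc_eq dest: Cn_on_SucD simp del: Cn_on.simps)

lemma Cn_on_continuous_on: "Cn_on n S f \<Longrightarrow> continuous_on S f"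
  using Cn_on_le[of n S f 0] by simp

text \<open>
  Being of class $C^n$ is a local property, so that it can be checked in a different chart around
  each point.
\<close>

lemma Cn_on_local:
  assumes "\<And>x. x \<in> S \<Longrightarrow> \<exists>T. open T \<and> x \<in> T \<and> Cn_on n T f"
  shows "Cn_on n S f"
  using assms
proof (induction n arbitrary: f)
  case 0
  then show ?case
    by (auto intro!: continuous_at_imp_continuous_on simp: continuous_on_eq_continuous_at)
      (metis continuous_on_eq_continuous_at)
next
  case (Suc n)
  have "Cn_on n S (\<lambda>x. frechet_derivative f (at x) v)" for v
    by (rule Suc.IH) (use Suc.prems in fastforce)
  moreover have "f differentiable (at x)" if "x \<in> S" for x
    using Suc.prems[OF that] by auto
  ultimately show ?case by simp
qed

lemma Cn_on_const [simp]: "Cn_on n S (\<lambda>x. c)"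
  by (induction n arbitrary: c) auto

lemma Cn_on_linear:
  assumes "bounded_linear f"
  shows "Cn_on n S f"
proof (cases n)
  case 0
  then show ?thesis using assms by (simp add: linear_continuous_on)
next
  case (Suc k)
  have "Cn_on (Suc k) UNIV f"
    by (rule Cn_on_SucI[where f' = "\<lambda>_. f"]) (use assms in \<open>auto intro: bounded_linear_imp_has_derivative\<close>)
  then show ?thesis using Suc Cn_on_subset by blast
qed

lemma Cn_on_ident: "Cn_on n S (\<lambda>x. x)"
  by (rule Cn_on_linear) (rule bounded_linear_ident)

lemma Cn_on_add:
  fixes f g :: "'a::euclidean_space \<Rightarrow> 'b::euclidean_space"
  assumes "open S" "Cn_on n S f" "Cn_on n S g"
  shows "Cn_on n S (\<lambda>x. f x + g x)"
  using assms(2,3)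
proof (induction n arbitrary: f g)
  case 0 then show ?case by (simp add: continuous_on_add)
next
  case (Suc n)
  show ?case
    by (rule Cn_on_SucI[OF assms(1) has_derivative_add[OF Cn_on_has_derivative[OF Suc.prems(1)] Cn_on_has_derivative[OF Suc.prems(2)]]])
      (use Suc in auto)
qed

lemma Cn_on_bilinear:
  fixes p :: "'b::euclidean_space \<Rightarrow> 'c::euclidean_space \<Rightarrow> 'd::euclidean_space"
  assumes p: "bounded_bilinear p" and "open S" "Cn_on n S f" "Cn_on n S g"
  shows "Cn_on n S (\<lambda>x. p (f x) (g x))"
  using assms(3,4)
proof (induction n arbitrary: f g)
  case 0 then show ?case using bounded_bilinear.continuous_on[OF p] by auto
next
  case (Suc n)
  show ?case
    by (rule Cn_on_SucI[OF assms(2) bounded_bilinear.FDERIV[OF p Cn_on_has_derivative[OF Suc.prems(1)] Cn_on_has_derivative[OF Suc.prems(2)]]])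
      (use Suc.IH Suc.prems Cn_on_SucD[OF Suc.prems(1)] Cn_on_SucD[OF Suc.prems(2)] in \<open>auto intro!: Cn_on_add assms(2)\<close>)
qed

lemmas Cn_on_mult = Cn_on_bilinear[OF bounded_bilinear_mult]
lemmas Cn_on_scaleR = Cn_on_bilinear[OF bounded_bilinear_scaleR]

lemma Cn_on_minus:
  fixes f :: "'a::euclidean_space \<Rightarrow> 'b::euclidean_space"
  shows "open S \<Longrightarrow> Cn_on n S f \<Longrightarrow> Cn_on n S (\<lambda>x. - f x)"
  using Cn_on_scaleR[of S n "\<lambda>x. -1" f] by simp

lemma Cn_on_diff:
  fixes f g :: "'a::euclidean_space \<Rightarrow> 'b::euclidean_space"
  shows "open S \<Longrightarrow> Cn_on n S f \<Longrightarrow> Cn_on n S g \<Longrightarrow> Cn_on n S (\<lambda>x. f x - g x)"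
  using Cn_on_add[of S n f "\<lambda>x. - g x"] Cn_on_minus[of S n g] by simp

lemma Cn_on_sum:
  fixes f :: "'i \<Rightarrow> 'a::euclidean_space \<Rightarrow> 'b::euclidean_space"
  assumes "open S" "\<And>i. i \<in> I \<Longrightarrow> Cn_on n S (f i)"
  shows "Cn_on n S (\<lambda>x. \<Sum>i\<in>I. f i x)"
  using assms(2) by (induction I rule: infinite_finite_induct) (auto intro!: Cn_on_add assms(1))

lemma Cn_on_prod:
  fixes f :: "'i \<Rightarrow> 'a::euclidean_space \<Rightarrow> real"
  assumes "open S" "\<And>i. i \<in> I \<Longrightarrow> Cn_on n S (f i)"
  shows "Cn_on n S (\<lambda>x. \<Prod>i\<in>I. f i x)"
  using assms(2) by (induction I rule: infinite_finite_induct) (auto intro!: Cn_on_mult assms(1))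

lemma Cn_on_power:
  fixes f :: "'a::euclidean_space \<Rightarrow> real"
  assumes "open S" "Cn_on n S f"
  shows "Cn_on n S (\<lambda>x. f x ^ k)"
  by (induction k) (auto intro!: Cn_on_mult assms)

text \<open>
  The chain rule writes the directional derivative of $f \circ g$ as a sum of products of
  directional derivatives of \<open>f\<close> along the basis vectors with components of those of \<open>g\<close>, to which
  the induction hypothesis applies.
\<close>

lemma Cn_on_compose:
  fixes f :: "'b::euclidean_space \<Rightarrow> 'c::euclidean_space" and g :: "'a::euclidean_space \<Rightarrow> 'b"
  assumes S: "open S" and T: "open T" and f: "Cn_on n T f" and g: "Cn_on n S g" and sub: "g ` S \<subseteq> T"
  shows "Cn_on n S (\<lambda>x. f (g x))"
  using f g
proof (induction n arbitrary: f)
  case 0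
  then show ?case using continuous_on_compose2[OF _ _ sub] by auto
next
  case (Suc n)
  let ?D = "\<lambda>x. frechet_derivative f (at x)" and ?E = "\<lambda>x. frechet_derivative g (at x)"
  have d: "((\<lambda>x. f (g x)) has_derivative (\<lambda>v. ?D (g x) (?E x v))) (at x)" if "x \<in> S" for x
    using diff_chain_at[OF Cn_on_has_derivative[OF Suc.prems(2) that] Cn_on_has_derivative[OF Suc.prems(1)]] sub that
    by (auto simp: o_def)
  have e: "?D (g x) (?E x v) = (\<Sum>b\<in>Basis. (?E x v \<bullet> b) *\<^sub>R ?D (g x) b)" if "x \<in> S" for x v
  proof -
    have l: "linear (?D (g x))" using Suc.prems(1) sub that by (auto intro!: linear_frechet_derivative)
    have "?D (g x) (?E x v) = ?D (g x) (\<Sum>b\<in>Basis. (?E x v \<bullet> b) *\<^sub>R b)" by (simp add: euclidean_representation)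
    then show ?thesis by (simp add: linear_sum[OF l] linear_scale[OF l])
  qed
  have "Cn_on n S (\<lambda>x. \<Sum>b\<in>Basis. (?E x v \<bullet> b) *\<^sub>R ?D (g x) b)" for v
  proof (intro Cn_on_sum Cn_on_scaleR S)
    fix b :: 'b
    show "Cn_on n S (\<lambda>x. ?E x v \<bullet> b)"
      by (rule Cn_on_bilinear[OF bounded_bilinear_inner S]) (use Suc.prems(2) in auto)
    show "Cn_on n S (\<lambda>x. ?D (g x) b)"
      by (rule Suc.IH) (use Suc.prems Cn_on_SucD in auto)
  qed
  from Cn_on_cong[OF S _ this] have "Cn_on n S (\<lambda>x. ?D (g x) (?E x v))" for v
    using e by simp
  with Cn_on_SucI[OF S d] show ?case by blast
qed

lemma Cn_on_compose_linear:
  fixes f :: "'b::euclidean_space \<Rightarrow> 'c::euclidean_space" and g :: "'a::euclidean_space \<Rightarrow> 'b"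
  shows "open S \<Longrightarrow> bounded_linear f \<Longrightarrow> Cn_on n S g \<Longrightarrow> Cn_on n S (\<lambda>x. f (g x))"
  by (rule Cn_on_compose[where T = UNIV]) (auto intro: Cn_on_linear)

lemma Cn_on_nth:
  fixes f :: "'a::euclidean_space \<Rightarrow> real^'n"
  shows "open S \<Longrightarrow> Cn_on n S f \<Longrightarrow> Cn_on n S (\<lambda>x. f x $ i)"
  by (rule Cn_on_compose_linear[OF _ bounded_linear_vec_nth])

lemma Cn_on_vec:
  fixes f :: "'a::euclidean_space \<Rightarrow> 'n::finite \<Rightarrow> real"
  assumes S: "open S" and f: "\<And>i. Cn_on n S (\<lambda>x. f x i)"
  shows "Cn_on n S (\<lambda>x. \<chi> i. f x i)"
proof -
  have "Cn_on n S (\<lambda>x. \<Sum>i\<in>UNIV. f x i *\<^sub>R axis i (1::real))"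
    by (intro Cn_on_sum Cn_on_scaleR S f) auto
  moreover have "(\<chi> i. f x i) = (\<Sum>i\<in>UNIV. f x i *\<^sub>R axis i (1::real))" for x
    by (simp add: vec_eq_iff axis_def if_distrib[of "\<lambda>t. _ * t"] cong: if_cong)
  ultimately show ?thesis by simp
qed

lemma Cn_on_inverse_real: "Cn_on n {x::real. x \<noteq> 0} inverse"
proof (induction n)
  case 0 show ?case by (auto intro!: continuous_intros)
next
  case (Suc n)
  have o: "open {x::real. x \<noteq> 0}" by (simp add: open_Collect_neq)
  show ?case
    by (rule Cn_on_SucI[OF o has_derivative_inverse'])
      (auto intro!: Cn_on_mult Cn_on_minus o Suc)
qed

lemma Cn_on_sqrt_real: "Cn_on n {x::real. x > 0} sqrt"
proof (induction n)
  case 0 show ?case by (auto intro!: continuous_intros)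
next
  case (Suc n)
  have o: "open {x::real. x > 0}" by (simp add: open_Collect_less)
  show ?case
  proof (rule Cn_on_SucI[OF o])
    fix x :: real assume "x \<in> {x. x > 0}"
    then have "(sqrt has_derivative (*) (inverse (sqrt x) / 2)) (at x)"
      using DERIV_real_sqrt[of x] by (simp add: has_field_derivative_def)
    then show "(sqrt has_derivative (\<lambda>v. inverse (2 * sqrt x) * v)) (at x)"
      by (rule has_derivative_eq_rhs) auto
  next
    show "Cn_on n {x. x > 0} (\<lambda>x. inverse (2 * sqrt x) * v)" for v
      by (intro Cn_on_mult o Cn_on_compose[OF o _ Cn_on_inverse_real] Suc Cn_on_const)
        (auto simp: open_Collect_neq)
  qed
qed

lemma Cn_on_inverse:
  fixes f :: "'a::euclidean_space \<Rightarrow> real"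
  assumes "open S" "Cn_on n S f" "\<And>x. x \<in> S \<Longrightarrow> f x \<noteq> 0"
  shows "Cn_on n S (\<lambda>x. inverse (f x))"
  by (rule Cn_on_compose[OF assms(1) _ Cn_on_inverse_real assms(2)]) (use assms(3) in \<open>auto simp: open_Collect_neq\<close>)

lemma Cn_on_divide:
  fixes f :: "'a::euclidean_space \<Rightarrow> real"
  assumes "open S" "Cn_on n S f" "Cn_on n S g" "\<And>x. x \<in> S \<Longrightarrow> g x \<noteq> 0"
  shows "Cn_on n S (\<lambda>x. f x / g x)"
  unfolding divide_inverse by (intro Cn_on_mult Cn_on_inverse assms)

lemma Cn_on_sqrt:
  fixes f :: "'a::euclidean_space \<Rightarrow> real"
  assumes "open S" "Cn_on n S f" "\<And>x. x \<in> S \<Longrightarrow> f x > 0"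
  shows "Cn_on n S (\<lambda>x. sqrt (f x))"
  by (rule Cn_on_compose[OF assms(1) _ Cn_on_sqrt_real assms(2)]) (use assms(3) in \<open>auto simp: open_Collect_less\<close>)

text \<open>
  The profile of the bump functions from which partitions of unity of class $C^n$ are built.
\<close>

lemma Cn_on_max_power: "Cn_on n S (\<lambda>x::real. max 0 x ^ Suc n)"
proof -
  have "Cn_on n UNIV (\<lambda>x::real. max 0 x ^ Suc n)"
  proof (induction n)
    case 0 show ?case by (auto intro!: continuous_intros)
  next
    case (Suc n)
    have d: "((\<lambda>x::real. max 0 x ^ Suc (Suc n)) has_derivative (\<lambda>v. (real (Suc (Suc n)) * max 0 x ^ Suc n) * v)) (at x)" for x :: real
    proof -
      have u: "{0..} \<union> {..<0} = (UNIV :: real set)" by auto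
      have "((\<lambda>x::real. if x \<in> {0..} then x ^ Suc (Suc n) else 0) has_derivative
        (if x \<in> {0..} then (\<lambda>v. (real (Suc (Suc n)) * x ^ Suc n) * v) else (\<lambda>v. 0))) (at x within {0..} \<union> {..<0})"
        using DERIV_pow[of "Suc (Suc n)" x] unfolding has_field_derivative_def
        by (intro has_derivative_If_within_closures[where f' = "\<lambda>x v. (real (Suc (Suc n)) * x ^ Suc n) * v" and g' = "\<lambda>x v. 0"])
          (auto intro: has_derivative_at_withinI)
      then have "((\<lambda>x::real. if x \<in> {0..} then x ^ Suc (Suc n) else 0) has_derivative
        (\<lambda>v. (real (Suc (Suc n)) * max 0 x ^ Suc n) * v)) (at x)"
        unfolding u by (rule has_derivative_eq_rhs) (auto simp: max_def)
      moreover have "(\<lambda>x::real. if x \<in> {0..} then x ^ Suc (Suc n) else 0) = (\<lambda>x. max 0 x ^ Suc (Suc n))"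
        by (auto simp: max_def)
      ultimately show ?thesis by simp
    qed
    show ?case
      by (rule Cn_on_SucI[OF open_UNIV d]) (intro Cn_on_mult Suc Cn_on_const open_UNIV)
  qed
  then show ?thesis using Cn_on_subset by blast
qed

lemma Cn_on_det:
  fixes M :: "'a::euclidean_space \<Rightarrow> real^'n^'n"
  assumes "open S" "\<And>i j. Cn_on n S (\<lambda>x. M x $ i $ j)"
  shows "Cn_on n S (\<lambda>x. det (M x))"
  unfolding det_def by (intro Cn_on_sum Cn_on_mult Cn_on_prod assms Cn_on_const)

text \<open>Cramer's rule exhibits the solution of a linear system as a rational function of its data.\<close>

lemma Cn_on_linear_system:
  fixes M :: "'a::euclidean_space \<Rightarrow> real^'n^'n" and u b :: "'a \<Rightarrow> real^'n"
  assumes S: "open S" and M: "\<And>i j. Cn_on n S (\<lambda>x. M x $ i $ j)" and b: "Cn_on n S b"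
    and det: "\<And>x. x \<in> S \<Longrightarrow> det (M x) \<noteq> 0" and eq: "\<And>x. x \<in> S \<Longrightarrow> M x *v u x = b x"
  shows "Cn_on n S u"
proof (rule Cn_on_cong[OF S])
  let ?w = "\<lambda>x. \<chi> k. det (\<chi> i j. if j = k then b x $ i else M x $ i $ j) / det (M x)"
  show "?w x = u x" if "x \<in> S" for x
    using cramer[OF det[OF that], of "u x" "b x"] eq[OF that] by simp
  show "Cn_on n S ?w"
  proof (intro Cn_on_vec Cn_on_divide Cn_on_det S M det)
    show "Cn_on n S (\<lambda>x. (\<chi> i j. if j = k then b x $ i else M x $ i $ j) $ i $ j)" for k i j
      using M[of i j] Cn_on_nth[OF S b, of i] by (cases "j = k") auto
  qed
qed


lemma matrix_mult_linear:
  fixes f :: "real^'m \<Rightarrow> real^'n"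
  assumes "linear f"
  shows "matrix f *v x = f x"
  using matrix_vector_mul(2)[OF assms] by metis

lemma has_derivative_sqrt:
  fixes q :: "'a::real_normed_vector \<Rightarrow> real"
  assumes "(q has_derivative q') (at x)" "q x > 0"
  shows "((\<lambda>x. sqrt (q x)) has_derivative (\<lambda>h. inverse (sqrt (q x)) / 2 * q' h)) (at x)"
  using has_derivative_compose[OF assms(1), of sqrt "(*) (inverse (sqrt (q x)) / 2)"] DERIV_real_sqrt[OF assms(2)]
  by (simp add: has_field_derivative_def)

lemma bounded_linear_frechet:
  "Cn_on (Suc n) S f \<Longrightarrow> x \<in> S \<Longrightarrow> bounded_linear (frechet_derivative f (at x))"
  using Cn_on_has_derivative has_derivative_bounded_linear by blast

lemma Cn_on_frechet: "Cn_on (Suc n) S f \<Longrightarrow> Cn_on n S (\<lambda>x. frechet_derivative f (at x) v)"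
  by simp

text \<open>
  A local inverse satisfies $Dg(y) = Df(g(y))^{-1}$, so that each order of differentiability of
  \<open>g\<close> yields the next one.
\<close>

lemma Cn_inverse_function:
  fixes f :: "real^'m \<Rightarrow> real^'m"
  assumes U: "open U" and f: "Cn_on (Suc n) U f" and x0: "x0 \<in> U" "inj (frechet_derivative f (at x0))"
  obtains U' V g where "open U'" "U' \<subseteq> U" "x0 \<in> U'" "open V" "homeomorphism U' V f g" "Cn_on (Suc n) V g"
    "\<And>x. x \<in> U' \<Longrightarrow> inj (frechet_derivative f (at x))"
proof -
  define D where "D x = frechet_derivative f (at x)" for x
  define B where "B x = Blinfun (D x)" for x
  have bl: "bounded_linear (D x)" if "x \<in> U" for x
    using bounded_linear_frechet[OF f that] by (simp add: D_def)
  have B: "blinfun_apply (B x) = D x" if "x \<in> U" for x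
    using bounded_linear_Blinfun_apply[OF bl[OF that]] by (simp add: B_def)
  have d: "(f has_derivative blinfun_apply (B x)) (at x)" if "x \<in> U" for x
    using Cn_on_has_derivative[OF f that] B[OF that] by (simp add: D_def)
  have c: "continuous_on U B"
  proof (rule continuous_on_blinfun_componentwise)
    fix i :: "real^'m"
    have "continuous_on U (\<lambda>x. D x i)" using Cn_on_continuous_on[OF Cn_on_frechet[OF f]] by (simp add: D_def)
    then show "continuous_on U (\<lambda>x. blinfun_apply (B x) i)" using B by (simp cong: continuous_on_cong)
  qed
  have "inj (D x0)" "linear (D x0)" using x0 bl bounded_linear.linear by (auto simp: D_def)
  then obtain h where h: "linear h" "h \<circ> D x0 = id" using linear_injective_left_inverse by blast
  have "Blinfun h o\<^sub>L B x0 = id_blinfun"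
    using h B[OF x0(1)] by (auto intro!: blinfun_eqI simp: bounded_linear_Blinfun_apply linear_conv_bounded_linear fun_eq_iff)
  from inverse_function_theorem[OF U d c x0(1) this]
  obtain U' V g g' where *: "open U'" "U' \<subseteq> U" "x0 \<in> U'" "open V" "homeomorphism U' V f g"
    "\<And>y. y \<in> V \<Longrightarrow> (g has_derivative g' y) (at y)"
    "\<And>y. y \<in> V \<Longrightarrow> g' y = inv (blinfun_apply (B (g y)))"
    "\<And>y. y \<in> V \<Longrightarrow> bij (blinfun_apply (B (g y)))"
    by metis
  have gU: "g y \<in> U'" "g y \<in> U" if "y \<in> V" for y using *(2,5) that by (auto simp: homeomorphism_def)
  have inj: "inj (D x)" if "x \<in> U'" for x
    using *(8)[of "f x"] *(2,5) B that by (metis bij_is_inj homeomorphism_apply1 homeomorphism_image1 imageI subsetD)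
  have "Cn_on k V g" if "k \<le> Suc n" for k
    using that
  proof (induction k)
    case 0
    then show ?case using *(5) by (simp add: homeomorphism_def)
  next
    case (Suc k)
    show ?case
    proof (rule Cn_on_SucI[OF *(4) *(6)])
      fix v :: "real^'m"
      show "Cn_on k V (\<lambda>y. g' y v)"
      proof (rule Cn_on_linear_system[where M = "\<lambda>y. matrix (D (g y))" and b = "\<lambda>y. v", OF *(4)])
        have "Cn_on k U (\<lambda>x. D x v)" for v
          using Cn_on_le[OF Cn_on_frechet[OF f], of k v] Suc.prems unfolding D_def by simp
        then have "Cn_on k V (\<lambda>y. D (g y) v)" for v
          by (rule Cn_on_compose[OF *(4) U]) (use Suc gU(2) in auto)
        from Cn_on_nth[OF *(4) this] show "Cn_on k V (\<lambda>y. matrix (D (g y)) $ i $ j)" for i j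
          by (simp add: matrix_def)
      next
        fix y assume y: "y \<in> V"
        have lin: "linear (D (g y))" using bl[OF gU(2)[OF y]] by (rule bounded_linear.linear)
        have bij: "bij (D (g y))" using *(8)[OF y] B[OF gU(2)[OF y]] by simp
        show "det (matrix (D (g y))) \<noteq> 0"
          using det_nz_iff_inj[OF lin] bij by (simp add: bij_is_inj)
        show "matrix (D (g y)) *v g' y v = v"
          using *(7)[OF y] B[OF gU(2)[OF y]] bij by (simp add: matrix_mult_linear[OF lin] surj_f_inv_f bij_is_surj)
      qed simp
    qed
  qed
  then show thesis using that[OF *(1-5) _ inj[unfolded D_def]] by blast
qed

text \<open>
  Let $p(s,t) = f(x + s w + t v)$. Differentiating
  $p(s,t) - p(s,0) = \int_0^t \partial_2 p(s,\tau)\, d\tau$ under the integral sign with respect to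
  \<open>s\<close> and then with respect to \<open>t\<close> gives $\partial_2\partial_1 p = \partial_1\partial_2 p$.
\<close>

lemma frechet_derivative_commute:
  fixes f :: "'a::euclidean_space \<Rightarrow> 'b::euclidean_space"
  assumes S: "open S" and f: "Cn_on (Suc (Suc 0)) S f" and x: "x \<in> S"
  shows "frechet_derivative (\<lambda>y. frechet_derivative f (at y) v) (at x) w =
    frechet_derivative (\<lambda>y. frechet_derivative f (at y) w) (at x) v"
proof -
  let ?D = "\<lambda>f x. frechet_derivative f (at x)"
  define E where "E u y = ?D f y u" for u y
  have E1: "Cn_on (Suc 0) S (E u)" for u using Cn_on_frechet[OF f] by (simp add: E_def[abs_def])
  have dE: "(E u has_derivative ?D (E u) y) (at y)" if "y \<in> S" for u y
    by (rule Cn_on_has_derivative[OF E1 that])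
  have df: "(f has_derivative (\<lambda>u. E u y)) (at y)" if "y \<in> S" for y
    using Cn_on_has_derivative[OF f that] by (simp add: E_def)
  obtain e where e: "e > 0" "ball x e \<subseteq> S" using S x open_contains_ball by blast
  \<comment> \<open>With this choice the parallelogram $x + s w + t v$, $|s|, |t| \<le> r$, stays in the ball of radius $e$.\<close>
  define r where "r = e / (2 * (norm v + norm w + 1))"
  have np: "norm v + norm w + 1 > 0" using norm_ge_zero[of v] norm_ge_zero[of w] by linarith
  have r: "r > 0" unfolding r_def using e np by simp
  have inS: "x + s *\<^sub>R w + t *\<^sub>R v \<in> S" if "\<bar>s\<bar> \<le> r" "\<bar>t\<bar> \<le> r" for s t
  proof -
    have "norm (s *\<^sub>R w + t *\<^sub>R v) \<le> \<bar>s\<bar> * norm w + \<bar>t\<bar> * norm v"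
      using norm_triangle_ineq[of "s *\<^sub>R w" "t *\<^sub>R v"] by simp
    also have "\<dots> \<le> r * norm w + r * norm v" using that by (intro add_mono mult_right_mono) auto
    also have "\<dots> \<le> r * (norm v + norm w + 1)" using r by (simp add: algebra_simps)
    also have "\<dots> = e / 2"
    proof -
      have "e / (2 * N) * N = e / 2" if "N > 0" for N using that by simp
      from this[OF np] show ?thesis by (simp add: r_def)
    qed
    also have "\<dots> < e" using e by simp
    finally show ?thesis using e(2) by (auto simp: dist_norm add.assoc norm_minus_commute add.commute intro!: subsetD[OF e(2)])
  qed
  have lin: "linear (\<lambda>u. E u y)" if "y \<in> S" for y using df[OF that] has_derivative_linear by blast
  have linE: "linear (?D (E u) y)" if "y \<in> S" for u y using dE[OF that] has_derivative_linear by blast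
  have main: "E w (x + t *\<^sub>R v) - E w x = integral {0..t} (\<lambda>\<tau>. ?D (E v) (x + \<tau> *\<^sub>R v) w)"
    if t: "t \<in> {0..r}" for t
  proof -
    have ftc: "((\<lambda>\<tau>. E v (x + s *\<^sub>R w + \<tau> *\<^sub>R v)) has_integral
        f (x + s *\<^sub>R w + t *\<^sub>R v) - f (x + s *\<^sub>R w + 0 *\<^sub>R v)) {0..t}" if s: "s \<in> {-r..r}" for s
    proof (rule fundamental_theorem_of_calculus)
      fix \<tau> assume \<tau>: "\<tau> \<in> {0..t}"
      have i: "x + s *\<^sub>R w + \<tau> *\<^sub>R v \<in> S" using inS s \<tau> t by auto
      have "((\<lambda>\<tau>. f (x + s *\<^sub>R w + \<tau> *\<^sub>R v)) has_derivative (\<lambda>h. E (h *\<^sub>R v) (x + s *\<^sub>R w + \<tau> *\<^sub>R v))) (at \<tau> within {0..t})"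
        by (rule has_derivative_compose[where g = f and f = "\<lambda>\<tau>. x + s *\<^sub>R w + \<tau> *\<^sub>R v", OF _ df[OF i]]) (auto intro!: derivative_eq_intros)
      then show "((\<lambda>\<tau>. f (x + s *\<^sub>R w + \<tau> *\<^sub>R v)) has_vector_derivative E v (x + s *\<^sub>R w + \<tau> *\<^sub>R v)) (at \<tau> within {0..t})"
        by (simp add: has_vector_derivative_def linear_scale[OF lin[OF i]])
    qed (use t in auto)
    have L: "((\<lambda>s. integral (cbox 0 t) (\<lambda>\<tau>. E v (x + s *\<^sub>R w + \<tau> *\<^sub>R v))) has_vector_derivative
      integral (cbox 0 t) (\<lambda>\<tau>. ?D (E v) (x + 0 *\<^sub>R w + \<tau> *\<^sub>R v) w)) (at 0 within {-r..r})"
    proof (rule leibniz_rule_vector_derivative)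
      fix s \<tau> assume *: "s \<in> {-r..r}" "\<tau> \<in> cbox 0 t"
      have i: "x + s *\<^sub>R w + \<tau> *\<^sub>R v \<in> S" using inS * t by auto
      have "((\<lambda>s. E v (x + s *\<^sub>R w + \<tau> *\<^sub>R v)) has_derivative (\<lambda>h. ?D (E v) (x + s *\<^sub>R w + \<tau> *\<^sub>R v) (h *\<^sub>R w))) (at s within {-r..r})"
        by (rule has_derivative_compose[where g = "E v" and f = "\<lambda>s. x + s *\<^sub>R w + \<tau> *\<^sub>R v", OF _ dE[OF i]]) (auto intro!: derivative_eq_intros)
      then show "((\<lambda>s. E v (x + s *\<^sub>R w + \<tau> *\<^sub>R v)) has_vector_derivative ?D (E v) (x + s *\<^sub>R w + \<tau> *\<^sub>R v) w) (at s within {-r..r})"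
        by (simp add: has_vector_derivative_def linear_scale[OF linE[OF i]])
    next
      show "(\<lambda>\<tau>. E v (x + s *\<^sub>R w + \<tau> *\<^sub>R v)) integrable_on cbox 0 t" if "s \<in> {-r..r}" for s
        using ftc[OF that] by (auto simp: integrable_on_def)
    next
      have "continuous_on S (\<lambda>y. ?D (E v) y w)" using E1 by simp
      then show "continuous_on ({-r..r} \<times> cbox 0 t) (\<lambda>(s, \<tau>). ?D (E v) (x + s *\<^sub>R w + \<tau> *\<^sub>R v) w)"
        unfolding split_beta
        by (rule continuous_on_compose2) (use t inS in \<open>auto intro!: continuous_intros\<close>)
    qed (use r in auto)
    have a: "((\<lambda>s. f (x + s *\<^sub>R w + t *\<^sub>R v) - f (x + s *\<^sub>R w)) has_vector_derivative
      integral {0..t} (\<lambda>\<tau>. ?D (E v) (x + \<tau> *\<^sub>R v) w)) (at 0 within {-r..r})"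
      by (rule has_vector_derivative_transform[OF _ _ L[simplified]]) (use r integral_unique[OF ftc] in auto)
    have i: "x + 0 *\<^sub>R w + t *\<^sub>R v \<in> S" "x + 0 *\<^sub>R w \<in> S" using inS[of 0 t] inS[of 0 0] t r by auto
    have "((\<lambda>s. f (x + s *\<^sub>R w + t *\<^sub>R v) - f (x + s *\<^sub>R w)) has_derivative
      (\<lambda>h. E (h *\<^sub>R w) (x + 0 *\<^sub>R w + t *\<^sub>R v) - E (h *\<^sub>R w) (x + 0 *\<^sub>R w))) (at 0 within {-r..r})"
      by (intro has_derivative_diff has_derivative_compose[where g = f and f = "\<lambda>s. x + s *\<^sub>R w + t *\<^sub>R v", OF _ df[OF i(1)]]
          has_derivative_compose[where g = f and f = "\<lambda>s. x + s *\<^sub>R w", OF _ df[OF i(2)]]) (auto intro!: derivative_eq_intros)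
    then have b: "((\<lambda>s. f (x + s *\<^sub>R w + t *\<^sub>R v) - f (x + s *\<^sub>R w)) has_vector_derivative
      E w (x + t *\<^sub>R v) - E w x) (at 0 within {-r..r})"
      using linear_scale[OF lin[OF i(1)]] linear_scale[OF lin[OF i(2)]]
      by (simp add: has_vector_derivative_def scaleR_diff_right)
    show ?thesis
      by (rule vector_derivative_unique_within[OF _ b a]) (use r in \<open>auto simp: trivial_limit_within islimpt_Icc\<close>)
  qed
  have c: "continuous_on {0..r} (\<lambda>\<tau>. ?D (E v) (x + \<tau> *\<^sub>R v) w)"
  proof -
    have "continuous_on S (\<lambda>y. ?D (E v) y w)" using E1 by simp
    then show ?thesis
      by (rule continuous_on_compose2) (use inS[of 0] r in \<open>auto intro!: continuous_intros\<close>)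
  qed
  from integral_has_vector_derivative[OF this, of 0]
  have L: "((\<lambda>t. integral {0..t} (\<lambda>\<tau>. ?D (E v) (x + \<tau> *\<^sub>R v) w)) has_vector_derivative ?D (E v) x w) (at 0 within {0..r})"
    using r by simp
  have a: "((\<lambda>t. E w (x + t *\<^sub>R v) - E w x) has_vector_derivative ?D (E v) x w) (at 0 within {0..r})"
    by (rule has_vector_derivative_transform[OF _ _ L]) (use r main in auto)
  have i: "x + 0 *\<^sub>R v \<in> S" using x by simp
  have "((\<lambda>t. E w (x + t *\<^sub>R v) - E w x) has_derivative (\<lambda>h. ?D (E w) (x + 0 *\<^sub>R v) (h *\<^sub>R v) - 0)) (at 0 within {0..r})"
    by (intro has_derivative_diff has_derivative_const
        has_derivative_compose[where g = "E w" and f = "\<lambda>t. x + t *\<^sub>R v", OF _ dE[OF i]]) (auto intro!: derivative_eq_intros)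
  then have b: "((\<lambda>t. E w (x + t *\<^sub>R v) - E w x) has_vector_derivative ?D (E w) x v) (at 0 within {0..r})"
    using linear_scale[OF linE[OF x]] by (simp add: has_vector_derivative_def)
  have "?D (E v) x w = ?D (E w) x v"
    by (rule vector_derivative_unique_within[OF _ a b]) (use r in \<open>auto simp: trivial_limit_within islimpt_Icc\<close>)
  then show ?thesis by (simp add: E_def[abs_def])
qed

section \<open>Determinants\<close>

text \<open>
  Expansion along the unit columns: a permutation contributes only if it fixes the indices
  outside the range of \<open>\<iota>\<close>.
\<close>

lemma det_unit_columns:
  fixes M :: "real^'m^'m" and \<iota> :: "'n::finite \<Rightarrow> 'm"
  assumes inj: "inj \<iota>" and unit: "\<And>i j. j \<notin> range \<iota> \<Longrightarrow> M $ i $ j = (if i = j then 1 else 0)"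
  shows "det M = det (\<chi> a b. M $ \<iota> a $ \<iota> b)"
proof -
  let ?term = "\<lambda>p. of_int (sign p) * (\<Prod>i\<in>UNIV. M $ i $ p i)"
  have bij: "bij_betw \<iota> UNIV (range \<iota>)" using inj by (simp add: inj_on_imp_bij_betw)
  have "?term p = 0" if p: "p permutes UNIV" "\<not> p permutes range \<iota>" for p
  proof -
    obtain j where j: "j \<notin> range \<iota>" "p j \<noteq> j"
      using p unfolding permutes_def by blast
    obtain i where i: "p i = j" using p(1) unfolding permutes_def by blast
    have "i \<noteq> j" using i j by auto
    then have "M $ i $ p i = 0" using unit[OF j(1)] i by simp
    then have "(\<Prod>i\<in>UNIV. M $ i $ p i) = 0" by (intro prod_zero) auto
    then show ?thesis by simp
  qed
  then have "det M = (\<Sum>p | p permutes range \<iota>. ?term p)"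
    unfolding det_def
    by (intro sum.mono_neutral_right) (auto simp: finite_permutations permutes_subset)
  also have "\<dots> = (\<Sum>q | q permutes UNIV. of_int (sign q) * (\<Prod>a\<in>UNIV. M $ \<iota> a $ \<iota> (q a)))"
  proof (rule sum.reindex_bij_witness[where i = "map_permutation UNIV \<iota>" and j = "map_permutation (range \<iota>) (inv \<iota>)"])
    fix p assume p: "p \<in> {p. p permutes range \<iota>}"
    have bij': "bij_betw (inv \<iota>) (range \<iota>) UNIV" using bij inj by (simp add: bij_betw_inv_into)
    let ?q = "map_permutation (range \<iota>) (inv \<iota>) p"
    show "map_permutation UNIV \<iota> ?q = p"
      by (rule map_permutation_compose_inv[OF bij']) (use p in \<open>auto simp: f_inv_into_f\<close>)
    then have *: "p = map_permutation UNIV \<iota> ?q" by simp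
    show q: "?q \<in> {q. q permutes UNIV}" using map_permutation_permutes[OF bij'] p by simp
    have "sign ?q = sign p" using sign_map_permutation[of "inv \<iota>" "range \<iota>" p] p by (simp add: inj_on_inv_into)
    moreover have "p (\<iota> a) = \<iota> (?q a)" for a
      by (subst *) (rule map_permutation_apply[OF inj], simp)
    then have "(\<Prod>i\<in>range \<iota>. M $ i $ p i) = (\<Prod>a\<in>UNIV. M $ \<iota> a $ \<iota> (?q a))"
      by (subst prod.reindex[OF inj]) simp
    moreover have "(\<Prod>i\<in>UNIV. M $ i $ p i) = (\<Prod>i\<in>range \<iota>. M $ i $ p i)"
      by (rule prod.mono_neutral_right) (use unit p permutes_not_in in \<open>fastforce+\<close>)
    ultimately show "of_int (sign ?q) * (\<Prod>a\<in>UNIV. M $ \<iota> a $ \<iota> (?q a)) = ?term p" by simp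
  next
    fix q assume q: "q \<in> {q. q permutes (UNIV :: 'n set)}"
    show "map_permutation (range \<iota>) (inv \<iota>) (map_permutation UNIV \<iota> q) = q"
      by (rule map_permutation_compose_inv[OF bij]) (use q inj in auto)
    show "map_permutation UNIV \<iota> q \<in> {p. p permutes range \<iota>}"
      using map_permutation_permutes[OF bij] q by simp
  qed
  finally show ?thesis by (simp add: det_def)
qed

lemma det_reindex:
  fixes M :: "real^'m^'m" and \<iota> :: "'n::finite \<Rightarrow> 'm"
  assumes "bij \<iota>"
  shows "det (\<chi> a b. M $ \<iota> a $ \<iota> b) = det M"
  using det_unit_columns[of \<iota> M] assms by (simp add: bij_def)

lemma det_single_row:
  fixes v :: "real^'m"
  shows "det (\<chi> i. if i = j then v else axis i 1) = v $ j"
proof -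
  let ?M = "\<chi> i. if i = j then v else axis i 1"
  \<comment> \<open>The transposed matrix has unit columns at all indices but one, which leaves a minor of size one.\<close>
  let ?i = "\<lambda>_ :: 1. j"
  have "inj ?i" by (simp add: inj_on_def)
  then have "det (transpose ?M) = det (\<chi> a b. transpose ?M $ ?i a $ ?i b)"
    by (rule det_unit_columns) (auto simp: transpose_def axis_def)
  then have "det (transpose ?M) = v $ j" by (simp add: det_1 transpose_def)
  moreover have "det (transpose ?M) = det ?M" by (rule det_transpose)
  ultimately show ?thesis by metis
qed

lemma has_derivative_det:
  fixes M :: "'a::real_normed_vector \<Rightarrow> real^'m^'m"
  assumes "(M has_derivative M') (at x within S)"
  shows "((\<lambda>x. det (M x)) has_derivative (\<lambda>h. \<Sum>j\<in>UNIV. det (\<chi> i. if i = j then M' h $ i else M x $ i))) (at x within S)"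
proof -
  have d: "((\<lambda>x. M x $ i $ j) has_derivative (\<lambda>h. M' h $ i $ j)) (at x within S)" for i j
    by (intro bounded_linear.has_derivative[OF bounded_linear_vec_nth] assms)
  have "((\<lambda>x. det (M x)) has_derivative
    (\<lambda>h. \<Sum>p | p permutes UNIV. of_int (sign p) * (\<Sum>j\<in>UNIV. M' h $ j $ p j * (\<Prod>i\<in>UNIV - {j}. M x $ i $ p i)))) (at x within S)"
    unfolding det_def by (intro has_derivative_sum has_derivative_mult_right has_derivative_prod d)
  moreover have "(\<Sum>p | p permutes UNIV. of_int (sign p) * (\<Sum>j\<in>UNIV. M' h $ j $ p j * (\<Prod>i\<in>UNIV - {j}. M x $ i $ p i)))
    = (\<Sum>j\<in>UNIV. det (\<chi> i. if i = j then M' h $ i else M x $ i))" for h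
  proof -
    have "(\<Prod>i\<in>UNIV. (\<chi> i. if i = j then M' h $ i else M x $ i) $ i $ p i) =
        M' h $ j $ p j * (\<Prod>i\<in>UNIV - {j}. M x $ i $ p i)" for j p
      by (subst prod.remove[of _ j]) (auto intro!: prod.cong)
    then show ?thesis
      unfolding det_def by (subst sum.swap) (simp add: sum_distrib_left)
  qed
  ultimately show ?thesis by simp
qed

text \<open>
  Both sides are the derivative at $t = 0$ of $\det (V (1 + tN)) = \det V \det (1 + tN)$.
\<close>

lemma sum_det_replace_row:
  fixes V N :: "real^'m^'m"
  shows "(\<Sum>j\<in>UNIV. det (\<chi> i. if i = j then V $ i v* N else V $ i)) = trace N * det V"
proof -
  have d: "((\<lambda>t. det (A ** (mat 1 + t *\<^sub>R N))) has_derivative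
     (\<lambda>h. \<Sum>j\<in>UNIV. det (\<chi> i. if i = j then (h *\<^sub>R (A ** N)) $ i else A $ i))) (at 0)" for A :: "real^'m^'m"
  proof -
    have der: "((\<lambda>t. A + t *\<^sub>R (A ** N)) has_derivative (\<lambda>h. h *\<^sub>R (A ** N))) (at 0)"
      by (auto intro!: derivative_eq_intros)
    have eq: "A + t *\<^sub>R (A ** N) = A ** (mat 1 + t *\<^sub>R N)" for t
      by (simp add: matrix_add_ldistrib matrix_scalar_ac scalar_matrix_assoc)
    show ?thesis using has_derivative_det[OF der]
      by (simp only: eq scaleR_zero_left add_0_right matrix_mul_rid)
  qed
  have row: "(A ** N) $ i = A $ i v* N" for A :: "real^'m^'m" and i
    by (simp add: matrix_matrix_mult_def vector_matrix_mult_def vec_eq_iff mult.commute)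
  have unit: "(mat 1 :: real^'m^'m) $ i = axis i 1" for i
    by (simp add: mat_def axis_def vec_eq_iff eq_commute)
  have "((\<lambda>t. det V * det (mat 1 ** (mat 1 + t *\<^sub>R N))) has_derivative
     (\<lambda>h. det V * (\<Sum>j\<in>UNIV. det (\<chi> i. if i = j then (h *\<^sub>R (mat 1 ** N)) $ i else mat 1 $ i)))) (at 0)"
    by (intro has_derivative_mult_right d)
  then have "((\<lambda>t. det (V ** (mat 1 + t *\<^sub>R N))) has_derivative
     (\<lambda>h. det V * (\<Sum>j\<in>UNIV. det (\<chi> i. if i = j then (h *\<^sub>R N) $ i else axis i 1)))) (at 0)"
    by (simp add: det_mul unit cong: if_cong)
  from has_derivative_unique[OF d this]
  have "(\<Sum>j\<in>UNIV. det (\<chi> i. if i = j then (1 *\<^sub>R (V ** N)) $ i else V $ i)) =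
     det V * (\<Sum>j\<in>UNIV. det (\<chi> i. if i = j then (1 *\<^sub>R N) $ i else axis i 1))" by metis
  moreover have "det (\<chi> i. if i = j then N $ i else axis i 1) = N $ j $ j" for j
  proof -
    have "(\<chi> i. if i = j then N $ i else axis i 1) = (\<chi> i. if i = j then N $ j else axis i 1)"
      by (simp add: vec_eq_iff)
    then show ?thesis using det_single_row[of j "N $ j"] by simp
  qed
  ultimately show ?thesis by (simp add: row trace_def mult.commute cong: if_cong)
qed

definition tr :: "(real^'m \<Rightarrow> real^'m) \<Rightarrow> real" where
  "tr L = (\<Sum>i\<in>UNIV. L (axis i 1) $ i)"

text \<open>
  This sum occurs in the Lie derivative of a top degree form, with \<open>L\<close> the derivative of the
  vector field.
\<close>

lemma sum_det_replace_row_linear: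
  fixes V :: "real^'m^'m"
  assumes "linear L"
  shows "(\<Sum>j\<in>UNIV. det (\<chi> i. if i = j then L (V $ j) else V $ i)) = tr L * det V"
proof -
  have "(\<chi> i. if i = j then L (V $ j) else V $ i) = (\<chi> i. if i = j then V $ i v* transpose (matrix L) else V $ i)" for j
    using matrix_mult_linear[OF assms] by (simp add: vec_eq_iff)
  then show ?thesis
    using sum_det_replace_row[of V "transpose (matrix L)"] by (simp add: trace_def transpose_def matrix_def tr_def)
qed

section \<open>Inner products and their Gram matrices\<close>

definition gram :: "(real^'m \<Rightarrow> real^'m \<Rightarrow> real) \<Rightarrow> real^'m^'m" where
  "gram \<alpha> = (\<chi> i j. \<alpha> (axis i 1) (axis j 1))"

definition inner_form :: "(real^'m \<Rightarrow> real^'m \<Rightarrow> real) \<Rightarrow> bool" where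
  "inner_form \<alpha> \<longleftrightarrow> bilinear \<alpha> \<and> (\<forall>v w. \<alpha> v w = \<alpha> w v) \<and> (\<forall>v. v \<noteq> 0 \<longrightarrow> \<alpha> v v > 0)"

lemma vec_axis_expansion: "(v::real^'m) = (\<Sum>i\<in>UNIV. (v $ i) *\<^sub>R axis i 1)"
  by (simp add: vec_eq_iff axis_def if_distrib[of "\<lambda>t. _ * t"] cong: if_cong)

lemma linear_axis_expansion:
  fixes L :: "real^'m \<Rightarrow> 'b::real_vector"
  assumes "linear L" shows "L v = (\<Sum>i\<in>UNIV. (v $ i) *\<^sub>R L (axis i 1))"
  by (subst vec_axis_expansion) (simp add: linear_sum[OF assms] linear_scale[OF assms])

lemma gram_mult:
  assumes "bilinear \<alpha>"
  shows "\<alpha> v w = v \<bullet> (gram \<alpha> *v w)"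
proof -
  have l: "linear (\<lambda>v. \<alpha> v w)" "linear (\<alpha> v)" for v w using assms by (auto simp: bilinear_def)
  have "\<alpha> v w = (\<Sum>i\<in>UNIV. v $ i * (\<Sum>j\<in>UNIV. w $ j * \<alpha> (axis i 1) (axis j 1)))"
    using linear_axis_expansion[OF l(1)[of w], of v] linear_axis_expansion[OF l(2), of _ w] by simp
  then show ?thesis by (simp add: inner_vec_def gram_def matrix_vector_mult_def mult.commute)
qed

lemma gram_pullback:
  assumes "bilinear \<alpha>" "linear T"
  shows "gram (\<lambda>v w. \<alpha> (T v) (T w)) = transpose (matrix T) ** gram \<alpha> ** matrix T"
proof -
  have "gram (\<lambda>v w. \<alpha> (T v) (T w)) $ i $ j = (transpose (matrix T) ** gram \<alpha> ** matrix T) $ i $ j" for i j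
  proof -
    have "T (axis i 1) = column i (matrix T)" "T (axis j 1) = column j (matrix T)"
      by (simp_all add: matrix_def column_def vec_eq_iff)
    then show ?thesis
      unfolding gram_def gram_mult[OF assms(1), of "T _"]
      by (simp add: inner_vec_def matrix_matrix_mult_def matrix_vector_mult_def column_def transpose_def
        sum_distrib_left sum_distrib_right mult.assoc) (subst sum.swap, simp)
  qed
  then show ?thesis by (simp add: vec_eq_iff)
qed

lemma det_gram_pullback:
  assumes "bilinear \<alpha>" "linear T"
  shows "det (gram (\<lambda>v w. \<alpha> (T v) (T w))) = (det (matrix T))\<^sup>2 * det (gram \<alpha>)"
  by (simp add: gram_pullback[OF assms] det_mul power2_eq_square)

lemma bilinear_pullback: "bilinear \<alpha> \<Longrightarrow> linear T \<Longrightarrow> bilinear (\<lambda>v w. \<alpha> (T v) (T w))"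
  unfolding bilinear_def using linear_compose[of T] by (auto simp: o_def)

lemma inner_form_pullback:
  "inner_form \<alpha> \<Longrightarrow> linear T \<Longrightarrow> inj T \<Longrightarrow> inner_form (\<lambda>v w. \<alpha> (T v) (T w))"
  unfolding inner_form_def by (auto intro: bilinear_pullback simp: linear_injective_0)

text \<open>The segment from the identity matrix to a Gram matrix consists of invertible matrices.\<close>

lemma det_gram_pos:
  fixes \<alpha> :: "real^'m \<Rightarrow> real^'m \<Rightarrow> real"
  assumes "inner_form \<alpha>"
  shows "det (gram \<alpha>) > 0"
proof (rule ccontr)
  assume neg: "\<not> det (gram \<alpha>) > 0"
  define M :: "real \<Rightarrow> real^'m^'m" where "M s = (1 - s) *\<^sub>R mat 1 + s *\<^sub>R gram \<alpha>" for s
  have c: "continuous_on {0..1} (\<lambda>s. det (M s))"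
    unfolding det_def M_def by (auto intro!: continuous_intros)
  have "det (M 0) = 1" "det (M 1) \<le> 0" using neg by (simp_all add: M_def)
  then obtain s where s: "0 \<le> s" "s \<le> 1" "det (M s) = 0"
    using IVT2'[of "\<lambda>s. det (M s)" 1 0 0] c by auto
  have "\<not> inj ((*v) (M s))" using det_nz_iff_inj[OF matrix_vector_mul_linear[of "M s"]] s(3) by simp
  then obtain v where v: "v \<noteq> 0" "M s *v v = 0"
    using linear_injective_0[OF matrix_vector_mul_linear[of "M s"]] by auto
  have "0 = v \<bullet> (M s *v v)" using v by simp
  also have "\<dots> = (1 - s) * (v \<bullet> v) + s * \<alpha> v v"
    using assms by (simp add: M_def matrix_vector_mult_add_rdistrib inner_add_right gram_mult inner_form_def
      scaleR_matrix_vector_assoc[symmetric])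
  also have "\<dots> > 0"
  proof -
    have "v \<bullet> v > 0" "\<alpha> v v > 0" using v assms by (auto simp: inner_form_def)
    then show ?thesis using s by (cases "s = 0") (auto intro: add_nonneg_pos)
  qed
  finally show False by simp
qed

section \<open>Splitting of coordinates\<close>

text \<open>
  The coordinates of the total space are divided into base coordinates and fibre coordinates.
  Keeping both inside one space, instead of passing to a product, allows determinants of all three
  sizes to be compared.
\<close>

locale coordinate_split =
  fixes \<iota> :: "'n::finite \<Rightarrow> 'm::finite" and \<kappa> :: "'k::finite \<Rightarrow> 'm"
  assumes inj_\<iota>: "inj \<iota>" and inj_\<kappa>: "inj \<kappa>" and disj: "range \<iota> \<inter> range \<kappa> = {}" and cover: "range \<iota> \<union> range \<kappa> = UNIV"
begin

definition base :: "real^'m \<Rightarrow> real^'n" where "base z = (\<chi> a. z $ \<iota> a)"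
definition fib :: "real^'m \<Rightarrow> real^'k" where "fib z = (\<chi> b. z $ \<kappa> b)"
definition join :: "real^'n \<Rightarrow> real^'k \<Rightarrow> real^'m" where
  "join y t = (\<chi> i. if i \<in> range \<iota> then y $ inv \<iota> i else t $ inv \<kappa> i)"

lemma disjoint_indices [simp]: "\<kappa> b \<notin> range \<iota>" "\<iota> a \<notin> range \<kappa>" "\<kappa> b \<noteq> \<iota> a" "\<iota> a \<noteq> \<kappa> b"
  using disj by (auto simp: disjoint_iff)

lemma join_nth [simp]: "join y t $ \<iota> a = y $ a" "join y t $ \<kappa> b = t $ b"
  using inj_\<iota> inj_\<kappa> by (simp_all add: join_def)

lemma index_cases: obtains a where "i = \<iota> a" | b where "i = \<kappa> b"
proof -
  have "i \<in> range \<iota> \<union> range \<kappa>" by (simp add: cover)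
  then show thesis using that by auto
qed

lemma split_eqI:
  assumes "\<And>a. z $ \<iota> a = w $ \<iota> a" "\<And>b. z $ \<kappa> b = w $ \<kappa> b"
  shows "z = w"
proof -
  have "z $ i = w $ i" for i by (cases i rule: index_cases) (simp_all add: assms)
  then show ?thesis by (simp add: vec_eq_iff)
qed

lemma base_join [simp]: "base (join y t) = y" and fib_join [simp]: "fib (join y t) = t"
  by (simp_all add: base_def fib_def vec_eq_iff)

lemma join_base_fib [simp]: "join (base z) (fib z) = z"
  by (rule split_eqI) (simp_all add: base_def fib_def)

lemma linear_base: "linear base" and linear_fib: "linear fib"
  by (auto intro!: linearI simp: base_def fib_def vec_eq_iff)

lemma join_add: "join (y + y') (t + t') = join y t + join y' t'"
  by (rule split_eqI) simp_all

lemma join_scaleR: "join (c *\<^sub>R y) (c *\<^sub>R t) = c *\<^sub>R join y t"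
  by (rule split_eqI) simp_all

lemma linear_join: "linear (\<lambda>p. join (fst p) (snd p))"
  by (rule linearI) (simp_all add: join_add join_scaleR)

lemma sum_split: "(\<Sum>i\<in>UNIV. h i) = (\<Sum>a\<in>UNIV. h (\<iota> a)) + (\<Sum>b\<in>UNIV. (h (\<kappa> b) :: 'x::comm_monoid_add))"
proof -
  have "(\<Sum>i\<in>UNIV. h i) = (\<Sum>i\<in>range \<iota>. h i) + (\<Sum>i\<in>range \<kappa>. h i)"
    using sum.union_disjoint[of "range \<iota>" "range \<kappa>" h] disj cover by simp
  then show ?thesis by (simp add: sum.reindex[OF inj_\<iota>] sum.reindex[OF inj_\<kappa>])
qed

lemma inner_join: "join y 0 \<bullet> z = y \<bullet> base z"
  by (simp add: inner_vec_def sum_split base_def)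

text \<open>
  Multiply \<open>Q\<close> with the matrix whose columns are those of $Q^{-1}$ for the indices in the range of \<open>\<iota>\<close>
  and unit columns otherwise. The product has unit columns for the indices in the range of \<open>\<iota>\<close>, so the
  determinants of both are minors. This is Jacobi's formula for complementary minors.
\<close>

lemma complementary_minor:
  fixes Q P :: "real^'m^'m"
  assumes "Q ** P = mat 1"
  shows "det (\<chi> a b. Q $ \<kappa> a $ \<kappa> b) = det Q * det (\<chi> a b. P $ \<iota> a $ \<iota> b)"
proof -
  let ?B = "\<chi> i j. if j \<in> range \<iota> then P $ i $ j else mat 1 $ i $ j"
  have "det ?B = det (\<chi> a b. ?B $ \<iota> a $ \<iota> b)"
    by (rule det_unit_columns[OF inj_\<iota>]) (simp add: mat_def)
  then have B: "det ?B = det (\<chi> a b. P $ \<iota> a $ \<iota> b)" by simp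
  have QB: "(Q ** ?B) $ i $ j = (if j \<in> range \<iota> then mat 1 $ i $ j else Q $ i $ j)" for i j
  proof (cases "j \<in> range \<iota>")
    case True
    then have "(Q ** ?B) $ i $ j = (Q ** P) $ i $ j" by (simp add: matrix_matrix_mult_def)
    then show ?thesis using True assms by simp
  next
    case False
    then have "(Q ** ?B) $ i $ j = (Q ** mat 1) $ i $ j" by (simp add: matrix_matrix_mult_def)
    then show ?thesis using False by simp
  qed
  have "det (Q ** ?B) = det (\<chi> a b. (Q ** ?B) $ \<kappa> a $ \<kappa> b)"
  proof (rule det_unit_columns[OF inj_\<kappa>])
    fix i j assume "j \<notin> range \<kappa>"
    then have "j \<in> range \<iota>" by (cases j rule: index_cases) auto
    then show "(Q ** ?B) $ i $ j = (if i = j then 1 else 0)" by (simp add: QB mat_def)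
  qed
  then show ?thesis using B by (simp add: QB det_mul)
qed

text \<open>
  In the frame given by \<open>M\<close>, in which \<open>L\<close> is the projection to the first group of coordinates,
  $L L^*$ is the corresponding block of the inverse Gram matrix.
\<close>

lemma det_normal_jacobian:
  fixes L :: "real^'m \<Rightarrow> real^'n"
  assumes \<alpha>: "inner_form \<alpha>" and \<beta>: "inner_form \<beta>"
    and M: "linear M" "inj M" and R: "linear R" "inj R" and L: "linear L" "\<And>z. L (M z) = R (base z)"
    and Q: "Q = gram (\<lambda>v w. \<alpha> (M v) (M w))" "Q ** P = mat 1"
  shows "det (matrix (L \<circ> adjoint_wrt \<alpha> \<beta> L)) = det (\<chi> a b. P $ \<iota> a $ \<iota> b) * det (gram (\<lambda>v w. \<beta> (R v) (R w)))"
proof -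
  define H where "H = gram (\<lambda>v w. \<beta> (R v) (R w))"
  obtain M' where M': "linear M'" "\<And>x. M (M' x) = x" "\<And>z. M' (M z) = z"
    using linear_injective_isomorphism[OF M] by metis
  obtain R' where R': "linear R'" "\<And>x. R (R' x) = x" "\<And>z. R' (R z) = z"
    using linear_injective_isomorphism[OF R] by metis
  have bil: "bilinear \<alpha>" "bilinear \<beta>" using \<alpha> \<beta> by (auto simp: inner_form_def)
  have QM: "\<alpha> (M v) (M w) = v \<bullet> (Q *v w)" for v w
    unfolding Q(1) by (rule gram_mult[OF bilinear_pullback[OF bil(1) M(1)]])
  have HR: "\<beta> (R v) (R w) = v \<bullet> (H *v w)" for v w
    unfolding H_def by (rule gram_mult[OF bilinear_pullback[OF bil(2) R(1)]])
  have QP: "Q *v (P *v x) = x" for x using Q(2) by (simp add: matrix_vector_mul_assoc)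
  define A where "A w = M (P *v join (H *v R' w) 0)" for w
  have adj: "\<beta> (L v) w = \<alpha> v (A w)" for v w
  proof -
    have "\<beta> (L v) w = \<beta> (R (base (M' v))) (R (R' w))" using L(2)[of "M' v"] M' R' by simp
    also have "\<dots> = join (H *v R' w) 0 \<bullet> M' v" by (simp only: HR inner_join) (simp add: inner_commute)
    also have "\<dots> = \<alpha> (M (M' v)) (A w)" unfolding A_def QM QP by (simp add: inner_commute)
    finally show ?thesis using M' by simp
  qed
  have "adjoint_wrt \<alpha> \<beta> L = A"
    unfolding adjoint_wrt_def
  proof (rule the_equality)
    show "\<forall>v w. \<beta> (L v) w = \<alpha> v (A w)" using adj by simp
  next
    fix A' assume "\<forall>v w. \<beta> (L v) w = \<alpha> v (A' w)"
    then have "\<alpha> v (A' w) = \<alpha> v (A w)" for v w using adj by simp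
    then have "\<alpha> (A' w - A w) (A' w - A w) = 0" for w
      by (simp add: bilinear_rsub[OF bil(1)])
    then have "A' w - A w = 0" for w using \<alpha> unfolding inner_form_def by (metis less_irrefl)
    then show "A' = A" by auto
  qed
  moreover have "matrix (L \<circ> A) = matrix R ** ((\<chi> a b. P $ \<iota> a $ \<iota> b) ** H) ** matrix R'"
  proof -
    have "(L \<circ> A) w = (matrix R ** ((\<chi> a b. P $ \<iota> a $ \<iota> b) ** H) ** matrix R') *v w" for w
    proof -
      have "base (P *v join u 0) = (\<chi> a b. P $ \<iota> a $ \<iota> b) *v u" for u
        by (simp add: base_def matrix_vector_mult_def sum_split vec_eq_iff)
      then have "L (A w) = R ((\<chi> a b. P $ \<iota> a $ \<iota> b) *v (H *v R' w))" unfolding A_def L(2) by simp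
      then show ?thesis
        by (simp only: o_def matrix_mult_linear[OF R(1)] matrix_mult_linear[OF R'(1)] matrix_vector_mul_assoc[symmetric])
    qed
    then have "L \<circ> A = (\<lambda>w. (matrix R ** ((\<chi> a b. P $ \<iota> a $ \<iota> b) ** H) ** matrix R') *v w)" by blast
    then show ?thesis by (metis matrix_of_matrix_vector_mul)
  qed
  moreover have "matrix R ** matrix R' = mat 1"
    using matrix_compose[OF R'(1) R(1)] R'(2) by (simp add: o_def matrix_id_mat_1 flip: id_def)
  then have "det (matrix R) * det (matrix R') = 1" by (metis det_I det_mul)
  ultimately show ?thesis by (simp add: det_mul H_def algebra_simps)
qed

text \<open>
  Jacobi's formula turns the block of the inverse Gram matrix in \<open>det_normal_jacobian\<close> into the Gram
  determinant of the fibre directions. Consequently the density of the fibre volume divided by the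
  normal Jacobian is the density of the total volume divided by that of the base.
\<close>

lemma fibre_density:
  fixes L :: "real^'m \<Rightarrow> real^'n"
  assumes \<alpha>: "inner_form \<alpha>" and \<beta>: "inner_form \<beta>"
    and M: "linear M" "inj M" and R: "linear R" "inj R" and L: "linear L" "\<And>z. L (M z) = R (base z)"
  defines "Q \<equiv> gram (\<lambda>v w. \<alpha> (M v) (M w))" and "H \<equiv> gram (\<lambda>v w. \<beta> (R v) (R w))"
  shows "det (matrix (L \<circ> adjoint_wrt \<alpha> \<beta> L)) = det (\<chi> a b. Q $ \<kappa> a $ \<kappa> b) / det Q * det H" (is ?A)
    and "det (\<chi> a b. Q $ \<kappa> a $ \<kappa> b) > 0" (is ?B)
proof -
  have pos: "det Q > 0" unfolding Q_def by (rule det_gram_pos[OF inner_form_pullback[OF \<alpha> M]])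
  then obtain P where P: "Q ** P = mat 1" using invertible_det_nz[of Q] by (auto simp: invertible_def)
  have "det (\<chi> a b. P $ \<iota> a $ \<iota> b) = det (\<chi> a b. Q $ \<kappa> a $ \<kappa> b) / det Q"
    using complementary_minor[OF P] pos by simp
  with det_normal_jacobian[OF \<alpha> \<beta> M R L meta_eq_to_obj_eq[OF Q_def] P] show ?A by (simp add: H_def)
  define e where "e = (\<lambda>t. M (join 0 t))"
  have "linear (\<lambda>t. join 0 t)"
    by (rule linearI) (auto intro!: split_eqI)
  from linear_compose[OF this M(1)] have e: "linear e" by (simp add: e_def o_def)
  have "inj e"
  proof (rule injI)
    fix s t assume "e s = e t"
    then have "fib (join 0 s) = fib (join 0 t)" using M(2) by (simp add: e_def inj_eq)
    then show "s = t" by simp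
  qed
  have ax: "join 0 (axis b 1) = axis (\<kappa> b) 1" for b
    by (rule split_eqI) (simp_all add: axis_def inj_eq[OF inj_\<kappa>])
  have "inner_form (\<lambda>v w. \<alpha> (e v) (e w))" by (rule inner_form_pullback[OF \<alpha> e \<open>inj e\<close>])
  from det_gram_pos[OF this] show ?B by (simp add: gram_def Q_def e_def ax)
qed

end

lemma coordinate_split_exists:
  assumes "CARD('n::finite) < CARD('m::finite)" "CARD('k::finite) = CARD('m) - CARD('n)"
  shows "\<exists>(\<iota> :: 'n \<Rightarrow> 'm) (\<kappa> :: 'k \<Rightarrow> 'm). coordinate_split \<iota> \<kappa>"
proof -
  obtain \<iota> :: "'n \<Rightarrow> 'm" where \<iota>: "inj \<iota>"
    using card_le_inj[of "UNIV :: 'n set" "UNIV :: 'm set"] assms(1) by auto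
  have "card (- range \<iota>) = CARD('k)"
    using card_image[OF \<iota>] assms by (simp add: Compl_eq_Diff_UNIV card_Diff_subset)
  then obtain \<kappa> where "bij_betw \<kappa> (UNIV :: 'k set) (- range \<iota>)"
    by (metis finite finite_same_card_bij)
  then have "inj \<kappa>" "range \<kappa> = - range \<iota>" by (auto simp: bij_betw_def)
  with \<iota> have "coordinate_split \<iota> \<kappa>" by unfold_locales auto
  then show ?thesis by blast
qed

section \<open>Change of variables\<close>

text \<open>
  A well-ordered copy of a finite index type. The change of variables theorem refers to coordinates
  indexed by a well-ordered type; renaming the coordinates changes neither Lebesgue measure nor
  determinants, which carries the theorem over to any finite index type.
\<close>

typedef 'k ordered = "UNIV :: 'k set" morphisms of_ordered to_ordered ..

lemma bij_of_ordered: "bij of_ordered"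
  by (metis bijI' of_ordered_inject to_ordered_inverse UNIV_I)

instance ordered :: (finite) finite
proof
  have "inj (of_ordered :: 'a ordered \<Rightarrow> 'a)" using bij_of_ordered by (rule bij_is_inj)
  then show "finite (UNIV :: 'a ordered set)" by (rule finite_imageD[rotated]) simp
qed

instantiation ordered :: (finite) wellorder
begin

definition ordered_index :: "'a ordered \<Rightarrow> nat" where
  "ordered_index = (SOME f. inj f)"

definition "x \<le> y \<longleftrightarrow> ordered_index x \<le> ordered_index (y :: 'a ordered)"
definition "x < y \<longleftrightarrow> ordered_index x < ordered_index (y :: 'a ordered)"

instance
proof
  have "\<exists>f :: 'a ordered \<Rightarrow> nat. inj f" using finite_imp_inj_to_nat_seg[of "UNIV :: 'a ordered set"] by auto
  then have inj: "inj (ordered_index :: 'a ordered \<Rightarrow> nat)" unfolding ordered_index_def by (rule someI_ex)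
  fix x y z :: "'a ordered"
  show "x < y \<longleftrightarrow> x \<le> y \<and> \<not> y \<le> x" "x \<le> x" "x \<le> y \<or> y \<le> x"
    by (auto simp: less_eq_ordered_def less_ordered_def)
  show "x \<le> y \<Longrightarrow> y \<le> z \<Longrightarrow> x \<le> z" by (auto simp: less_eq_ordered_def)
  show "x \<le> y \<Longrightarrow> y \<le> x \<Longrightarrow> x = y" using inj by (auto simp: less_eq_ordered_def inj_eq)
  fix P :: "'a ordered \<Rightarrow> bool" and a
  assume step: "\<And>x. (\<And>y. y < x \<Longrightarrow> P y) \<Longrightarrow> P x"
  show "P a"
  proof (induction a rule: measure_induct_rule[where f = ordered_index])
    case (less x)
    show ?case by (rule step) (rule less, simp add: less_ordered_def)
  qed
qed

end

definition rename_coords :: "('j \<Rightarrow> 'k) \<Rightarrow> real^'k \<Rightarrow> real^'j" where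
  "rename_coords s x = (\<chi> j. x $ s j)"

lemma linear_rename_coords: "linear (rename_coords s)"
  by (rule linearI) (simp_all add: rename_coords_def vec_eq_iff)

lemma prod_Basis_cart: "(\<Prod>b\<in>Basis. x \<bullet> b) = (\<Prod>i\<in>UNIV. (x :: real^'n) $ i)"
proof -
  let ?e = "\<lambda>i. axis i (1::real) :: real^'n"
  have B: "Basis = range ?e" by (auto simp: Basis_vec_def)
  have "inj ?e" by (auto simp: inj_def axis_eq_axis)
  then have "(\<Prod>b\<in>Basis. x \<bullet> b) = prod ((\<lambda>b. x \<bullet> b) \<circ> ?e) UNIV"
    unfolding B by (rule prod.reindex)
  then show ?thesis by (simp add: cart_eq_inner_axis o_def)
qed

lemma lborel_rename_coords:
  fixes s :: "'j::finite \<Rightarrow> 'k::finite"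
  assumes s: "bij s"
  shows "distr lborel borel (rename_coords s) = (lborel :: (real^'j) measure)"
proof (rule lborel_eqI[symmetric])
  have m: "rename_coords s \<in> borel_measurable borel"
    by (intro borel_measurable_continuous_onI linear_continuous_on) (simp add: linear_rename_coords linear_conv_bounded_linear[symmetric])
  have inv: "s (inv s k) = k" "inv s (s j) = j" for k j using s by (simp_all add: bij_def surj_f_inv_f)
  fix l u :: "real^'j" assume "\<And>b. b \<in> Basis \<Longrightarrow> l \<bullet> b \<le> u \<bullet> b"
  then have lu: "l $ j \<le> u $ j" for j by (simp add: cart_eq_inner_axis axis_in_Basis_iff)
  let ?R = "rename_coords (inv s) :: real^'j \<Rightarrow> real^'k"
  have "emeasure (distr lborel borel (rename_coords s)) (box l u) = emeasure lborel (rename_coords s -` box l u)"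
    using m by (subst emeasure_distr) auto
  also have "rename_coords s -` box l u = box (?R l) (?R u)"
  proof -
    have all: "(\<forall>j. Q j (s j)) \<longleftrightarrow> (\<forall>k. Q (inv s k) k)" for Q :: "'j \<Rightarrow> 'k \<Rightarrow> bool"
    proof (intro iffI allI)
      show "Q (inv s k) k" if "\<forall>j. Q j (s j)" for k using that[rule_format, of "inv s k"] by (simp add: inv)
      show "Q j (s j)" if "\<forall>k. Q (inv s k) k" for j using that[rule_format, of "s j"] by (simp add: inv)
    qed
    show ?thesis
      by (rule set_eqI) (simp add: rename_coords_def mem_box_cart all[of "\<lambda>j k. l $ j < _ $ k \<and> _ $ k < u $ j"])
  qed
  also have "emeasure lborel \<dots> = ennreal (\<Prod>b\<in>Basis. (?R u - ?R l) \<bullet> b)"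
    by (rule emeasure_lborel_box) (auto simp: Basis_vec_def inner_axis rename_coords_def lu)
  also have "(\<Prod>b\<in>Basis. (?R u - ?R l) \<bullet> b) = (\<Prod>b\<in>Basis. (u - l) \<bullet> b)"
    unfolding prod_Basis_cart rename_coords_def
    using prod.reindex_bij_betw[OF bij_betw_inv_into[OF s], of "\<lambda>j. (u - l) $ j"] by simp
  finally show "emeasure (distr lborel borel (rename_coords s)) (box l u) = (\<Prod>b\<in>Basis. (u - l) \<bullet> b)" .
qed simp

lemma nn_integral_rename_coords:
  fixes s :: "'j::finite \<Rightarrow> 'k::finite" and f :: "real^'j \<Rightarrow> ennreal"
  assumes "bij s" "f \<in> borel_measurable borel"
  shows "(\<integral>\<^sup>+x. f (rename_coords s x) \<partial>lborel) = (\<integral>\<^sup>+x. f x \<partial>lborel)"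
proof -
  have m: "rename_coords s \<in> borel_measurable borel"
    by (intro borel_measurable_continuous_onI linear_continuous_on) (simp add: linear_rename_coords linear_conv_bounded_linear[symmetric])
  show ?thesis
    by (subst lborel_rename_coords[OF assms(1), symmetric]) (use m assms(2) in \<open>simp add: nn_integral_distr\<close>)
qed

text \<open>
  The theorem for absolutely integrable functions states that one integral exists if and only if
  the other one does, so the integrals of nonnegative functions agree also when they are infinite.
\<close>

lemma nn_integral_change_of_variables_ordered:
  fixes \<theta> :: "real^'k::{finite,wellorder} \<Rightarrow> real^'k::_" and q :: "real^'k::_ \<Rightarrow> real"
  assumes X: "X \<in> sets borel" "\<theta> ` X \<in> sets borel" and inj: "inj_on \<theta> X"
    and d: "\<And>x. x \<in> X \<Longrightarrow> (\<theta> has_derivative \<theta>' x) (at x within X)"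
    and q: "\<And>y. 0 \<le> q y" "(\<lambda>y. indicator (\<theta> ` X) y * q y) \<in> borel_measurable borel"
    and p: "\<And>x. 0 \<le> p x" "(\<lambda>x. indicator X x * p x) \<in> borel_measurable borel"
    and eq: "\<And>x. x \<in> X \<Longrightarrow> p x = \<bar>det (matrix (\<theta>' x))\<bar> * q (\<theta> x)"
  shows "(\<integral>\<^sup>+x. ennreal (indicator X x * p x) \<partial>lborel) = (\<integral>\<^sup>+y. ennreal (indicator (\<theta> ` X) y * q y) \<partial>lborel)"
proof -
  let ?q = "\<lambda>y. vec (q y) :: real^1"
  have hi: "(\<integral>\<^sup>+x. ennreal (indicator S x * f x) \<partial>lborel) = ennreal b \<longleftrightarrow> (f has_integral b) S"
    if f: "\<And>x. 0 \<le> f x" "(\<lambda>x. indicator S x * f x) \<in> borel_measurable borel" and b: "b \<ge> 0"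
    for S and f :: "real^'k::_ \<Rightarrow> real" and b
  proof -
    have "(f has_integral b) S \<longleftrightarrow> ((\<lambda>x. indicator S x * f x) has_integral b) UNIV"
    proof -
      have "(\<lambda>x. indicator S x * f x) = (\<lambda>x. if x \<in> S then f x else 0)" by (auto simp: indicator_def)
      then show ?thesis by (simp add: has_integral_restrict_UNIV)
    qed
    moreover have "(\<integral>\<^sup>+x. ennreal (indicator S x * f x) \<partial>lborel) = ennreal b \<longleftrightarrow> ((\<lambda>x. indicator S x * f x) has_integral b) UNIV"
    proof
      show "((\<lambda>x. indicator S x * f x) has_integral b) UNIV"
        if "(\<integral>\<^sup>+x. ennreal (indicator S x * f x) \<partial>lborel) = ennreal b"
        by (rule nn_integral_has_integral[OF f(2) _ that b]) (simp add: f(1))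
      show "(\<integral>\<^sup>+x. ennreal (indicator S x * f x) \<partial>lborel) = ennreal b"
        if "((\<lambda>x. indicator S x * f x) has_integral b) UNIV"
        by (rule nn_integral_has_integral_lborel[OF f(2) _ that]) (simp add: f(1))
    qed
    ultimately show ?thesis by simp
  qed
  have ai: "f absolutely_integrable_on S \<and> integral S f = b \<longleftrightarrow> (f has_integral b) S"
    if "\<And>x. 0 \<le> f x" for S b and f :: "real^'k::_ \<Rightarrow> real"
    using that by (metis absolutely_integrable_on_iff_nonneg has_integral_integrable_integral)
  have cov: "(\<lambda>x. \<bar>det (matrix (\<theta>' x))\<bar> * q (\<theta> x)) absolutely_integrable_on X \<and>
      integral X (\<lambda>x. \<bar>det (matrix (\<theta>' x))\<bar> * q (\<theta> x)) = b \<longleftrightarrow>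
      q absolutely_integrable_on (\<theta> ` X) \<and> integral (\<theta> ` X) q = b" for b
  proof -
    have "X \<in> sets lebesgue" using X(1) by (simp add: sets_completionI_sets)
    from has_absolute_integral_change_of_variables[OF this d inj, of ?q "vec b"]
    show ?thesis
      unfolding absolutely_integrable_on_1_iff integral_on_1_eq by (simp add: vec_eq_iff)
  qed
  have "(p has_integral b) X \<longleftrightarrow> (q has_integral b) (\<theta> ` X)" for b
  proof -
    have "(p has_integral b) X \<longleftrightarrow> ((\<lambda>x. \<bar>det (matrix (\<theta>' x))\<bar> * q (\<theta> x)) has_integral b) X"
      by (rule has_integral_cong) (rule eq)
    also have "\<dots> \<longleftrightarrow> (q has_integral b) (\<theta> ` X)"
      using cov[of b] ai[of "\<lambda>x. \<bar>det (matrix (\<theta>' x))\<bar> * q (\<theta> x)" X b] ai[of q "\<theta> ` X" b] q(1) by simp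
    finally show ?thesis .
  qed
  then have *: "(\<integral>\<^sup>+x. ennreal (indicator X x * p x) \<partial>lborel) = ennreal b \<longleftrightarrow>
      (\<integral>\<^sup>+y. ennreal (indicator (\<theta> ` X) y * q y) \<partial>lborel) = ennreal b" if "b \<ge> 0" for b
    using hi[OF p that] hi[OF q that] by simp
  show ?thesis
    by (cases "\<integral>\<^sup>+x. ennreal (indicator X x * p x) \<partial>lborel"; cases "\<integral>\<^sup>+y. ennreal (indicator (\<theta> ` X) y * q y) \<partial>lborel")
      (use * in \<open>auto simp: top_unique\<close>)
qed

lemma nn_integral_change_of_variables:
  fixes \<theta> :: "real^'k \<Rightarrow> real^'k" and q :: "real^'k \<Rightarrow> real"
  assumes X: "X \<in> sets borel" "\<theta> ` X \<in> sets borel" and inj: "inj_on \<theta> X"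
    and d: "\<And>x. x \<in> X \<Longrightarrow> (\<theta> has_derivative \<theta>' x) (at x)"
    and q: "\<And>y. 0 \<le> q y" "(\<lambda>y. indicator (\<theta> ` X) y * q y) \<in> borel_measurable borel"
    and p: "\<And>x. 0 \<le> p x" "(\<lambda>x. indicator X x * p x) \<in> borel_measurable borel"
    and eq: "\<And>x. x \<in> X \<Longrightarrow> p x = \<bar>det (matrix (\<theta>' x))\<bar> * q (\<theta> x)"
  shows "(\<integral>\<^sup>+x. ennreal (indicator X x * p x) \<partial>lborel) = (\<integral>\<^sup>+y. ennreal (indicator (\<theta> ` X) y * q y) \<partial>lborel)"
proof -
  let ?s = "of_ordered :: 'k ordered \<Rightarrow> 'k"
  define R :: "real^'k \<Rightarrow> real^'k ordered" where "R = rename_coords ?s"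
  define R' :: "real^'k ordered \<Rightarrow> real^'k" where "R' = rename_coords (inv ?s)"
  have bij: "bij ?s" "bij (inv ?s)" using bij_of_ordered bij_imp_bij_inv by blast+
  have inv: "?s (inv ?s k) = k" "inv ?s (?s j) = j" for k j using bij(1) by (simp_all add: bij_def surj_f_inv_f)
  have RR [simp]: "R (R' x) = x" "R' (R y) = y" for x y
    by (simp_all add: R_def R'_def rename_coords_def inv)
  have lin: "linear R" "linear R'" by (simp_all add: R_def R'_def linear_rename_coords)
  have bl: "bounded_linear R" "bounded_linear R'" using lin by (simp_all add: linear_conv_bounded_linear)
  have meas: "R \<in> borel_measurable borel" "R' \<in> borel_measurable borel"
    using bl by (auto intro!: borel_measurable_continuous_onI linear_continuous_on)
  have img: "R ` S = R' -` S" for S by (auto simp: image_iff) (metis RR(1))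
  have borel_img: "R ` S \<in> sets borel" if "S \<in> sets borel" for S
    using measurable_sets[OF meas(2) that] img[of S] by simp
  let ?X = "R ` X" and ?\<theta> = "\<lambda>x. R (\<theta> (R' x))"
  have \<theta>X: "?\<theta> ` ?X = R ` \<theta> ` X" by (auto simp: image_iff)
  have ind: "indicator (R ` S) x = (indicator S (R' x) :: real)" for S x by (simp add: img indicator_def)
  have "(\<integral>\<^sup>+x. ennreal (indicator ?X x * p (R' x)) \<partial>lborel) = (\<integral>\<^sup>+y. ennreal (indicator (?\<theta> ` ?X) y * q (R' y)) \<partial>lborel)"
  proof (rule nn_integral_change_of_variables_ordered[where \<theta>' = "\<lambda>x h. R (\<theta>' (R' x) (R' h))"])
    show "?X \<in> sets borel" "?\<theta> ` ?X \<in> sets borel" using X borel_img by (auto simp: \<theta>X)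
    show "inj_on ?\<theta> ?X" using inj by (intro inj_onI) (metis RR image_iff inj_onD)
    show "(\<lambda>y. indicator (?\<theta> ` ?X) y * q (R' y)) \<in> borel_measurable borel"
      unfolding \<theta>X ind using measurable_compose[OF meas(2) q(2)] by simp
    show "(\<lambda>x. indicator ?X x * p (R' x)) \<in> borel_measurable borel"
      unfolding ind using measurable_compose[OF meas(2) p(2)] by simp
  next
    fix x assume x: "x \<in> ?X"
    then have xX: "R' x \<in> X" by auto
    have "((\<lambda>x. \<theta> (R' x)) has_derivative (\<lambda>h. \<theta>' (R' x) (R' h))) (at x)"
      by (rule has_derivative_compose[OF bounded_linear_imp_has_derivative[OF bl(2)] d[OF xX]])
    from bounded_linear.has_derivative[OF bl(1) this]
    show "(?\<theta> has_derivative (\<lambda>h. R (\<theta>' (R' x) (R' h)))) (at x within ?X)" by (rule has_derivative_at_withinI)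
    have ax: "R' (axis i 1) = axis (?s i) 1" for i
      by (simp add: R'_def rename_coords_def vec_eq_iff axis_def) (metis inv)
    have "matrix (\<lambda>h. R (\<theta>' (R' x) (R' h))) = (\<chi> i j. matrix (\<theta>' (R' x)) $ ?s i $ ?s j)"
      by (simp add: matrix_def ax vec_eq_iff) (simp add: R_def rename_coords_def)
    then show "p (R' x) = \<bar>det (matrix (\<lambda>h. R (\<theta>' (R' x) (R' h))))\<bar> * q (R' (?\<theta> x))"
      using eq[OF xX] det_reindex[OF bij(1)] by simp
  qed (use p(1) q(1) in auto)
  moreover have "(\<integral>\<^sup>+x. ennreal (indicator (R ` S) x * f (R' x)) \<partial>lborel) = (\<integral>\<^sup>+x. ennreal (indicator S x * f x) \<partial>lborel)"
    if "(\<lambda>x. indicator S x * f x) \<in> borel_measurable borel" for S f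
    unfolding ind
    using nn_integral_rename_coords[OF bij(2), of "\<lambda>x. ennreal (indicator S x * f x)"] that by (simp add: R'_def)
  ultimately show ?thesis using p(2) q(2) by (simp add: \<theta>X)
qed

section \<open>Integrals depending on parameters\<close>

lemma compact_support_integral:
  fixes g :: "'q::euclidean_space \<Rightarrow> real"
  assumes g: "continuous_on UNIV g" and K: "compact K" "K \<subseteq> cbox a b" "\<And>q. q \<notin> K \<Longrightarrow> g q = 0"
  shows "integrable lborel g" "(LINT q|lborel. g q) = integral (cbox a b) g"
proof -
  have e: "(\<lambda>q. indicator K q *\<^sub>R g q) = g" using K(3) by (auto simp: fun_eq_iff indicator_def)
  show i: "integrable lborel g"
    using borel_integrable_compact[OF K(1) continuous_on_subset[OF g]] unfolding e by simp
  have "(LINT q|lborel. g q) = integral UNIV g" using integral_lborel[OF i] by simp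
  also have "\<dots> = integral (cbox a b) g"
  proof -
    have "(\<lambda>x. if x \<in> cbox a b then g x else 0) = g"
    proof
      show "(if x \<in> cbox a b then g x else 0) = g x" for x using K(2) K(3)[of x] by (cases "x \<in> K") auto
    qed
    then show ?thesis using integral_restrict_UNIV[of "cbox a b" g] by simp
  qed
  finally show "(LINT q|lborel. g q) = integral (cbox a b) g" .
qed

lemma compact_support_integrable:
  fixes g :: "'q::euclidean_space \<Rightarrow> real"
  assumes "continuous_on UNIV g" "compact K" "\<And>q. q \<notin> K \<Longrightarrow> g q = 0"
  shows "integrable lborel g"
proof -
  obtain a where "K \<subseteq> cbox (- a) a"
    using bounded_subset_cbox_symmetric[OF compact_imp_bounded[OF assms(2)]] by blast
  then show ?thesis using compact_support_integral(1) assms by blast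
qed

context
  fixes \<phi> :: "'p::euclidean_space \<times> 'q::euclidean_space \<Rightarrow> real" and K :: "'q set"
  assumes K: "compact K" and supp: "\<And>p q. q \<notin> K \<Longrightarrow> \<phi> (p, q) = 0"
begin

lemma continuous_param_integral:
  assumes "continuous_on UNIV \<phi>"
  shows "continuous_on UNIV (\<lambda>p. LINT q|lborel. \<phi> (p, q))"
proof -
  obtain a where a: "K \<subseteq> cbox (- a) a"
    using bounded_subset_cbox_symmetric[OF compact_imp_bounded[OF K]] by blast
  have "continuous_on UNIV (\<lambda>q. \<phi> (p, q))" for p
    by (rule continuous_on_compose2[OF assms]) (auto intro!: continuous_intros)
  from compact_support_integral(2)[OF this K a supp]
  have *: "(LINT q|lborel. \<phi> (p, q)) = integral (cbox (- a) a) (\<lambda>q. \<phi> (p, q))" for p by blast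
  have "continuous_on UNIV (\<lambda>p. integral (cbox (- a) a) (\<lambda>q. \<phi> (p, q)))"
    by (rule integral_continuous_on_param) (use continuous_on_subset[OF assms] in simp)
  then show ?thesis unfolding * .
qed

lemma has_derivative_param_integral:
  assumes \<phi>: "Cn_on (Suc 0) UNIV \<phi>"
  shows "((\<lambda>p. LINT q|lborel. \<phi> (p, q)) has_derivative
    (\<lambda>v. LINT q|lborel. frechet_derivative \<phi> (at (p, q)) (v, 0))) (at p)"
    and frechet_derivative_outside_support: "q \<notin> K \<Longrightarrow> frechet_derivative \<phi> (at (p, q)) w = 0"
proof -
  let ?D = "\<lambda>z. frechet_derivative \<phi> (at z)"
  have supp': "?D (p, q) w = 0" if "q \<notin> K" for p q w
  proof -
    have "(\<phi> has_derivative (\<lambda>_. 0)) (at (p, q))"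
      by (rule has_derivative_transform_within_open[OF has_derivative_const, where s = "UNIV \<times> - K"])
        (use K supp that in \<open>auto intro!: open_Times simp: compact_imp_closed open_Compl\<close>)
    from frechet_derivative_at[OF this] show ?thesis by metis
  qed
  then show "q \<notin> K \<Longrightarrow> ?D (p, q) w = 0" .
  obtain a where a: "K \<subseteq> cbox (- a) a"
    using bounded_subset_cbox_symmetric[OF compact_imp_bounded[OF K]] by blast
  have dz: "(\<phi> has_derivative ?D z) (at z)" for z using Cn_on_has_derivative[OF \<phi>] by simp
  have bl: "bounded_linear (?D z)" for z using dz has_derivative_bounded_linear by blast
  have blp: "bounded_linear (\<lambda>v. ?D z (v, 0))" for z
    by (rule bounded_linear_compose[OF bl]) (intro bounded_linear_Pair bounded_linear_ident bounded_linear_zero)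
  define B where "B p q = Blinfun (\<lambda>v. ?D (p, q) (v, 0))" for p q
  have B: "blinfun_apply (B p q) v = ?D (p, q) (v, 0)" for p q v
    by (simp add: B_def bounded_linear_Blinfun_apply[OF blp])
  have c: "continuous_on UNIV (\<lambda>z. ?D z w)" for w using Cn_on_continuous_on[OF Cn_on_frechet[OF \<phi>]] .
  have cB: "continuous_on UNIV (\<lambda>z. B (fst z) (snd z))"
    by (rule continuous_on_blinfun_componentwise) (simp add: B c)
  have cq: "continuous_on UNIV (\<lambda>q. ?D (p, q) (v, 0))" for v
    by (rule continuous_on_compose2[OF c]) (auto intro!: continuous_intros)
  have cphi: "continuous_on UNIV (\<lambda>q. \<phi> (p, q))" for p
    by (rule continuous_on_compose2[OF Cn_on_continuous_on[OF \<phi>]]) (auto intro!: continuous_intros)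
  have "((\<lambda>p. integral (cbox (- a) a) (\<lambda>q. \<phi> (p, q))) has_derivative integral (cbox (- a) a) (B p)) (at p within UNIV)"
  proof (rule leibniz_rule)
    show "((\<lambda>p. \<phi> (p, q)) has_derivative blinfun_apply (B p q)) (at p within UNIV)" for p q
    proof -
      have "((\<lambda>p. \<phi> (p, q)) has_derivative (\<lambda>v. ?D (p, q) (v, 0))) (at p)"
        by (rule has_derivative_compose[of "\<lambda>p. (p, q)", OF _ dz]) (auto intro!: derivative_eq_intros)
      moreover have "blinfun_apply (B p q) = (\<lambda>v. ?D (p, q) (v, 0))" using B by blast
      ultimately show ?thesis by simp
    qed
    show "(\<lambda>q. \<phi> (p, q)) integrable_on cbox (- a) a" for p
      using cphi by (intro integrable_continuous) (rule continuous_on_subset, auto)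
    show "continuous_on (UNIV \<times> cbox (- a) a) (\<lambda>(p, q). B p q)"
      using continuous_on_subset[OF cB, of "UNIV \<times> cbox (- a) a"] by (simp add: split_beta)
  qed auto
  moreover have "(\<lambda>p. integral (cbox (- a) a) (\<lambda>q. \<phi> (p, q))) = (\<lambda>p. LINT q|lborel. \<phi> (p, q))"
    using compact_support_integral(2)[OF cphi K a supp] by simp
  moreover have "blinfun_apply (integral (cbox (- a) a) (B p)) v = (LINT q|lborel. ?D (p, q) (v, 0))" for v
  proof -
    have "continuous_on UNIV (\<lambda>q. B (fst (p, q)) (snd (p, q)))"
      by (rule continuous_on_compose2[OF cB]) (auto intro!: continuous_intros)
    then have "continuous_on UNIV (B p)" by simp
    then have "B p integrable_on cbox (- a) a"
      by (intro integrable_continuous) (rule continuous_on_subset, auto)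
    then have "blinfun_apply (integral (cbox (- a) a) (B p)) v = integral (cbox (- a) a) (\<lambda>q. B p q v)"
      by (simp add: blinfun_apply_integral)
    then show ?thesis
      using compact_support_integral(2)[OF cq K a supp'] by (simp add: B)
  qed
  then have "blinfun_apply (integral (cbox (- a) a) (B p)) = (\<lambda>v. LINT q|lborel. ?D (p, q) (v, 0))" by blast
  ultimately show "((\<lambda>p. LINT q|lborel. \<phi> (p, q)) has_derivative (\<lambda>v. LINT q|lborel. ?D (p, q) (v, 0))) (at p)"
    by simp
qed

end

text \<open>
  The directional derivatives of the integral are the integrals of the directional derivatives of
  the integrand, which have the same support, so the order of differentiability is inherited
  by induction.
\<close>

lemma Cn_on_param_integral:
  fixes \<phi> :: "'p::euclidean_space \<times> 'q::euclidean_space \<Rightarrow> real"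
  assumes K: "compact K" and supp: "\<And>p q. q \<notin> K \<Longrightarrow> \<phi> (p, q) = 0" and \<phi>: "Cn_on n UNIV \<phi>"
  shows "Cn_on n UNIV (\<lambda>p. LINT q|lborel. \<phi> (p, q))"
  using supp \<phi>
proof (induction n arbitrary: \<phi>)
  case 0
  then show ?case using continuous_param_integral[OF K, of \<phi>] by simp
next
  case (Suc n)
  have 1: "Cn_on (Suc 0) UNIV \<phi>" using Cn_on_le[OF Suc.prems(2), of "Suc 0"] by simp
  show ?case
  proof (rule Cn_on_SucI[OF open_UNIV has_derivative_param_integral(1)[OF K Suc.prems(1) 1]])
    show "Cn_on n UNIV (\<lambda>p. LINT q|lborel. frechet_derivative \<phi> (at (p, q)) (v, 0))" for v
      by (rule Suc.IH) (use Suc.prems(2) has_derivative_param_integral(2)[OF K Suc.prems(1) 1] in auto)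
  qed
qed

text \<open>
  The integral of a translate of \<open>\<psi>\<close> is constant, so its derivative vanishes. Translating by
  \<open>sin s\<close> times the vector instead of \<open>s\<close> times the vector keeps the supports in a common compact set.
\<close>

lemma integral_directional_derivative_eq_0:
  fixes \<psi> :: "'q::euclidean_space \<Rightarrow> real"
  assumes \<psi>: "Cn_on (Suc 0) UNIV \<psi>" and K: "compact K" "\<And>q. q \<notin> K \<Longrightarrow> \<psi> q = 0"
  shows "(LINT q|lborel. frechet_derivative \<psi> (at q) v) = 0"
proof -
  define \<phi> where "\<phi> z = \<psi> (snd z + sin (fst z) *\<^sub>R v)" for z :: "real \<times> 'q"
  define K' where "K' = (\<lambda>(q, s). q - s *\<^sub>R v) ` (K \<times> {-1..1})"
  have K': "compact K'" unfolding K'_def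
    by (intro compact_continuous_image compact_Times K) (auto simp: split_beta intro!: continuous_intros)
  have supp: "\<phi> (s, q) = 0" if "q \<notin> K'" for s q
  proof -
    have "q + sin s *\<^sub>R v \<notin> K"
    proof
      assume "q + sin s *\<^sub>R v \<in> K"
      then have "(\<lambda>(q, s). q - s *\<^sub>R v) (q + sin s *\<^sub>R v, sin s) \<in> K'"
        unfolding K'_def by (intro imageI) auto
      with that show False by simp
    qed
    then show ?thesis using K(2) by (simp add: \<phi>_def)
  qed
  have sin: "Cn_on (Suc 0) UNIV (sin :: real \<Rightarrow> real)"
    by (rule Cn_on_SucI[OF open_UNIV, where f' = "\<lambda>x h. cos x * h"])
      (use DERIV_sin in \<open>auto simp: has_field_derivative_def intro!: continuous_intros\<close>)
  have \<phi>: "Cn_on (Suc 0) UNIV \<phi>" unfolding \<phi>_def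
  proof (rule Cn_on_compose[OF open_UNIV open_UNIV \<psi>])
    show "Cn_on (Suc 0) UNIV (\<lambda>z :: real \<times> 'q. snd z + sin (fst z) *\<^sub>R v)"
      by (intro Cn_on_add Cn_on_scaleR Cn_on_const open_UNIV Cn_on_linear bounded_linear_snd
          Cn_on_compose[OF open_UNIV open_UNIV sin] bounded_linear_fst) simp
  qed simp
  have inv: "(LINT q|lborel. \<phi> (s, q)) = (LINT q|lborel. \<psi> q)" for s
  proof -
    have m: "\<psi> \<in> borel_measurable borel" using Cn_on_continuous_on[OF \<psi>] by (rule borel_measurable_continuous_onI)
    have "(LINT q|lborel. \<psi> q) = (LINT q|distr lborel borel ((+) (sin s *\<^sub>R v)). \<psi> q)" by (simp add: lborel_distr_plus)
    also have "\<dots> = (LINT q|lborel. \<psi> (sin s *\<^sub>R v + q))" using m by (subst integral_distr) auto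
    finally show ?thesis by (simp add: \<phi>_def add.commute)
  qed
  have "((\<lambda>s. LINT q|lborel. \<phi> (s, q)) has_derivative (\<lambda>v. LINT q|lborel. frechet_derivative \<phi> (at (0, q)) (v, 0))) (at 0)"
    by (rule has_derivative_param_integral(1)[OF K' supp \<phi>])
  then have "((\<lambda>s::real. LINT q|lborel. \<psi> q) has_derivative (\<lambda>v. LINT q|lborel. frechet_derivative \<phi> (at (0, q)) (v, 0))) (at 0)"
    by (simp add: inv)
  from has_derivative_unique[OF this has_derivative_const]
  have "(LINT q|lborel. frechet_derivative \<phi> (at (0, q)) (1, 0)) = 0" by metis
  moreover have "frechet_derivative \<phi> (at (0, q)) (1, 0) = frechet_derivative \<psi> (at q) v" for q
  proof -
    have d: "(\<psi> has_derivative frechet_derivative \<psi> (at q)) (at q)" for q using Cn_on_has_derivative[OF \<psi>] by simp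
    have "((\<lambda>z :: real \<times> 'q. snd z + sin (fst z) *\<^sub>R v) has_derivative (\<lambda>h. snd h + (cos 0 * fst h) *\<^sub>R v)) (at (0, q))"
      by (auto intro!: derivative_eq_intros)
    from has_derivative_compose[OF this, of \<psi> "frechet_derivative \<psi> (at q)"] d[of q]
    have "(\<phi> has_derivative (\<lambda>h. frechet_derivative \<psi> (at q) (snd h + (cos 0 * fst h) *\<^sub>R v))) (at (0, q))"
      by (simp add: \<phi>_def[abs_def])
    from frechet_derivative_at[OF this, symmetric] show ?thesis by simp
  qed
  ultimately show ?thesis by simp
qed

section \<open>Divergence in coordinates\<close>

text \<open>
  The divergence $G^{-1/2} \operatorname{div}(G^{1/2} Y)$ with respect to the volume form
  $G^{1/2}\, dx$, in terms of \<open>G\<close> because Gram determinants, and not their square roots, transform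
  polynomially.
\<close>

definition coord_div :: "(real^'m \<Rightarrow> real) \<Rightarrow> (real^'m \<Rightarrow> real^'m) \<Rightarrow> real^'m \<Rightarrow> real" where
  "coord_div G Y x = frechet_derivative G (at x) (Y x) / (2 * G x) + tr (frechet_derivative Y (at x))"

lemma tr_eq_trace: "tr L = trace (matrix L)"
  by (simp add: tr_def trace_def matrix_def)

text \<open>
  Differentiating $D\Phi(U) = Y \circ \Phi$ and using the symmetry of $D^2\Phi$ gives
  $D_U(D\Phi) + D\Phi \circ DU = DY \circ D\Phi$. Composing with $D\Phi^{-1}$ and taking traces,
  $\operatorname{tr}(D\Phi^{-1} D_U(D\Phi)) + \operatorname{tr} DU = \operatorname{tr} DY$, and the first
  term is the logarithmic derivative of $\det D\Phi$ along \<open>U\<close>. The symmetry of $D^2\Phi$ is the reason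
  why \<open>\<Phi>\<close> has to be of class $C^2$.
\<close>

lemma coord_div_pullback:
  fixes \<Phi> U Y :: "real^'m \<Rightarrow> real^'m" and G G' :: "real^'m \<Rightarrow> real"
  assumes \<Omega>: "open \<Omega>" "z \<in> \<Omega>" and \<Phi>: "Cn_on (Suc (Suc 0)) \<Omega> \<Phi>"
    and det: "det (matrix (frechet_derivative \<Phi> (at z))) \<noteq> 0"
    and G: "G differentiable (at (\<Phi> z))" "G (\<Phi> z) \<noteq> 0" and Y: "Y differentiable (at (\<Phi> z))" and U: "U differentiable (at z)"
    and UY: "\<And>x. x \<in> \<Omega> \<Longrightarrow> frechet_derivative \<Phi> (at x) (U x) = Y (\<Phi> x)"
    and G': "\<And>x. x \<in> \<Omega> \<Longrightarrow> G' x = G (\<Phi> x) * (det (matrix (frechet_derivative \<Phi> (at x))))\<^sup>2"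
  shows "coord_div G' U z = coord_div G Y (\<Phi> z)"
proof -
  define E where "E x = frechet_derivative \<Phi> (at x)" for x
  define H where "H e = frechet_derivative (\<lambda>x. E x e) (at z)" for e
  define M where "M x = matrix (E x)" for x
  let ?DG = "frechet_derivative G (at (\<Phi> z))" and ?DY = "frechet_derivative Y (at (\<Phi> z))" and ?DU = "frechet_derivative U (at z)"
  have dG: "(G has_derivative ?DG) (at (\<Phi> z))" and dY: "(Y has_derivative ?DY) (at (\<Phi> z))" and dU: "(U has_derivative ?DU) (at z)"
    using G(1) Y U by (simp_all add: frechet_derivative_works)
  have d\<Phi>: "(\<Phi> has_derivative E x) (at x)" if "x \<in> \<Omega>" for x
    using Cn_on_has_derivative[OF \<Phi> that] by (simp add: E_def)
  have linE: "linear (E x)" if "x \<in> \<Omega>" for x using d\<Phi>[OF that] has_derivative_linear by blast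
  have dE: "((\<lambda>x. E x e) has_derivative H e) (at z)" for e
    using Cn_on_has_derivative[OF Cn_on_frechet[OF \<Phi>] \<Omega>(2)] by (simp add: E_def H_def)
  have linH: "linear (H e)" for e using dE has_derivative_linear by blast
  have comm: "H e u = H u e" for e u
    using frechet_derivative_commute[OF \<Omega>(1) \<Phi> \<Omega>(2)] by (simp add: H_def E_def)
  define u where "u = U z"
  have key: "H e u + E z (?DU e) = ?DY (E z e)" for e
  proof -
    have "((\<lambda>x. \<Sum>i\<in>UNIV. (U x $ i) *\<^sub>R E x (axis i 1)) has_derivative
      (\<lambda>e. \<Sum>i\<in>UNIV. (U z $ i) *\<^sub>R H (axis i 1) e + (?DU e $ i) *\<^sub>R E z (axis i 1))) (at z)"
      by (intro has_derivative_sum has_derivative_scaleR dE bounded_linear.has_derivative[OF bounded_linear_vec_nth] dU)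
    then have "((\<lambda>x. Y (\<Phi> x)) has_derivative
      (\<lambda>e. \<Sum>i\<in>UNIV. (U z $ i) *\<^sub>R H (axis i 1) e + (?DU e $ i) *\<^sub>R E z (axis i 1))) (at z)"
    proof (rule has_derivative_transform_within_open[OF _ \<Omega>])
      fix x assume x: "x \<in> \<Omega>"
      show "(\<Sum>i\<in>UNIV. (U x $ i) *\<^sub>R E x (axis i 1)) = Y (\<Phi> x)"
        using linear_axis_expansion[OF linE[OF x], of "U x"] UY[OF x] by (simp add: E_def)
    qed
    from has_derivative_unique[OF this has_derivative_compose[OF d\<Phi>[OF \<Omega>(2)] dY]]
    have "(\<Sum>i\<in>UNIV. (u $ i) *\<^sub>R H (axis i 1) e + (?DU e $ i) *\<^sub>R E z (axis i 1)) = ?DY (E z e)"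
      unfolding u_def by metis
    moreover have "(\<Sum>i\<in>UNIV. (u $ i) *\<^sub>R H (axis i 1) e) = H e u"
      unfolding comm[of _ e] by (rule linear_axis_expansion[OF linH, symmetric])
    ultimately show ?thesis
      using linear_axis_expansion[OF linE[OF \<Omega>(2)], of "?DU e"] by (simp add: sum.distrib)
  qed
  define N where "N = (\<chi> i j. H (axis j 1) u $ i)"
  have dM: "(M has_derivative (\<lambda>h. \<chi> i j. H (axis j 1) h $ i)) (at z)"
  proof -
    have comp: "((\<lambda>x. M x $ i $ j) has_derivative (\<lambda>h. H (axis j 1) h $ i)) (at z)" for i j
      using bounded_linear.has_derivative[OF bounded_linear_vec_nth dE] by (simp add: M_def matrix_def)
    show ?thesis
      by (rule has_derivative_componentwise_within[THEN iffD2])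
        (auto simp: Basis_vec_def inner_axis comp)
  qed
  have detz: "det (M z) \<noteq> 0" using det by (simp add: M_def E_def)
  then obtain P where P: "M z ** P = mat 1" "P ** M z = mat 1"
    using invertible_det_nz[of "M z"] by (auto simp: invertible_def)
  define D where "D h = (\<Sum>j\<in>UNIV. det (\<chi> i. if i = j then (\<chi> i j. H (axis j 1) h $ i) $ i else M z $ i))" for h
  have ddet: "((\<lambda>x. det (M x)) has_derivative D) (at z)"
    unfolding D_def by (rule has_derivative_det[OF dM])
  have "D u = trace (P ** N) * det (M z)"
  proof -
    define X where "X = P ** N"
    have "N = M z ** X" using P(1) by (simp add: X_def matrix_mul_assoc)
    then have row: "N $ i = M z $ i v* X" for i
      by (simp add: matrix_matrix_mult_def vector_matrix_mult_def vec_eq_iff mult.commute)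
    have "D u = (\<Sum>j\<in>UNIV. det (\<chi> i. if i = j then N $ i else M z $ i))"
      by (simp only: D_def N_def)
    also have "\<dots> = trace X * det (M z)"
      unfolding row by (rule sum_det_replace_row)
    finally show ?thesis by (simp add: X_def)
  qed
  moreover have "trace (P ** N) + tr ?DU = tr ?DY"
  proof -
    have lin: "linear ?DU" "linear ?DY" using dU dY has_derivative_linear by blast+
    have "N + M z ** matrix ?DU = matrix ?DY ** M z"
    proof -
      have "(N + M z ** matrix ?DU) *v e = (matrix ?DY ** M z) *v e" for e
      proof -
        have Nu: "linear (\<lambda>e. H e u)" unfolding comm[of _ u] by (rule linH)
        have "N *v e = H e u"
        proof -
          have "N = matrix (\<lambda>e. H e u)" by (simp add: N_def matrix_def)
          then show ?thesis using matrix_mult_linear[OF Nu] by simp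
        qed
        moreover have "M z *v x = E z x" for x using matrix_mult_linear[OF linE[OF \<Omega>(2)]] by (simp add: M_def)
        ultimately show ?thesis using key[of e]
          by (simp add: matrix_vector_mult_add_rdistrib matrix_vector_mul_assoc[symmetric] matrix_mult_linear[OF lin(1)] matrix_mult_linear[OF lin(2)])
      qed
      then show ?thesis by (metis matrix_eq)
    qed
    then have "P ** N + matrix ?DU = P ** (matrix ?DY ** M z)"
      using P(2) by (metis matrix_add_ldistrib matrix_mul_assoc matrix_mul_lid)
    then have "trace (P ** N) + trace (matrix ?DU) = trace (P ** (matrix ?DY ** M z))"
      by (metis trace_add)
    also have "\<dots> = trace (matrix ?DY)"
      using P(1) by (subst trace_mul_sym) (metis matrix_mul_assoc matrix_mul_rid)
    finally show ?thesis by (simp add: tr_eq_trace)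
  qed
  moreover have "frechet_derivative G' (at z) u = ?DG (Y (\<Phi> z)) * (det (M z))\<^sup>2 + G (\<Phi> z) * (2 * det (M z) * D u)"
  proof -
    have "((\<lambda>x. G (\<Phi> x) * (det (M x))\<^sup>2) has_derivative
      (\<lambda>h. G (\<Phi> z) * (of_nat 2 * D h * det (M z) ^ (2 - 1)) + ?DG (E z h) * (det (M z))\<^sup>2)) (at z)"
      by (intro has_derivative_mult has_derivative_power has_derivative_compose[OF d\<Phi>[OF \<Omega>(2)] dG] ddet)
    then have "(G' has_derivative
      (\<lambda>h. G (\<Phi> z) * (of_nat 2 * D h * det (M z) ^ (2 - 1)) + ?DG (E z h) * (det (M z))\<^sup>2)) (at z)"
      by (rule has_derivative_transform_within_open[OF _ \<Omega>]) (simp add: G' M_def E_def)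
    from frechet_derivative_at[OF this, symmetric] show ?thesis
      using UY[OF \<Omega>(2)] by (simp add: u_def E_def algebra_simps)
  qed
  moreover have "G' z = G (\<Phi> z) * (det (M z))\<^sup>2" using G' \<Omega>(2) by (simp add: M_def E_def)
  moreover have "(a * d\<^sup>2 + e * (2 * d * (t * d))) / (2 * (e * d\<^sup>2)) = a / (2 * e) + t"
    if "d \<noteq> 0" "e \<noteq> 0" for a d e t :: real
    using that by (simp add: field_simps power2_eq_square)
  from this[OF detz G(2)]
  have "(?DG (Y (\<Phi> z)) * (det (M z))\<^sup>2 + G (\<Phi> z) * (2 * det (M z) * (trace (P ** N) * det (M z)))) / (2 * (G (\<Phi> z) * (det (M z))\<^sup>2))
    = ?DG (Y (\<Phi> z)) / (2 * G (\<Phi> z)) + trace (P ** N)" .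
  ultimately show ?thesis
    unfolding coord_div_def u_def[symmetric] by simp
qed

section \<open>Charts\<close>

abbreviation trans_deriv :: "('a, 'm::finite) chart \<Rightarrow> ('a, 'm) chart \<Rightarrow> 'a \<Rightarrow> real^'m \<Rightarrow> real^'m" where
  "trans_deriv c d p \<equiv> differential c d (\<lambda>x. x) p"

definition Cn_fun :: "nat \<Rightarrow> ('a, 'm::finite) chart set \<Rightarrow> ('a \<Rightarrow> real) \<Rightarrow> bool" where
  "Cn_fun n A f \<longleftrightarrow> (\<forall>c\<in>A. Cn_on n (coord c ` chart_dom c) (\<lambda>x. f (chart_inv c x)))"

lemma Ck_fun_iff: "Ck_fun k A f \<longleftrightarrow> (\<forall>n. enat n \<le> k \<longrightarrow> Cn_fun n A f)"
  by (auto simp: Ck_fun_def Cn_fun_def Ck_on_def o_def)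

text \<open>
  The transformation law of vector fields alone. The normal lift obeys it, but is in general only
  as regular as the differential of the submersion.
\<close>

definition transforms :: "('a, 'm::finite) chart set \<Rightarrow> ('a, 'm) vfield \<Rightarrow> bool" where
  "transforms A X \<longleftrightarrow> (\<forall>c\<in>A. \<forall>d\<in>A. \<forall>p\<in>chart_dom c \<inter> chart_dom d. X d p = trans_deriv c d p (X c p))"

lemma transformsD:
  "transforms A X \<Longrightarrow> c \<in> A \<Longrightarrow> d \<in> A \<Longrightarrow> p \<in> chart_dom c \<Longrightarrow> p \<in> chart_dom d \<Longrightarrow> X d p = trans_deriv c d p (X c p)"
  unfolding transforms_def by blast

lemma smooth_vector_fieldD:
  assumes "smooth_vector_field A X"
  shows "transforms A X" "c \<in> A \<Longrightarrow> Cn_on n (coord c ` chart_dom c) (\<lambda>x. X c (chart_inv c x))"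
proof -
  show "transforms A X" using assms unfolding smooth_vector_field_def transforms_def by (rule conjunct2)
  show "Cn_on n (coord c ` chart_dom c) (\<lambda>x. X c (chart_inv c x))" if "c \<in> A"
    using conjunct1[OF assms[unfolded smooth_vector_field_def]] that unfolding Ck_on_def by simp
qed

locale oriented_manifold =
  fixes A :: "('a::{t2_space, second_countable_topology}, 'm::finite) chart set"
  assumes atlas: "oriented_atlas A"
begin

lemma chart_at: "chart_at A p \<in> A" "p \<in> chart_dom (chart_at A p)"
proof -
  have "p \<in> (\<Union>c\<in>A. chart_dom c)" using atlas by (simp add: oriented_atlas_def)
  then have "\<exists>c. c \<in> A \<and> p \<in> chart_dom c" by blast
  then have "chart_at A p \<in> A \<and> p \<in> chart_dom (chart_at A p)" unfolding chart_at_def by (rule someI_ex)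
  then show "chart_at A p \<in> A" "p \<in> chart_dom (chart_at A p)" by auto
qed

context
  fixes c assumes c: "c \<in> A"
begin

lemma chart: "is_chart c"
  using atlas c by (simp add: oriented_atlas_def)

lemma chart_homeomorphism: "homeomorphism (chart_dom c) (coord c ` chart_dom c) (coord c) (chart_inv c)"
  using chart by (simp add: is_chart_def)

lemma open_chart_dom: "open (chart_dom c)" and open_chart_image: "open (coord c ` chart_dom c)"
  using chart by (simp_all add: is_chart_def)

lemma chart_inv_coord: "p \<in> chart_dom c \<Longrightarrow> chart_inv c (coord c p) = p"
  using chart_homeomorphism by (auto simp: homeomorphism_def)

lemma coord_chart_inv: "x \<in> coord c ` chart_dom c \<Longrightarrow> coord c (chart_inv c x) = x"
  using chart_homeomorphism by (auto simp: homeomorphism_def)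

lemma chart_inv_in_dom: "x \<in> coord c ` chart_dom c \<Longrightarrow> chart_inv c x \<in> chart_dom c"
  using chart_homeomorphism by (auto simp: homeomorphism_def)

lemma continuous_coord: "continuous_on (chart_dom c) (coord c)"
  and continuous_chart_inv: "continuous_on (coord c ` chart_dom c) (chart_inv c)"
  using chart_homeomorphism by (auto simp: homeomorphism_def)

lemma coord_image_eq:
  assumes "V \<subseteq> chart_dom c"
  shows "coord c ` V = coord c ` chart_dom c \<inter> chart_inv c -` V"
proof (intro equalityI subsetI)
  fix x assume "x \<in> coord c ` V"
  then obtain p where p: "p \<in> V" "x = coord c p" by blast
  with assms have "chart_inv c x = p" by (simp add: chart_inv_coord subset_iff)
  with p assms show "x \<in> coord c ` chart_dom c \<inter> chart_inv c -` V" by auto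
next
  fix x assume "x \<in> coord c ` chart_dom c \<inter> chart_inv c -` V"
  then have "chart_inv c x \<in> V" "x = coord c (chart_inv c x)" using coord_chart_inv by auto
  then show "x \<in> coord c ` V" by blast
qed

lemma open_coord_image: "open V \<Longrightarrow> V \<subseteq> chart_dom c \<Longrightarrow> open (coord c ` V)"
  by (subst coord_image_eq) (auto intro: continuous_open_preimage[OF continuous_chart_inv open_chart_image])

lemma open_coord_preimage: "open T \<Longrightarrow> open (chart_dom c \<inter> coord c -` T)"
  by (rule continuous_open_preimage[OF continuous_coord open_chart_dom])

lemma coord_inj: "p \<in> chart_dom c \<Longrightarrow> q \<in> chart_dom c \<Longrightarrow> coord c p = coord c q \<Longrightarrow> p = q"
  by (drule arg_cong[of _ _ "chart_inv c"]) (simp add: chart_inv_coord)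

end

lemma Cn_on_transition:
  assumes "c \<in> A" "d \<in> A"
  shows "Cn_on n (coord c ` (chart_dom c \<inter> chart_dom d)) (\<lambda>x. coord d (chart_inv c x))"
proof -
  have "Ck_on \<infinity> (coord c ` (chart_dom c \<inter> chart_dom d)) (coord d \<circ> chart_inv c)"
    using atlas assms unfolding oriented_atlas_def by blast
  then show ?thesis by (simp add: Ck_on_def o_def)
qed

lemma open_transition_domain:
  assumes "c \<in> A" "d \<in> A"
  shows "open (coord c ` (chart_dom c \<inter> chart_dom d))"
  using assms by (intro open_coord_image open_Int open_chart_dom) auto

lemma transition_has_derivative:
  assumes "c \<in> A" "d \<in> A" "p \<in> chart_dom c" "p \<in> chart_dom d"
  shows "((\<lambda>x. coord d (chart_inv c x)) has_derivative trans_deriv c d p) (at (coord c p))"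
  using Cn_on_has_derivative[OF Cn_on_transition[OF assms(1,2), of "Suc 0"], of "coord c p"] assms(3,4)
  by (simp add: differential_def o_def)

lemma linear_trans_deriv:
  assumes "c \<in> A" "d \<in> A" "p \<in> chart_dom c" "p \<in> chart_dom d"
  shows "linear (trans_deriv c d p)"
  using transition_has_derivative[OF assms] has_derivative_linear by blast

lemma det_trans_deriv:
  assumes "c \<in> A" "d \<in> A" "p \<in> chart_dom c" "p \<in> chart_dom d"
  shows "det (matrix (trans_deriv c d p)) \<noteq> 0"
proof -
  have "det (matrix (trans_deriv c d p)) > 0" using atlas assms unfolding oriented_atlas_def by blast
  then show ?thesis by simp
qed

lemma inj_trans_deriv:
  assumes "c \<in> A" "d \<in> A" "p \<in> chart_dom c" "p \<in> chart_dom d"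
  shows "inj (trans_deriv c d p)"
  using det_nz_iff_inj[OF linear_trans_deriv[OF assms]] det_trans_deriv[OF assms] by simp

lemma has_derivative_change_chart:
  assumes cd: "c \<in> A" "d \<in> A" "p \<in> chart_dom c" "p \<in> chart_dom d"
    and f: "((\<lambda>x. f (chart_inv d x)) has_derivative f') (at (coord d p))"
  shows "((\<lambda>x. f (chart_inv c x)) has_derivative (\<lambda>v. f' (trans_deriv c d p v))) (at (coord c p))"
proof -
  have 1: "coord d p = coord d (chart_inv c (coord c p))" using chart_inv_coord[OF cd(1,3)] by simp
  have "((\<lambda>x. f (chart_inv d (coord d (chart_inv c x)))) has_derivative (\<lambda>v. f' (trans_deriv c d p v))) (at (coord c p))"
    by (rule has_derivative_compose[OF transition_has_derivative[OF cd]]) (use f 1 in simp)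
  then show ?thesis
    by (rule has_derivative_transform_within_open[OF _ open_transition_domain[OF cd(1,2)]])
      (use cd in \<open>auto simp: chart_inv_coord\<close>)
qed

lemma trans_deriv_compose:
  assumes "c \<in> A" "d \<in> A" "e \<in> A" "p \<in> chart_dom c" "p \<in> chart_dom d" "p \<in> chart_dom e"
  shows "trans_deriv d e p (trans_deriv c d p v) = trans_deriv c e p v"
proof -
  have "((\<lambda>x. coord e (chart_inv c x)) has_derivative (\<lambda>v. trans_deriv d e p (trans_deriv c d p v))) (at (coord c p))"
    by (rule has_derivative_change_chart[OF assms(1,2,4,5) transition_has_derivative[OF assms(2,3,5,6)]])
  from has_derivative_unique[OF this transition_has_derivative[OF assms(1,3,4,6)]] show ?thesis by metis
qed

lemma trans_deriv_self:
  assumes "c \<in> A" "p \<in> chart_dom c"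
  shows "trans_deriv c c p v = v"
  using inj_trans_deriv[OF assms(1,1,2,2)] trans_deriv_compose[OF assms(1,1,1,2,2,2), of v] by (simp add: inj_eq)

lemma derivative_along_chart:
  assumes c: "c \<in> A" "p \<in> chart_dom c" and X: "transforms A X"
    and f: "(\<lambda>x. f (chart_inv c x)) differentiable (at (coord c p))"
  shows "derivative_along A X f p = frechet_derivative (\<lambda>x. f (chart_inv c x)) (at (coord c p)) (X c p)"
proof -
  let ?d = "chart_at A p"
  note d = chart_at[of p]
  have "((\<lambda>x. f (chart_inv ?d x)) has_derivative
      (\<lambda>v. frechet_derivative (\<lambda>x. f (chart_inv c x)) (at (coord c p)) (trans_deriv ?d c p v))) (at (coord ?d p))"
    by (rule has_derivative_change_chart) (use c d f in \<open>auto simp: frechet_derivative_works\<close>)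
  from frechet_derivative_at[OF this, symmetric] show ?thesis
    unfolding derivative_along_def Let_def o_def transformsD[OF X d(1) c(1) d(2) c(2)] by simp
qed

text \<open>
  By the smoothness of the transition maps, one chart around each point decides the regularity of a
  function.
\<close>

lemma Cn_fun_localI:
  assumes "\<And>p. \<exists>c\<in>A. \<exists>V. open V \<and> p \<in> V \<and> V \<subseteq> chart_dom c \<and> Cn_on n (coord c ` V) (\<lambda>x. f (chart_inv c x))"
  shows "Cn_fun n A f"
  unfolding Cn_fun_def
proof (intro ballI Cn_on_local)
  fix d x assume d: "d \<in> A" and x: "x \<in> coord d ` chart_dom d"
  define p where "p = chart_inv d x"
  have p: "p \<in> chart_dom d" "coord d p = x" using chart_inv_in_dom[OF d x] coord_chart_inv[OF d x] by (simp_all add: p_def)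
  obtain c V where c: "c \<in> A" "open V" "p \<in> V" "V \<subseteq> chart_dom c" "Cn_on n (coord c ` V) (\<lambda>x. f (chart_inv c x))"
    using assms by blast
  have dV: "V \<inter> chart_dom d \<subseteq> chart_dom d" "open (V \<inter> chart_dom d)" using c(2) open_chart_dom[OF d] by auto
  have oV: "open (coord d ` (V \<inter> chart_dom d))" by (rule open_coord_image[OF d dV(2,1)])
  have sub: "coord d ` (V \<inter> chart_dom d) \<subseteq> coord d ` (chart_dom d \<inter> chart_dom c)" using c(4) by auto
  have inv: "chart_inv d y \<in> V" "chart_inv d y \<in> chart_dom d" if "y \<in> coord d ` (V \<inter> chart_dom d)" for y
    using that chart_inv_coord[OF d] by auto
  have "Cn_on n (coord d ` (V \<inter> chart_dom d)) (\<lambda>y. f (chart_inv c (coord c (chart_inv d y))))"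
    by (rule Cn_on_compose[OF oV open_coord_image[OF c(1,2,4)] c(5) Cn_on_subset[OF Cn_on_transition[OF d c(1)] sub]])
      (use inv in auto)
  then have "Cn_on n (coord d ` (V \<inter> chart_dom d)) (\<lambda>y. f (chart_inv d y))"
    by (rule Cn_on_cong[OF oV, rotated]) (use inv c(4) in \<open>auto simp: chart_inv_coord[OF c(1)] subset_iff\<close>)
  then show "\<exists>T. open T \<and> x \<in> T \<and> Cn_on n T (\<lambda>y. f (chart_inv d y))"
    using oV p c(3) by blast
qed

text \<open>
  Outside the closed set \<open>S\<close>, usually a support, regularity and derivatives are those of the zero
  function.
\<close>

lemma locally_zero:
  assumes S: "closed S" "\<And>q. q \<notin> S \<Longrightarrow> f q = 0" and p: "p \<notin> S"
  shows "\<exists>c\<in>A. \<exists>V. open V \<and> p \<in> V \<and> V \<subseteq> chart_dom c \<and> Cn_on n (coord c ` V) (\<lambda>x. f (chart_inv c x))"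
    and "derivative_along A X f p = 0"
proof -
  let ?c = "chart_at A p" and ?V = "chart_dom (chart_at A p) \<inter> - S"
  note c = chart_at[of p]
  have V: "open ?V" "p \<in> ?V" "?V \<subseteq> chart_dom ?c"
    using S(1) open_chart_dom[OF c(1)] c(2) p by (auto simp: open_Int open_Compl)
  have oV: "open (coord ?c ` ?V)" by (rule open_coord_image[OF c(1) V(1,3)])
  have z: "0 = f (chart_inv ?c x)" if "x \<in> coord ?c ` ?V" for x using that chart_inv_coord[OF c(1)] S(2) by auto
  have "Cn_on n (coord ?c ` ?V) (\<lambda>x. f (chart_inv ?c x))" by (rule Cn_on_cong[OF oV z Cn_on_const])
  with c(1) V show "\<exists>c\<in>A. \<exists>V. open V \<and> p \<in> V \<and> V \<subseteq> chart_dom c \<and> Cn_on n (coord c ` V) (\<lambda>x. f (chart_inv c x))"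
    by (intro bexI[of _ ?c] exI[of _ ?V] conjI)
  have "((\<lambda>x. f (chart_inv ?c x)) has_derivative (\<lambda>v. 0)) (at (coord ?c p))"
    by (rule has_derivative_transform_within_open[OF has_derivative_const oV _ z]) (use V(2) in auto)
  from frechet_derivative_at[OF this, symmetric] show "derivative_along A X f p = 0"
    by (simp add: derivative_along_def Let_def o_def)
qed

lemma Cn_fun_continuous:
  assumes "Cn_fun n A f" shows "continuous_on UNIV f"
proof -
  have "continuous (at p) f" for p
  proof -
    note c = chart_at[of p]
    have "continuous_on (chart_dom (chart_at A p)) (\<lambda>q. f (chart_inv (chart_at A p) (coord (chart_at A p) q)))"
      using assms c by (intro continuous_on_compose2[OF Cn_on_continuous_on continuous_coord[OF c(1)]]) (auto simp: Cn_fun_def)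
    then have "continuous_on (chart_dom (chart_at A p)) f"
      by (rule continuous_on_eq) (simp add: chart_inv_coord[OF c(1)])
    then show ?thesis using c open_chart_dom[OF c(1)] by (simp add: continuous_on_eq_continuous_at)
  qed
  then show ?thesis by (simp add: continuous_at_imp_continuous_on)
qed

lemma derivative_along_sum:
  assumes "\<And>i. i \<in> I \<Longrightarrow> Cn_fun (Suc 0) A (f i)"
  shows "derivative_along A X (\<lambda>p. \<Sum>i\<in>I. f i p) p = (\<Sum>i\<in>I. derivative_along A X (f i) p)"
proof -
  let ?c = "chart_at A p"
  note c = chart_at[of p]
  let ?D = "\<lambda>i. frechet_derivative (\<lambda>x. f i (chart_inv ?c x)) (at (coord ?c p))"
  have "((\<lambda>x. f i (chart_inv ?c x)) has_derivative ?D i) (at (coord ?c p))" if "i \<in> I" for i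
  proof (rule Cn_on_has_derivative)
    show "Cn_on (Suc 0) (coord ?c ` chart_dom ?c) (\<lambda>x. f i (chart_inv ?c x))"
      using assms[OF that] c(1) unfolding Cn_fun_def by blast
  qed (use c(2) in blast)
  then have "((\<lambda>x. \<Sum>i\<in>I. f i (chart_inv ?c x)) has_derivative (\<lambda>v. \<Sum>i\<in>I. ?D i v)) (at (coord ?c p))"
    by (rule has_derivative_sum)
  from frechet_derivative_at[OF this, symmetric] show ?thesis
    by (simp add: derivative_along_def Let_def o_def)
qed

lemma Cn_fun_le: "Cn_fun n A f \<Longrightarrow> k \<le> n \<Longrightarrow> Cn_fun k A f"
  unfolding Cn_fun_def using Cn_on_le by blast

lemma Cn_fun_mult: "Cn_fun n A f \<Longrightarrow> Cn_fun n A f' \<Longrightarrow> Cn_fun n A (\<lambda>p. f p * f' p)"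
  unfolding Cn_fun_def by (intro ballI Cn_on_mult open_chart_image) auto

lemma Cn_fun_sum: "(\<And>i. i \<in> I \<Longrightarrow> Cn_fun n A (f i)) \<Longrightarrow> Cn_fun n A (\<lambda>p. \<Sum>i\<in>I. f i p)"
  unfolding Cn_fun_def by (intro ballI Cn_on_sum open_chart_image) auto

lemma Cn_fun_divide:
  assumes f: "Cn_fun n A f" and b: "Cn_fun n A b" and S: "closed S" "\<And>p. p \<in> S \<Longrightarrow> b p \<noteq> 0" "\<And>p. p \<notin> S \<Longrightarrow> f p = 0"
  shows "Cn_fun n A (\<lambda>p. f p / b p)"
proof (rule Cn_fun_localI)
  fix q
  let ?c = "chart_at A q"
  note c = chart_at[of q]
  let ?V = "chart_dom ?c \<inter> (if q \<in> S then {p. b p \<noteq> 0} else - S)"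
  have "open {p. b p \<noteq> 0}"
    by (rule open_Collect_neq[OF Cn_fun_continuous[OF b] continuous_on_const])
  then have o: "open ?V" using S(1) open_chart_dom[OF c(1)] by (simp add: open_Int open_Compl)
  have oi: "open (coord ?c ` ?V)" by (rule open_coord_image[OF c(1) o]) simp
  have sub: "coord ?c ` ?V \<subseteq> coord ?c ` chart_dom ?c" by auto
  have inv: "chart_inv ?c x \<in> ?V" if "x \<in> coord ?c ` ?V" for x using that chart_inv_coord[OF c(1)] by auto
  have "Cn_on n (coord ?c ` ?V) (\<lambda>x. f (chart_inv ?c x) / b (chart_inv ?c x))"
  proof (cases "q \<in> S")
    case True
    show ?thesis
    proof (rule Cn_on_divide[OF oi])
      show "Cn_on n (coord ?c ` ?V) (\<lambda>x. f (chart_inv ?c x))" "Cn_on n (coord ?c ` ?V) (\<lambda>x. b (chart_inv ?c x))"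
        by (rule Cn_on_subset[OF _ sub], use f b c(1) in \<open>simp add: Cn_fun_def\<close>)+
      show "b (chart_inv ?c x) \<noteq> 0" if "x \<in> coord ?c ` ?V" for x using inv[OF that] True by simp
    qed
  next
    case False
    show ?thesis
    proof (rule Cn_on_cong[OF oi _ Cn_on_const[of _ _ 0]])
      show "0 = f (chart_inv ?c x) / b (chart_inv ?c x)" if "x \<in> coord ?c ` ?V" for x using inv[OF that] False S(3) by simp
    qed
  qed
  moreover have "q \<in> ?V" using c(2) S(2) by simp
  ultimately show "\<exists>c\<in>A. \<exists>V. open V \<and> q \<in> V \<and> V \<subseteq> chart_dom c \<and> Cn_on n (coord c ` V) (\<lambda>x. f (chart_inv c x) / b (chart_inv c x))"
    using c(1) o by (intro bexI[of _ ?c] exI[of _ ?V]) simp_all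
qed

end

section \<open>The Riemannian volume form and the divergence\<close>

locale riemannian = oriented_manifold A
  for A :: "('a::{t2_space, second_countable_topology}, 'm::finite) chart set" +
  fixes g :: "('a, 'm) metric"
  assumes metric: "riemannian_metric A g"
begin

text \<open>
  The square of the density of the Riemannian volume form in the chart \<open>c\<close>.
\<close>

definition gdet :: "('a, 'm) chart \<Rightarrow> real^'m \<Rightarrow> real" where
  "gdet c x = det (gram (g c (chart_inv c x)))"

lemma metric_inner: "c \<in> A \<Longrightarrow> p \<in> chart_dom c \<Longrightarrow> inner_form (g c p)"
  using metric unfolding riemannian_metric_def inner_form_def by blast

lemma metric_trans:
  assumes "c \<in> A" "d \<in> A" "p \<in> chart_dom c" "p \<in> chart_dom d"
  shows "g c p = (\<lambda>v w. g d p (trans_deriv c d p v) (trans_deriv c d p w))"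
proof (intro ext)
  show "g c p v w = g d p (trans_deriv c d p v) (trans_deriv c d p w)" for v w
    using metric assms unfolding riemannian_metric_def by blast
qed

lemma Cn_on_metric: "c \<in> A \<Longrightarrow> Cn_on n (coord c ` chart_dom c) (\<lambda>x. g c (chart_inv c x) v w)"
  using metric unfolding riemannian_metric_def Ck_on_def by simp

lemma Cn_on_gdet: "c \<in> A \<Longrightarrow> Cn_on n (coord c ` chart_dom c) (gdet c)"
  unfolding gdet_def[abs_def] by (intro Cn_on_det open_chart_image) (simp_all add: gram_def Cn_on_metric)

lemma gdet_pos: "c \<in> A \<Longrightarrow> x \<in> coord c ` chart_dom c \<Longrightarrow> gdet c x > 0"
  unfolding gdet_def by (intro det_gram_pos metric_inner chart_inv_in_dom)

lemma gdet_trans: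
  assumes "c \<in> A" "d \<in> A" "p \<in> chart_dom c" "p \<in> chart_dom d"
  shows "gdet c (coord c p) = gdet d (coord d p) * (det (matrix (trans_deriv c d p)))\<^sup>2"
proof -
  have "bilinear (g d p)" using metric_inner[OF assms(2,4)] by (simp add: inner_form_def)
  then have "det (gram (g c p)) = (det (matrix (trans_deriv c d p)))\<^sup>2 * det (gram (g d p))"
    by (subst metric_trans[OF assms]) (rule det_gram_pullback[OF _ linear_trans_deriv[OF assms]])
  then show ?thesis using assms by (simp add: gdet_def chart_inv_coord)
qed

lemma volume_form_eq: "volume_form g c p V = sqrt (det (gram (g c p))) * det V"
  by (simp add: volume_form_def gram_def)

text \<open>
  The transition map pulls the coordinate representation of \<open>Y\<close> in \<open>d\<close> back to the one in \<open>c\<close>, and it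
  transforms the Gram determinants by the square of its Jacobian.
\<close>

lemma coord_div_change_chart:
  assumes cd: "c \<in> A" "d \<in> A" "p \<in> chart_dom c" "p \<in> chart_dom d" and Y: "transforms A Y"
    and diff: "(\<lambda>x. Y c (chart_inv c x)) differentiable (at (coord c p))"
      "(\<lambda>x. Y d (chart_inv d x)) differentiable (at (coord d p))"
  shows "coord_div (gdet c) (\<lambda>x. Y c (chart_inv c x)) (coord c p) = coord_div (gdet d) (\<lambda>x. Y d (chart_inv d x)) (coord d p)"
proof -
  let ?\<Omega> = "coord c ` (chart_dom c \<inter> chart_dom d)" and ?\<Phi> = "\<lambda>x. coord d (chart_inv c x)"
  have D: "frechet_derivative ?\<Phi> (at x) = trans_deriv c d (chart_inv c x)"
    and inv: "chart_inv c x \<in> chart_dom c" "chart_inv c x \<in> chart_dom d" "coord c (chart_inv c x) = x" if x: "x \<in> ?\<Omega>" for x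
  proof -
    obtain q where q: "q \<in> chart_dom c" "q \<in> chart_dom d" "x = coord c q" using x by auto
    then show "frechet_derivative ?\<Phi> (at x) = trans_deriv c d (chart_inv c x)"
      using frechet_derivative_at[OF transition_has_derivative[OF cd(1,2) q(1,2)]] chart_inv_coord[OF cd(1) q(1)] by simp
    show "chart_inv c x \<in> chart_dom c" "chart_inv c x \<in> chart_dom d" "coord c (chart_inv c x) = x"
      using q chart_inv_coord[OF cd(1) q(1)] by auto
  qed
  have p: "coord c p \<in> ?\<Omega>" "?\<Phi> (coord c p) = coord d p" using cd chart_inv_coord[OF cd(1,3)] by auto
  have "coord_div (gdet c) (\<lambda>x. Y c (chart_inv c x)) (coord c p) = coord_div (gdet d) (\<lambda>x. Y d (chart_inv d x)) (?\<Phi> (coord c p))"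
  proof (rule coord_div_pullback[OF open_transition_domain[OF cd(1,2)] p(1) Cn_on_transition[OF cd(1,2)]])
    show "det (matrix (frechet_derivative ?\<Phi> (at (coord c p)))) \<noteq> 0"
      unfolding D[OF p(1)] by (rule det_trans_deriv) (use inv[OF p(1)] cd in auto)
    have "coord d p \<in> coord d ` chart_dom d" using cd by auto
    then show "gdet d (?\<Phi> (coord c p)) \<noteq> 0" "gdet d differentiable (at (?\<Phi> (coord c p)))"
      using gdet_pos[OF cd(2)] Cn_on_gdet[OF cd(2), of "Suc 0"] unfolding p(2) by (force, auto)
    show "(\<lambda>x. Y d (chart_inv d x)) differentiable (at (?\<Phi> (coord c p)))" using diff(2) p(2) by simp
    show "(\<lambda>x. Y c (chart_inv c x)) differentiable (at (coord c p))" by (rule diff)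
  next
    fix x assume x: "x \<in> ?\<Omega>"
    show "frechet_derivative ?\<Phi> (at x) (Y c (chart_inv c x)) = Y d (chart_inv d (?\<Phi> x))"
      unfolding D[OF x] chart_inv_coord[OF cd(2) inv(2)[OF x]]
      by (rule transformsD[OF Y cd(1,2) inv(1,2)[OF x], symmetric])
    show "gdet c x = gdet d (?\<Phi> x) * (det (matrix (frechet_derivative ?\<Phi> (at x))))\<^sup>2"
      using gdet_trans[OF cd(1,2) inv(1,2)[OF x]] D[OF x] inv(3)[OF x] by simp
  qed
  then show ?thesis unfolding p(2) .
qed

text \<open>
  The terms of the Lie derivative with brackets add up to a trace times the volume form, so the Lie
  derivative is a multiple of the volume form; evaluation on the standard frame shows that the
  factor is unique.
\<close>

lemma divergence_chart:
  assumes c: "c \<in> A" "p \<in> chart_dom c" and Y: "transforms A Y"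
    and diff: "\<And>c. c \<in> A \<Longrightarrow> p \<in> chart_dom c \<Longrightarrow> (\<lambda>x. Y c (chart_inv c x)) differentiable (at (coord c p))"
  shows "divergence A (volume_form g) Y p = coord_div (gdet c) (\<lambda>x. Y c (chart_inv c x)) (coord c p)"
proof -
  let ?d = "chart_at A p"
  note d = chart_at[of p]
  let ?x = "coord ?d p" and ?Y = "\<lambda>x. Y ?d (chart_inv ?d x)"
  have pd: "chart_inv ?d ?x = p" "?x \<in> coord ?d ` chart_dom ?d" using chart_inv_coord[OF d] d by auto
  have pos: "gdet ?d ?x > 0" using gdet_pos[OF d(1)] d(2) by auto
  have dG: "(gdet ?d has_derivative frechet_derivative (gdet ?d) (at ?x)) (at ?x)"
    using Cn_on_has_derivative[OF Cn_on_gdet[OF d(1), of "Suc 0"], of ?x] d(2) by auto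
  have linY: "linear (frechet_derivative ?Y (at ?x))" using diff[OF d] by (rule linear_frechet_derivative)
  have vol: "volume_form g ?d p V = sqrt (gdet ?d ?x) * det V" for V
    using pd by (simp add: volume_form_eq gdet_def)
  have lie: "lie_derivative Y (volume_form g) ?d p V = coord_div (gdet ?d) ?Y ?x * volume_form g ?d p V" for V
  proof -
    from has_derivative_mult_left[OF has_derivative_sqrt[OF dG pos], of "det V"]
    have "((\<lambda>x. volume_form g ?d (chart_inv ?d x) V) has_derivative
      (\<lambda>h. inverse (sqrt (gdet ?d ?x)) / 2 * frechet_derivative (gdet ?d) (at ?x) h * det V)) (at ?x)"
      by (simp add: volume_form_eq gdet_def)
    from frechet_derivative_at[OF this, symmetric]
    have "lie_derivative Y (volume_form g) ?d p V = inverse (sqrt (gdet ?d ?x)) / 2 * frechet_derivative (gdet ?d) (at ?x) (Y ?d p) * det V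
      + sqrt (gdet ?d ?x) * (\<Sum>j\<in>UNIV. det (\<chi> i. if i = j then frechet_derivative ?Y (at ?x) (V $ j) else V $ i))"
      by (simp add: lie_derivative_def vol sum_distrib_left)
    also have "\<dots> = inverse (sqrt (gdet ?d ?x)) / 2 * frechet_derivative (gdet ?d) (at ?x) (Y ?d p) * det V
      + sqrt (gdet ?d ?x) * (tr (frechet_derivative ?Y (at ?x)) * det V)"
      by (simp only: sum_det_replace_row_linear[OF linY])
    also have "\<dots> = coord_div (gdet ?d) ?Y ?x * (sqrt (gdet ?d ?x) * det V)"
    proof -
      have aux: "inverse r / 2 * a * e + r * (t * e) = (a / (2 * (r * r)) + t) * (r * e)" if "r > 0" for r a e t :: real
        using that by (simp add: field_simps)
      show ?thesis
        using aux[of "sqrt (gdet ?d ?x)"] pos unfolding coord_div_def pd(1) by simp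
    qed
    finally show ?thesis by (simp add: vol)
  qed
  have "divergence A (volume_form g) Y p = coord_div (gdet ?d) ?Y ?x"
    unfolding divergence_def Let_def
  proof (rule the_equality)
    show "\<forall>V. lie_derivative Y (volume_form g) ?d p V = coord_div (gdet ?d) ?Y ?x * volume_form g ?d p V" using lie by blast
  next
    fix a assume "\<forall>V. lie_derivative Y (volume_form g) ?d p V = a * volume_form g ?d p V"
    then have "coord_div (gdet ?d) ?Y ?x * volume_form g ?d p (mat 1) = a * volume_form g ?d p (mat 1)" using lie by metis
    then show "a = coord_div (gdet ?d) ?Y ?x" using pos by (simp add: vol)
  qed
  also have "\<dots> = coord_div (gdet c) (\<lambda>x. Y c (chart_inv c x)) (coord c p)"
    by (rule coord_div_change_chart) (use c d Y diff in auto)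
  finally show ?thesis .
qed

end

section \<open>Riemannian volume of submanifolds\<close>

lemma borel_vimage_continuous_on:
  assumes "continuous_on W f" "W \<in> sets borel" "E \<in> sets borel"
  shows "W \<inter> f -` E \<in> sets borel"
proof -
  have "f -` E \<inter> space (restrict_space borel W) \<in> sets (restrict_space borel W)"
    by (rule measurable_sets[OF borel_measurable_continuous_on_restrict[OF assms(1)] assms(3)])
  then show ?thesis using assms(2) by (simp add: sets_restrict_space_iff space_restrict_space Int_commute)
qed

lemma measurable_indicator_times:
  fixes q :: "'a::topological_space \<Rightarrow> real"
  assumes "X \<in> sets borel" "X \<subseteq> W" "continuous_on W q"
  shows "(\<lambda>u. indicator X u * q u) \<in> borel_measurable borel"
  using borel_measurable_continuous_on_indicator[OF assms(1) continuous_on_subset[OF assms(3,2)]] by simp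

lemma suminf_disjoint_indicator:
  fixes c :: ennreal
  assumes "disjoint_family X"
  shows "(\<Sum>i. c * indicator (X i) u) = c * indicator (\<Union>i. X i) u"
  by (simp only: ennreal_suminf_cmult suminf_indicator[OF assms])

lemma in_sets_restrict_borel:
  assumes "E' \<in> sets borel" "E = E' \<inter> S"
  shows "E \<in> sets (restrict_space borel S)"
  unfolding sets_restrict_space by (rule image_eqI[OF _ assms(1)]) (simp add: assms(2) Int_commute)

context riemannian
begin

context
  fixes S :: "'a set" and W :: "(real^'k::finite) set" and \<sigma> :: "real^'k \<Rightarrow> 'a"
  assumes \<sigma>: "local_parametrization A S W \<sigma>"
begin

lemma param_open: "open W"
  and param_image: "openin (top_of_set S) (\<sigma> ` W)"
  and param_subset: "\<sigma> ` W \<subseteq> S"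
  and param_continuous: "continuous_on W \<sigma>"
proof -
  show "open W" and im: "openin (top_of_set S) (\<sigma> ` W)" using \<sigma> by (simp_all add: local_parametrization_def)
  show "\<sigma> ` W \<subseteq> S" using openin_imp_subset[OF im] .
  show "continuous_on W \<sigma>" using \<sigma> by (auto simp: local_parametrization_def homeomorphism_def)
qed

lemma param_inj: "inj_on \<sigma> W"
proof -
  obtain \<tau> where "homeomorphism W (\<sigma> ` W) \<sigma> \<tau>" using \<sigma> by (auto simp: local_parametrization_def)
  then show ?thesis by (intro inj_onI) (metis homeomorphism_apply1)
qed

lemma param_open_vimage: "open V \<Longrightarrow> open (W \<inter> \<sigma> -` V)"
  by (rule continuous_open_preimage[OF param_continuous param_open])

lemma param_C1: "c \<in> A \<Longrightarrow> Cn_on (Suc 0) (W \<inter> \<sigma> -` chart_dom c) (\<lambda>u. coord c (\<sigma> u))"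
proof -
  assume "c \<in> A"
  then have "Ck_on 1 (W \<inter> \<sigma> -` chart_dom c) (coord c \<circ> \<sigma>)" using \<sigma> unfolding local_parametrization_def by blast
  then have "enat 1 \<le> 1 \<longrightarrow> Cn_on 1 (W \<inter> \<sigma> -` chart_dom c) (coord c \<circ> \<sigma>)" unfolding Ck_on_def by blast
  then show ?thesis by (simp only: o_def One_nat_def one_enat_def)
qed

lemma param_has_derivative:
  assumes "c \<in> A" "u \<in> W" "\<sigma> u \<in> chart_dom c"
  shows "((\<lambda>u. coord c (\<sigma> u)) has_derivative frechet_derivative (\<lambda>u. coord c (\<sigma> u)) (at u)) (at u)"
  using Cn_on_has_derivative[OF param_C1[OF assms(1)], of u] assms by simp

lemma param_derivative_inj:
  assumes "c \<in> A" "u \<in> W" "\<sigma> u \<in> chart_dom c"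
  shows "inj (frechet_derivative (\<lambda>u. coord c (\<sigma> u)) (at u))"
proof -
  have "u \<in> W \<inter> \<sigma> -` chart_dom c" using assms by simp
  then have "inj (frechet_derivative (coord c \<circ> \<sigma>) (at u))" using \<sigma> assms(1) unfolding local_parametrization_def by blast
  then show ?thesis by (simp add: o_def)
qed

lemma volume_density_chart:
  assumes c: "c \<in> A" "u \<in> W" "\<sigma> u \<in> chart_dom c"
  defines "D \<equiv> frechet_derivative (\<lambda>u. coord c (\<sigma> u)) (at u)"
  shows "volume_density A g \<sigma> u = sqrt (det (gram (\<lambda>v w. g c (\<sigma> u) (D v) (D w))))"
    and "inner_form (\<lambda>v w. g c (\<sigma> u) (D v) (D w))"
proof -
  let ?d = "chart_at A (\<sigma> u)"
  note d = chart_at[of "\<sigma> u"]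
  have D: "((\<lambda>u. coord c (\<sigma> u)) has_derivative D) (at u)" unfolding D_def by (rule param_has_derivative[OF c])
  show "inner_form (\<lambda>v w. g c (\<sigma> u) (D v) (D w))"
    by (rule inner_form_pullback[OF metric_inner[OF c(1,3)] has_derivative_linear[OF D]])
      (unfold D_def, rule param_derivative_inj[OF c])
  have "((\<lambda>u. coord ?d (chart_inv c (coord c (\<sigma> u)))) has_derivative (\<lambda>h. trans_deriv c ?d (\<sigma> u) (D h))) (at u)"
    by (rule has_derivative_compose[OF D transition_has_derivative]) (use c d in auto)
  then have "((\<lambda>u. coord ?d (\<sigma> u)) has_derivative (\<lambda>h. trans_deriv c ?d (\<sigma> u) (D h))) (at u)"
    by (rule has_derivative_transform_within_open[OF _ param_open_vimage[OF open_chart_dom[OF c(1)]]])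
      (use c chart_inv_coord[OF c(1)] in auto)
  from frechet_derivative_at[OF this, symmetric]
  have "volume_density A g \<sigma> u = sqrt (det (gram (\<lambda>v w. g ?d (\<sigma> u) (trans_deriv c ?d (\<sigma> u) (D v)) (trans_deriv c ?d (\<sigma> u) (D w)))))"
    by (simp add: volume_density_def Let_def gram_def o_def)
  then show "volume_density A g \<sigma> u = sqrt (det (gram (\<lambda>v w. g c (\<sigma> u) (D v) (D w))))"
    unfolding metric_trans[OF c(1) d(1) c(3) d(2)] .
qed

lemma volume_density_nonneg: "u \<in> W \<Longrightarrow> volume_density A g \<sigma> u \<ge> 0"
  using volume_density_chart(1)[OF chart_at(1) _ chart_at(2)]
    det_gram_pos[OF volume_density_chart(2)[OF chart_at(1) _ chart_at(2)]] by (simp add: less_imp_le)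

lemma continuous_volume_density: "continuous_on W (volume_density A g \<sigma>)"
proof (rule continuous_at_imp_continuous_on, rule ballI)
  fix u assume u: "u \<in> W"
  define c where "c = chart_at A (\<sigma> u)"
  have c: "c \<in> A" "\<sigma> u \<in> chart_dom c" using chart_at by (auto simp: c_def)
  let ?O = "W \<inter> \<sigma> -` chart_dom c"
  have O: "open ?O" "u \<in> ?O" using param_open_vimage[OF open_chart_dom[OF c(1)]] u c by auto
  let ?D = "\<lambda>u. frechet_derivative (\<lambda>u. coord c (\<sigma> u)) (at u)"
  have cD: "continuous_on ?O (\<lambda>u. ?D u v)" for v
    using Cn_on_continuous_on[OF Cn_on_frechet[OF param_C1[OF c(1)]]] .
  have cc: "continuous_on ?O (\<lambda>u. coord c (\<sigma> u))" using Cn_on_continuous_on[OF param_C1[OF c(1)]] .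
  have cg: "continuous_on ?O (\<lambda>u. gram (g c (\<sigma> u)) $ i $ j)" for i j
  proof -
    have "continuous_on ?O (\<lambda>u. g c (chart_inv c (coord c (\<sigma> u))) (axis i 1) (axis j 1))"
      by (rule continuous_on_compose2[OF Cn_on_continuous_on[OF Cn_on_metric[OF c(1)]] cc]) auto
    then show ?thesis
      by (rule continuous_on_eq) (simp add: gram_def chart_inv_coord[OF c(1)])
  qed
  have cp: "continuous_on ?O (\<lambda>u. g c (\<sigma> u) (?D u v) (?D u w))" for v w
  proof -
    have "continuous_on ?O (\<lambda>u. \<Sum>i\<in>UNIV. ?D u v $ i * (\<Sum>j\<in>UNIV. gram (g c (\<sigma> u)) $ i $ j * ?D u w $ j))"
      by (intro continuous_intros cg continuous_on_component cD)
    then show ?thesis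
    proof (rule continuous_on_eq)
      fix u assume "u \<in> ?O"
      then have "bilinear (g c (\<sigma> u))" using metric_inner[OF c(1)] by (auto simp: inner_form_def)
      then show "(\<Sum>i\<in>UNIV. ?D u v $ i * (\<Sum>j\<in>UNIV. gram (g c (\<sigma> u)) $ i $ j * ?D u w $ j)) = g c (\<sigma> u) (?D u v) (?D u w)"
        by (simp add: gram_mult inner_vec_def matrix_vector_mult_def)
    qed
  qed
  have "continuous_on ?O (\<lambda>u. sqrt (det (gram (\<lambda>v w. g c (\<sigma> u) (?D u v) (?D u w)))))"
    unfolding det_def gram_def by (simp, intro continuous_intros cp)
  then have "continuous_on ?O (volume_density A g \<sigma>)"
    by (rule continuous_on_eq) (use volume_density_chart(1)[OF c(1)] in auto)
  then show "continuous (at u) (volume_density A g \<sigma>)" using O by (simp add: continuous_on_eq_continuous_at)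
qed

lemma measurable_density:
  assumes "E \<in> sets borel"
  shows "W \<inter> \<sigma> -` E \<in> sets borel"
    "(\<lambda>u. indicator (W \<inter> \<sigma> -` E) u * volume_density A g \<sigma> u) \<in> borel_measurable borel"
    "(\<lambda>u. ennreal (volume_density A g \<sigma> u) * indicator (W \<inter> \<sigma> -` E) u) \<in> borel_measurable lborel"
proof -
  show *: "W \<inter> \<sigma> -` E \<in> sets borel"
    by (rule borel_vimage_continuous_on[OF param_continuous _ assms]) (simp add: param_open)
  show 1: "(\<lambda>u. indicator (W \<inter> \<sigma> -` E) u * volume_density A g \<sigma> u) \<in> borel_measurable borel"
    by (rule measurable_indicator_times[OF * _ continuous_volume_density]) auto
  have "(\<lambda>u. ennreal (volume_density A g \<sigma> u) * indicator (W \<inter> \<sigma> -` E) u) =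
      (\<lambda>u. ennreal (indicator (W \<inter> \<sigma> -` E) u * volume_density A g \<sigma> u))"
    by (auto simp: indicator_def)
  then show "(\<lambda>u. ennreal (volume_density A g \<sigma> u) * indicator (W \<inter> \<sigma> -` E) u) \<in> borel_measurable lborel"
    using 1 by simp
qed

end

text \<open>
  Composing the second parametrization with a linear left inverse of its derivative gives a local
  diffeomorphism of the parameter space, by means of which the change of parameters is seen to be
  differentiable.
\<close>

lemma param_transition:
  fixes \<sigma>1 \<sigma>2 :: "real^'k::finite \<Rightarrow> 'a"
  assumes 1: "local_parametrization A S W1 \<sigma>1" and 2: "local_parametrization A S W2 \<sigma>2"
    and u: "u \<in> W1" "\<sigma>1 u \<in> \<sigma>2 ` W2"
  defines "\<theta> \<equiv> \<lambda>u. inv_into W2 \<sigma>2 (\<sigma>1 u)"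
  shows "\<exists>T. (\<theta> has_derivative T) (at u) \<and> volume_density A g \<sigma>1 u = \<bar>det (matrix T)\<bar> * volume_density A g \<sigma>2 (\<theta> u)"
proof -
  define p where "p = \<sigma>1 u"
  define c where "c = chart_at A p"
  have c: "c \<in> A" "\<sigma>1 u \<in> chart_dom c" using chart_at[of p] by (auto simp: c_def p_def)
  obtain V where V: "open V" "\<sigma>2 ` W2 = S \<inter> V" using param_image[OF 2] by (auto simp: openin_open)
  let ?O = "W1 \<inter> \<sigma>1 -` (V \<inter> chart_dom c)"
  have O: "open ?O" "u \<in> ?O"
    using param_open_vimage[OF 1 open_Int[OF V(1) open_chart_dom[OF c(1)]]] u c V(2) by auto
  have inO: "\<sigma>1 x \<in> \<sigma>2 ` W2" if "x \<in> ?O" for x using that V(2) param_subset[OF 1] by auto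
  have \<theta>: "\<theta> x \<in> W2" "\<sigma>2 (\<theta> x) = \<sigma>1 x" if "x \<in> ?O" for x
    using inv_into_into[OF inO[OF that]] f_inv_into_f[OF inO[OF that]] by (simp_all add: \<theta>_def)
  obtain \<tau> where \<tau>: "homeomorphism W2 (\<sigma>2 ` W2) \<sigma>2 \<tau>" using 2 by (auto simp: local_parametrization_def)
  have c\<theta>: "continuous_on ?O \<theta>"
  proof -
    have "continuous_on ?O (\<lambda>x. \<tau> (\<sigma>1 x))"
      by (rule continuous_on_compose2[of "\<sigma>2 ` W2"])
        (use \<tau> inO continuous_on_subset[OF param_continuous[OF 1], of ?O] in \<open>auto simp: homeomorphism_def\<close>)
    then show ?thesis
      by (rule continuous_on_eq) (metis \<theta> \<tau> homeomorphism_apply1)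
  qed
  let ?f1 = "\<lambda>x. coord c (\<sigma>1 x)" and ?f2 = "\<lambda>x. coord c (\<sigma>2 x)"
  define D1 where "D1 = frechet_derivative ?f1 (at u)"
  define D2 where "D2 = frechet_derivative ?f2 (at (\<theta> u))"
  have c2: "\<sigma>2 (\<theta> u) \<in> chart_dom c" "\<theta> u \<in> W2" using \<theta>[OF O(2)] c by auto
  have d1: "(?f1 has_derivative D1) (at u)" unfolding D1_def by (rule param_has_derivative[OF 1 c(1) u(1) c(2)])
  have d2: "(?f2 has_derivative D2) (at (\<theta> u))" unfolding D2_def by (rule param_has_derivative[OF 2 c(1) c2(2,1)])
  have lin2: "linear D2" "inj D2"
    using d2 has_derivative_linear param_derivative_inj[OF 2 c(1) c2(2,1)] by (auto simp: D2_def)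
  obtain P where P: "linear P" "P \<circ> D2 = id" using linear_injective_left_inverse[OF lin2] by blast
  have blP: "bounded_linear P" using P(1) by (simp add: linear_conv_bounded_linear)
  let ?O2 = "W2 \<inter> \<sigma>2 -` chart_dom c"
  have O2: "open ?O2" "\<theta> u \<in> ?O2" using param_open_vimage[OF 2 open_chart_dom[OF c(1)]] c2 by auto
  let ?q = "\<lambda>x. P (?f2 x)"
  have q: "Cn_on (Suc 0) ?O2 ?q" by (rule Cn_on_compose_linear[OF O2(1) blP param_C1[OF 2 c(1)]])
  have "(?q has_derivative (\<lambda>h. P (D2 h))) (at (\<theta> u))" by (rule bounded_linear.has_derivative[OF blP d2])
  from frechet_derivative_at[OF this, symmetric] P(2)
  have "inj (frechet_derivative ?q (at (\<theta> u)))" by (simp add: fun_eq_iff inj_def)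
  from Cn_inverse_function[OF O2(1) q O2(2) this]
  obtain U' V' G where G: "open U'" "\<theta> u \<in> U'" "open V'" "homeomorphism U' V' ?q G" "Cn_on (Suc 0) V' G" by metis
  have qV: "?q (\<theta> u) \<in> V'" "G (?q x) = x" if "x \<in> U'" for x using G(2,4) that by (auto simp: homeomorphism_def)
  have "?q (\<theta> u) \<in> V'" using qV(1)[OF G(2)] .
  then have dG: "(G has_derivative frechet_derivative G (at (?q (\<theta> u)))) (at (?q (\<theta> u)))"
    by (rule Cn_on_has_derivative[OF G(5)])
  have e: "P (?f1 u) = ?q (\<theta> u)" using \<theta>[OF O(2)] by simp
  define T where "T h = frechet_derivative G (at (?q (\<theta> u))) (P (D1 h))" for h
  have "((\<lambda>x. G (P (?f1 x))) has_derivative T) (at u)"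
    unfolding T_def
    by (rule has_derivative_compose[OF bounded_linear.has_derivative[OF blP d1]]) (use dG e in simp)
  moreover have O': "open (?O \<inter> \<theta> -` U')" by (rule continuous_open_preimage[OF c\<theta> O(1) G(1)])
  ultimately have dT: "(\<theta> has_derivative T) (at u)"
  proof (rule has_derivative_transform_within_open)
    show "u \<in> ?O \<inter> \<theta> -` U'" using O(2) G(2) by simp
    show "G (P (?f1 x)) = \<theta> x" if "x \<in> ?O \<inter> \<theta> -` U'" for x
      using qV(2)[of "\<theta> x"] \<theta>(2)[of x] that by simp
  qed
  have "(?f1 has_derivative (\<lambda>h. D2 (T h))) (at u)"
    by (rule has_derivative_transform_within_open[OF has_derivative_compose[OF dT d2] O]) (simp add: \<theta>)
  from has_derivative_unique[OF this d1] have D12: "D1 = (\<lambda>h. D2 (T h))" by simp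
  have linT: "linear T" using dT has_derivative_linear by blast
  have "volume_density A g \<sigma>1 u = sqrt (det (gram (\<lambda>v w. g c (\<sigma>1 u) (D2 (T v)) (D2 (T w)))))"
    using volume_density_chart(1)[OF 1 c(1) u(1) c(2)] D12 by (simp add: D1_def)
  also have "\<dots> = sqrt ((det (matrix T))\<^sup>2 * det (gram (\<lambda>v w. g c (\<sigma>1 u) (D2 v) (D2 w))))"
  proof -
    have "bilinear (\<lambda>v w. g c (\<sigma>1 u) (D2 v) (D2 w))"
      by (rule bilinear_pullback[OF _ lin2(1)]) (use metric_inner[OF c] in \<open>simp add: inner_form_def\<close>)
    from det_gram_pullback[OF this linT] show ?thesis by simp
  qed
  also have "\<dots> = \<bar>det (matrix T)\<bar> * volume_density A g \<sigma>2 (\<theta> u)"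
    using volume_density_chart(1)[OF 2 c(1) c2(2,1)] \<theta>(2)[OF O(2)] by (simp add: D2_def real_sqrt_mult)
  finally show ?thesis using dT by blast
qed

text \<open>
  The densities of two parametrizations differ by the Jacobian of the change of parameters, so both
  assign the same measure to a set in the intersection of their images.
\<close>

lemma param_consistent:
  fixes \<sigma>1 \<sigma>2 :: "real^'k::finite \<Rightarrow> 'a"
  assumes 1: "local_parametrization A S W1 \<sigma>1" and 2: "local_parametrization A S W2 \<sigma>2" and E: "E \<in> sets borel"
  shows "(\<integral>\<^sup>+u\<in>W1 \<inter> \<sigma>1 -` (E \<inter> \<sigma>2 ` W2). ennreal (volume_density A g \<sigma>1 u) \<partial>lborel) =
    (\<integral>\<^sup>+u\<in>W2 \<inter> \<sigma>2 -` (E \<inter> \<sigma>1 ` W1). ennreal (volume_density A g \<sigma>2 u) \<partial>lborel)"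
proof -
  define \<theta> where "\<theta> = (\<lambda>u. inv_into W2 \<sigma>2 (\<sigma>1 u))"
  obtain V1 where V1: "open V1" "\<sigma>1 ` W1 = S \<inter> V1" using param_image[OF 1] by (auto simp: openin_open)
  obtain V2 where V2: "open V2" "\<sigma>2 ` W2 = S \<inter> V2" using param_image[OF 2] by (auto simp: openin_open)
  let ?X1 = "W1 \<inter> \<sigma>1 -` (E \<inter> V2)" and ?X2 = "W2 \<inter> \<sigma>2 -` (E \<inter> V1)"
  have X: "W1 \<inter> \<sigma>1 -` (E \<inter> \<sigma>2 ` W2) = ?X1" "W2 \<inter> \<sigma>2 -` (E \<inter> \<sigma>1 ` W1) = ?X2"
    using param_subset[OF 1] param_subset[OF 2] V1(2) V2(2) by blast+
  have bor: "E \<inter> V2 \<in> sets borel" "E \<inter> V1 \<in> sets borel" using E V1(1) V2(1) by auto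
  have in2: "\<sigma>1 u \<in> \<sigma>2 ` W2" if "u \<in> ?X1" for u using that V2(2) param_subset[OF 1] by auto
  have \<theta>: "\<theta> u \<in> W2" "\<sigma>2 (\<theta> u) = \<sigma>1 u" if "u \<in> ?X1" for u
    using inv_into_into[OF in2[OF that]] f_inv_into_f[OF in2[OF that]] by (simp_all add: \<theta>_def)
  have img: "\<theta> ` ?X1 = ?X2"
  proof (intro equalityI subsetI)
    fix t assume "t \<in> \<theta> ` ?X1"
    then obtain u where u: "u \<in> ?X1" "t = \<theta> u" by blast
    have "\<sigma>1 u \<in> V1" using V1(2) u(1) by auto
    then show "t \<in> ?X2" using \<theta>[OF u(1)] u by auto
  next
    fix t assume t: "t \<in> ?X2"
    then have "\<sigma>2 t \<in> \<sigma>1 ` W1" using V1(2) param_subset[OF 2] by auto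
    then obtain u where u: "u \<in> W1" "\<sigma>1 u = \<sigma>2 t" by auto
    have "u \<in> ?X1" using u t V2(2) by auto
    moreover have "\<theta> u = t" using u(2) t inv_into_f_f[OF param_inj[OF 2]] by (simp add: \<theta>_def)
    ultimately show "t \<in> \<theta> ` ?X1" by blast
  qed
  have inj: "inj_on \<theta> ?X1"
  proof (rule inj_onI)
    fix x y assume xy: "x \<in> ?X1" "y \<in> ?X1" "\<theta> x = \<theta> y"
    then have "\<sigma>1 x = \<sigma>1 y" using \<theta>(2) by metis
    then show "x = y" using inj_onD[OF param_inj[OF 1]] xy by blast
  qed
  have "\<forall>u. \<exists>T. u \<in> ?X1 \<longrightarrow> (\<theta> has_derivative T) (at u) \<and>
      volume_density A g \<sigma>1 u = \<bar>det (matrix T)\<bar> * volume_density A g \<sigma>2 (\<theta> u)"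
    using param_transition[OF 1 2] in2 unfolding \<theta>_def by blast
  then obtain T where T: "\<And>u. u \<in> ?X1 \<Longrightarrow> (\<theta> has_derivative T u) (at u)"
      "\<And>u. u \<in> ?X1 \<Longrightarrow> volume_density A g \<sigma>1 u = \<bar>det (matrix (T u))\<bar> * volume_density A g \<sigma>2 (\<theta> u)"
    by metis
  let ?p = "\<lambda>u. indicator ?X1 u * volume_density A g \<sigma>1 u" and ?q = "\<lambda>u. indicator ?X2 u * volume_density A g \<sigma>2 u"
  have "(\<integral>\<^sup>+u. ennreal (indicator ?X1 u * ?p u) \<partial>lborel) = (\<integral>\<^sup>+u. ennreal (indicator (\<theta> ` ?X1) u * ?q u) \<partial>lborel)"
  proof (rule nn_integral_change_of_variables[OF _ _ inj T(1)])
    show "?X1 \<in> sets borel" "\<theta> ` ?X1 \<in> sets borel"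
      unfolding img using measurable_density(1)[OF 1 bor(1)] measurable_density(1)[OF 2 bor(2)] by auto
    have "(\<lambda>u. indicator ?X1 u * ?p u) = ?p" "(\<lambda>u. indicator ?X2 u * ?q u) = ?q" by (auto simp: indicator_def)
    then show "(\<lambda>u. indicator (\<theta> ` ?X1) u * ?q u) \<in> borel_measurable borel" "(\<lambda>u. indicator ?X1 u * ?p u) \<in> borel_measurable borel"
      unfolding img using measurable_density(2)[OF 1 bor(1)] measurable_density(2)[OF 2 bor(2)] by auto
    show "0 \<le> ?p u" "0 \<le> ?q u" for u
      using volume_density_nonneg[OF 1] volume_density_nonneg[OF 2] by (auto simp: indicator_def)
    fix u assume u: "u \<in> ?X1"
    then have "\<theta> u \<in> ?X2" using img by blast
    then show "?p u = \<bar>det (matrix (T u))\<bar> * ?q (\<theta> u)" using T(2)[OF u] u by simp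
  qed auto
  moreover have "ennreal (indicator X u * (indicator X u * q u)) = ennreal (q u) * indicator X u" for X u and q :: "real^'k \<Rightarrow> real"
    by (auto simp: indicator_def)
  ultimately show ?thesis unfolding X img by simp
qed

text \<open>
  The property that singles out the Riemannian volume of \<open>S\<close>; by \<open>is_volume_ex1\<close> exactly one
  measure has it.
\<close>

definition is_volume :: "'k::finite itself \<Rightarrow> 'a set \<Rightarrow> 'a measure \<Rightarrow> bool" where
  "is_volume K S \<eta> \<longleftrightarrow> sets \<eta> = sets (restrict_space borel S) \<and>
     (\<forall>W (\<sigma> :: real ^ 'k \<Rightarrow> 'a). local_parametrization A S W \<sigma> \<longrightarrow>
       (\<forall>E\<in>sets borel. emeasure \<eta> (E \<inter> \<sigma> ` W) =
          (\<integral>\<^sup>+u\<in>W \<inter> \<sigma> -` E. ennreal (volume_density A g \<sigma> u) \<partial>lborel)))"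

text \<open>
  The measure is glued from countably many parametrizations, restricted to disjoint Borel sets
  that cover \<open>S\<close>.
\<close>

lemma is_volume_ex1:
  assumes ex: "\<And>p. p \<in> S \<Longrightarrow> \<exists>W (\<sigma> :: real ^ 'k::finite \<Rightarrow> 'a). local_parametrization A S W \<sigma> \<and> p \<in> \<sigma> ` W"
  shows "\<exists>!\<eta>. is_volume TYPE('k) S \<eta>"
proof -
  define F where "F = {B. \<exists>W (\<sigma> :: real^'k \<Rightarrow> 'a). local_parametrization A S W \<sigma> \<and> B = \<sigma> ` W}"
  have "openin (top_of_set S) B" if "B \<in> F" for B using that param_image by (auto simp: F_def)
  from Lindelof_openin[OF this] obtain F' where F': "F' \<subseteq> F" "countable F'" "\<Union>F' = \<Union>F" by metis
  \<comment> \<open>The empty parametrization is added so that the countable family can be enumerated by the natural numbers even if it is empty.\<close>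
  have "local_parametrization A S {} (undefined :: real^'k \<Rightarrow> 'a)"
    unfolding local_parametrization_def by (auto simp: Ck_on_def homeomorphism_def intro: Cn_on_local)
  then have "{} \<in> F" by (auto simp: F_def)
  then have F0: "insert {} F' \<subseteq> F" "countable (insert {} F')" using F' by auto
  let ?B = "from_nat_into (insert {} F')"
  have "?B i \<in> F" for i using from_nat_into[of "insert {} F'" i] F0(1) by blast
  then have "\<forall>i. \<exists>W. \<exists>\<sigma> :: real^'k \<Rightarrow> 'a. local_parametrization A S W \<sigma> \<and> ?B i = \<sigma> ` W" unfolding F_def by blast
  then obtain W and \<sigma> :: "nat \<Rightarrow> real^'k \<Rightarrow> 'a" where \<sigma>: "\<And>i. local_parametrization A S (W i) (\<sigma> i)" "\<And>i. ?B i = \<sigma> i ` W i"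
    by metis
  have cov: "S \<subseteq> (\<Union>i. \<sigma> i ` W i)"
  proof
    fix p assume "p \<in> S"
    then obtain W' and \<sigma>' :: "real^'k \<Rightarrow> 'a" where "local_parametrization A S W' \<sigma>'" "p \<in> \<sigma>' ` W'" using ex by blast
    then have "p \<in> \<Union>F" unfolding F_def by blast
    then have "p \<in> \<Union>(insert {} F')" using F' by simp
    then show "p \<in> (\<Union>i. \<sigma> i ` W i)"
      using range_from_nat_into[of "insert {} F'"] F0(2) \<sigma>(2) by auto
  qed
  have "\<forall>i. \<exists>V. open V \<and> \<sigma> i ` W i = S \<inter> V" using param_image[OF \<sigma>(1)] by (auto simp: openin_open)
  then obtain V where V: "\<And>i. open (V i)" "\<And>i. \<sigma> i ` W i = S \<inter> V i" by metis
  define B where "B = disjointed V"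
  have B: "B i \<in> sets borel" for i
  proof -
    have "range V \<subseteq> sets borel" using V(1) by auto
    from sets.range_disjointed_sets[OF this] show ?thesis by (auto simp: B_def)
  qed
  have disj: "disjoint_family B" unfolding B_def by (rule disjoint_family_disjointed)
  have SB: "S \<subseteq> (\<Union>i. B i)" using cov V(2) by (auto simp: B_def UN_disjointed_eq)
  have B\<sigma>: "S \<inter> B i \<subseteq> \<sigma> i ` W i" for i using V(2) disjointed_subset[of V i] by (auto simp: B_def)
  have \<sigma>S: "\<sigma> i ` W i \<subseteq> S" for i by (rule param_subset[OF \<sigma>(1)])
  let ?vd = "\<lambda>i u. ennreal (volume_density A g (\<sigma> i) u)"
  let ?m = "\<lambda>i E. \<integral>\<^sup>+u\<in>W i \<inter> \<sigma> i -` (E \<inter> B i). ?vd i u \<partial>lborel"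
  define \<eta> where "\<eta> = measure_of S (sets (restrict_space borel S)) (\<lambda>E. \<Sum>i. ?m i E)"
  have setsD: "\<exists>E'\<in>sets borel. E = E' \<inter> S" if "E \<in> sets (restrict_space borel S)" for E
    using that by (auto simp: sets_restrict_space)
  have sub: "sets (restrict_space borel S) \<subseteq> Pow S" using sets.space_closed[of "restrict_space borel S"] by (simp add: space_restrict_space)
  have sets\<eta>: "sets \<eta> = sets (restrict_space borel S)"
    unfolding \<eta>_def using sub sets.sigma_sets_eq[of "restrict_space borel S"] by (simp add: space_restrict_space)
  have vE: "W i \<inter> \<sigma> i -` (E \<inter> S \<inter> C) = W i \<inter> \<sigma> i -` (E \<inter> C)" for i E C using \<sigma>S[of i] by auto
  have meas: "(\<lambda>u. ?vd i u * indicator (W i \<inter> \<sigma> i -` (E \<inter> B i)) u) \<in> borel_measurable lborel"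
    if E: "E \<in> sets (restrict_space borel S)" for i E
  proof -
    obtain E' where "E' \<in> sets borel" "E = E' \<inter> S" using setsD[OF E] by blast
    then show ?thesis using measurable_density(3)[OF \<sigma>(1), of "E' \<inter> B i" i] B by (simp only: vE sets.Int)
  qed
  have add: "countably_additive (sets (restrict_space borel S)) (\<lambda>E. \<Sum>i. ?m i E)"
  proof (rule countably_additiveI)
    fix E :: "nat \<Rightarrow> 'a set" assume E: "range E \<subseteq> sets (restrict_space borel S)" "disjoint_family E"
    have m: "(\<Sum>n. ?m i (E n)) = ?m i (\<Union>n. E n)" for i
    proof -
      have "(\<Sum>n. ?m i (E n)) = (\<integral>\<^sup>+u. (\<Sum>n. ?vd i u * indicator (W i \<inter> \<sigma> i -` (E n \<inter> B i)) u) \<partial>lborel)"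
        by (rule nn_integral_suminf[symmetric]) (use E meas in auto)
      also have "\<dots> = (\<integral>\<^sup>+u. ?vd i u * indicator (\<Union>n. W i \<inter> \<sigma> i -` (E n \<inter> B i)) u \<partial>lborel)"
      proof -
        have "disjoint_family (\<lambda>n. W i \<inter> \<sigma> i -` (E n \<inter> B i))" using E(2) unfolding disjoint_family_on_def by blast
        then show ?thesis by (simp only: suminf_disjoint_indicator)
      qed
      also have "(\<Union>n. W i \<inter> \<sigma> i -` (E n \<inter> B i)) = W i \<inter> \<sigma> i -` ((\<Union>n. E n) \<inter> B i)" by auto
      finally show ?thesis .
    qed
    have "(\<Sum>n. \<Sum>i. ?m i (E n)) = (\<integral>\<^sup>+n. (\<Sum>i. ?m i (E n)) \<partial>count_space UNIV)" by (simp add: nn_integral_count_space_nat)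
    also have "\<dots> = (\<Sum>i. \<integral>\<^sup>+n. ?m i (E n) \<partial>count_space UNIV)" by (rule nn_integral_suminf) simp
    also have "\<dots> = (\<Sum>i. \<Sum>n. ?m i (E n))" by (simp add: nn_integral_count_space_nat)
    finally show "(\<Sum>n. \<Sum>i. ?m i (E n)) = (\<Sum>i. ?m i (\<Union>n. E n))" by (simp only: m)
  qed
  have em: "emeasure \<eta> E = (\<Sum>i. ?m i E)" if "E \<in> sets (restrict_space borel S)" for E
    by (rule emeasure_measure_of[OF \<eta>_def sub _ add[folded sets\<eta>]])
      (use that sets\<eta> in \<open>auto simp: positive_def\<close>)
  have vol: "is_volume TYPE('k) S \<eta>"
    unfolding is_volume_def
  proof (intro conjI allI impI ballI sets\<eta>)
    fix W' and \<sigma>' :: "real^'k \<Rightarrow> 'a" and E :: "'a set"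
    assume \<sigma>': "local_parametrization A S W' \<sigma>'" and E: "E \<in> sets borel"
    let ?vd' = "\<lambda>u. ennreal (volume_density A g \<sigma>' u)"
    obtain V' where V': "open V'" "\<sigma>' ` W' = S \<inter> V'" using param_image[OF \<sigma>'] by (auto simp: openin_open)
    have "E \<inter> \<sigma>' ` W' = (E \<inter> V') \<inter> S" unfolding V'(2) by blast
    then have "E \<inter> \<sigma>' ` W' \<in> sets (restrict_space borel S)" by (rule in_sets_restrict_borel[rotated]) (use E V'(1) in auto)
    then have "emeasure \<eta> (E \<inter> \<sigma>' ` W') = (\<Sum>i. ?m i (E \<inter> \<sigma>' ` W'))" by (rule em)
    also have "\<dots> = (\<Sum>i. \<integral>\<^sup>+u\<in>W' \<inter> \<sigma>' -` (E \<inter> B i). ?vd' u \<partial>lborel)"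
    proof (rule suminf_cong)
      fix i
      have "?m i (E \<inter> \<sigma>' ` W') = (\<integral>\<^sup>+u\<in>W i \<inter> \<sigma> i -` ((E \<inter> B i) \<inter> \<sigma>' ` W'). ?vd i u \<partial>lborel)" by (simp add: Int_ac)
      also have "\<dots> = (\<integral>\<^sup>+u\<in>W' \<inter> \<sigma>' -` ((E \<inter> B i) \<inter> \<sigma> i ` W i). ?vd' u \<partial>lborel)"
        by (rule param_consistent[OF \<sigma>(1) \<sigma>']) (use E B in auto)
      also have "W' \<inter> \<sigma>' -` ((E \<inter> B i) \<inter> \<sigma> i ` W i) = W' \<inter> \<sigma>' -` (E \<inter> B i)"
        using B\<sigma>[of i] param_subset[OF \<sigma>'] by blast
      finally show "?m i (E \<inter> \<sigma>' ` W') = (\<integral>\<^sup>+u\<in>W' \<inter> \<sigma>' -` (E \<inter> B i). ?vd' u \<partial>lborel)" .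
    qed
    also have "\<dots> = (\<integral>\<^sup>+u. (\<Sum>i. ?vd' u * indicator (W' \<inter> \<sigma>' -` (E \<inter> B i)) u) \<partial>lborel)"
      by (rule nn_integral_suminf[symmetric], rule measurable_density(3)[OF \<sigma>']) (use E B in auto)
    also have "\<dots> = (\<integral>\<^sup>+u. ?vd' u * indicator (\<Union>i. W' \<inter> \<sigma>' -` (E \<inter> B i)) u \<partial>lborel)"
    proof -
      have "disjoint_family (\<lambda>i. W' \<inter> \<sigma>' -` (E \<inter> B i))" using disj unfolding disjoint_family_on_def by blast
      then show ?thesis by (simp only: suminf_disjoint_indicator)
    qed
    also have "(\<Union>i. W' \<inter> \<sigma>' -` (E \<inter> B i)) = W' \<inter> \<sigma>' -` E"
    proof -
      have "\<sigma>' u \<in> (\<Union>i. B i)" if "u \<in> W'" for u by (rule subsetD[OF SB]) (use param_subset[OF \<sigma>'] that in auto)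
      then show ?thesis by auto
    qed
    finally show "emeasure \<eta> (E \<inter> \<sigma>' ` W') = (\<integral>\<^sup>+u\<in>W' \<inter> \<sigma>' -` E. ?vd' u \<partial>lborel)" .
  qed
  have uni: "emeasure \<eta>' E = (\<Sum>i. \<integral>\<^sup>+u\<in>W i \<inter> \<sigma> i -` (E' \<inter> B i). ?vd i u \<partial>lborel)"
    if \<eta>': "is_volume TYPE('k) S \<eta>'" and E: "E' \<in> sets borel" "E = E' \<inter> S" for \<eta>' E E'
  proof -
    have s: "sets \<eta>' = sets (restrict_space borel S)" using \<eta>' by (simp add: is_volume_def)
    have e: "E \<inter> B i = (E' \<inter> B i) \<inter> \<sigma> i ` W i" for i using B\<sigma>[of i] \<sigma>S[of i] E by blast
    have "E \<inter> B i \<in> sets \<eta>'" for i using E B unfolding s by (intro in_sets_restrict_borel[of "E' \<inter> B i"]) auto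
    then have "emeasure \<eta>' (\<Union>i. E \<inter> B i) = (\<Sum>i. emeasure \<eta>' (E \<inter> B i))"
      using disj by (intro suminf_emeasure[symmetric]) (auto simp: disjoint_family_on_def)
    moreover have "(\<Union>i. E \<inter> B i) = E" using SB E by auto
    moreover have "emeasure \<eta>' (E \<inter> B i) = (\<integral>\<^sup>+u\<in>W i \<inter> \<sigma> i -` (E' \<inter> B i). ?vd i u \<partial>lborel)" for i
      unfolding e using \<eta>' \<sigma>(1) E B unfolding is_volume_def by blast
    ultimately show ?thesis by simp
  qed
  show ?thesis
  proof (rule ex1I[of _ \<eta>], rule vol)
    fix \<eta>' assume \<eta>': "is_volume TYPE('k) S \<eta>'"
    then have s: "sets \<eta>' = sets (restrict_space borel S)" by (simp add: is_volume_def)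
    show "\<eta>' = \<eta>"
    proof (rule measure_eqI)
      show "sets \<eta>' = sets \<eta>" using s sets\<eta> by simp
      fix E assume "E \<in> sets \<eta>'"
      then obtain E' where "E' \<in> sets borel" "E = E' \<inter> S" using setsD s by blast
      then show "emeasure \<eta>' E = emeasure \<eta> E" using uni[OF \<eta>'] uni[OF vol] by simp
    qed
  qed
qed

lemma riemannian_volume_is_volume:
  assumes "\<And>p. p \<in> S \<Longrightarrow> \<exists>W (\<sigma> :: real ^ 'k::finite \<Rightarrow> 'a). local_parametrization A S W \<sigma> \<and> p \<in> \<sigma> ` W"
  shows "is_volume TYPE('k) S (riemannian_volume TYPE('k) A g S)"
  using theI'[OF is_volume_ex1[OF assms]] unfolding is_volume_def riemannian_volume_def .

text \<open>
  The restriction of \<open>\<eta>\<close> to the image of \<open>\<sigma>\<close> is the image under \<open>\<sigma>\<close> of Lebesgue measure weighted by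
  the volume density, because the two agree on Borel sets.
\<close>

lemma integral_in_parametrization:
  fixes \<sigma> :: "real^'k::finite \<Rightarrow> 'a" and f :: "'a \<Rightarrow> real"
  assumes \<eta>: "is_volume TYPE('k) S \<eta>" and \<sigma>: "local_parametrization A S W \<sigma>"
    and f: "f \<in> borel_measurable borel" and supp: "\<And>p. p \<in> S \<Longrightarrow> p \<notin> \<sigma> ` W \<Longrightarrow> f p = 0"
  defines "q \<equiv> \<lambda>u. indicator W u * (volume_density A g \<sigma> u * f (\<sigma> u))"
  shows "integrable \<eta> f \<longleftrightarrow> integrable lborel q" and "(LINT p|\<eta>. f p) = (LINT u|lborel. q u)"
proof -
  let ?vd = "volume_density A g \<sigma>"
  have s: "sets \<eta> = sets (restrict_space borel S)" using \<eta> by (simp add: is_volume_def)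
  then have sp: "space \<eta> = S" using sets_eq_imp_space_eq[OF s] by (simp add: space_restrict_space)
  obtain V where V: "open V" "\<sigma> ` W = S \<inter> V" using param_image[OF \<sigma>] by (auto simp: openin_open)
  have im: "\<sigma> ` W \<in> sets \<eta>" unfolding s by (rule in_sets_restrict_borel[of V]) (use V in auto)
  have W: "W \<in> sets borel" using param_open[OF \<sigma>] by simp
  define M where "M = density (restrict_space lborel W) (\<lambda>u. ennreal (?vd u))"
  have vd: "?vd \<in> borel_measurable (restrict_space lborel W)"
    using borel_measurable_continuous_on_restrict[OF continuous_volume_density[OF \<sigma>]]
    by (simp add: measurable_def space_restrict_space sets_restrict_space)
  have \<sigma>m: "\<sigma> \<in> measurable M borel"
    using borel_measurable_continuous_on_restrict[OF param_continuous[OF \<sigma>]]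
    by (simp add: M_def measurable_def space_restrict_space sets_restrict_space)
  define N where "N = distr M borel \<sigma>"
  define R where "R = distr (restrict_space \<eta> (\<sigma> ` W)) borel (\<lambda>p. p)"
  have idm: "(\<lambda>p. p) \<in> measurable (restrict_space \<eta> (\<sigma> ` W)) borel"
  proof -
    have "(\<lambda>p. p) \<in> measurable \<eta> borel"
      by (subst measurable_cong_sets[OF s refl]) (rule measurable_restrict_space1, simp)
    then show ?thesis by (rule measurable_restrict_space1)
  qed
  have "R = N"
  proof (rule measure_eqI)
    show "sets R = sets N" by (simp add: R_def N_def)
    fix E assume "E \<in> sets R"
    then have E: "E \<in> sets borel" by (simp add: R_def)
    have spR: "space (restrict_space \<eta> (\<sigma> ` W)) = \<sigma> ` W"
      using param_subset[OF \<sigma>] sp by (simp add: space_restrict_space Int_absorb2)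
    have "E \<inter> \<sigma> ` W = (E \<inter> V) \<inter> S" unfolding V(2) by blast
    then have E': "E \<inter> \<sigma> ` W \<in> sets \<eta>" unfolding s by (rule in_sets_restrict_borel[rotated]) (use E V(1) in auto)
    have "emeasure R E = emeasure (restrict_space \<eta> (\<sigma> ` W)) (E \<inter> \<sigma> ` W)"
      unfolding R_def using idm E by (simp add: emeasure_distr spR)
    also have "\<dots> = emeasure \<eta> (E \<inter> \<sigma> ` W)"
      by (rule emeasure_restrict_space) (use im in auto)
    also have "\<dots> = (\<integral>\<^sup>+u\<in>W \<inter> \<sigma> -` E. ennreal (?vd u) \<partial>lborel)"
      using \<eta> \<sigma> E unfolding is_volume_def by blast
    also have "\<dots> = (\<integral>\<^sup>+u. ennreal (?vd u) * indicator (W \<inter> \<sigma> -` E) u \<partial>restrict_space lborel W)"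
      using W by (subst nn_integral_restrict_space) (auto intro!: nn_integral_cong simp: indicator_def)
    also have "\<dots> = emeasure M (W \<inter> \<sigma> -` E)"
      unfolding M_def using vd measurable_density(1)[OF \<sigma> E] W
      by (subst emeasure_density) (auto simp: sets_restrict_space_iff)
    also have "\<dots> = emeasure N E"
      unfolding N_def using \<sigma>m E by (simp add: emeasure_distr M_def space_restrict_space Int_commute)
    finally show "emeasure R E = emeasure N E" .
  qed
  have f\<eta>: "f \<in> borel_measurable \<eta>"
    by (subst measurable_cong_sets[OF s refl]) (rule measurable_restrict_space1[OF f])
  have ind: "f p = indicator (\<sigma> ` W) p *\<^sub>R f p" if "p \<in> space \<eta>" for p
    using supp that by (auto simp: sp indicator_def)
  have qq: "q u = indicator W u *\<^sub>R (?vd u *\<^sub>R f (\<sigma> u))" for u by (simp add: q_def)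
  have nn: "AE u in restrict_space lborel W. 0 \<le> ?vd u"
    by (rule AE_I2) (use volume_density_nonneg[OF \<sigma>] in \<open>simp add: space_restrict_space\<close>)
  have f\<sigma>: "(\<lambda>u. f (\<sigma> u)) \<in> borel_measurable (restrict_space lborel W)"
    using measurable_compose[OF \<sigma>m f] by (simp add: M_def)
  have im': "\<sigma> ` W \<inter> space \<eta> \<in> sets \<eta>" using im by simp
  have "integrable \<eta> f \<longleftrightarrow> integrable \<eta> (\<lambda>p. indicator (\<sigma> ` W) p *\<^sub>R f p)"
    by (rule Bochner_Integration.integrable_cong[OF refl ind])
  also have "\<dots> \<longleftrightarrow> integrable (restrict_space \<eta> (\<sigma> ` W)) f"
    by (rule integrable_restrict_space[OF im', symmetric])
  also have "\<dots> \<longleftrightarrow> integrable R f" unfolding R_def by (simp add: integrable_distr_eq[OF idm f])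
  also have "\<dots> \<longleftrightarrow> integrable M (\<lambda>u. f (\<sigma> u))" unfolding \<open>R = N\<close> N_def by (rule integrable_distr_eq[OF \<sigma>m f])
  also have "\<dots> \<longleftrightarrow> integrable (restrict_space lborel W) (\<lambda>u. ?vd u *\<^sub>R f (\<sigma> u))"
    unfolding M_def by (rule integrable_density[OF f\<sigma> vd nn])
  also have "\<dots> \<longleftrightarrow> integrable lborel q"
    using W by (subst integrable_restrict_space) (auto simp: qq[abs_def])
  finally show "integrable \<eta> f \<longleftrightarrow> integrable lborel q" .
  have "(LINT p|\<eta>. f p) = (LINT p|\<eta>. indicator (\<sigma> ` W) p *\<^sub>R f p)"
    by (rule Bochner_Integration.integral_cong[OF refl ind])
  also have "\<dots> = (LINT p|restrict_space \<eta> (\<sigma> ` W). f p)"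
    by (rule integral_restrict_space[OF im', symmetric])
  also have "\<dots> = (LINT p|R. f p)" unfolding R_def by (simp add: integral_distr[OF idm f])
  also have "\<dots> = (LINT u|M. f (\<sigma> u))" unfolding \<open>R = N\<close> N_def by (rule integral_distr[OF \<sigma>m f])
  also have "\<dots> = (LINT u|restrict_space lborel W. ?vd u *\<^sub>R f (\<sigma> u))"
    unfolding M_def by (rule integral_density[OF f\<sigma> vd nn])
  also have "\<dots> = (LINT u|lborel. q u)"
    using W by (subst integral_restrict_space) (auto simp: qq[abs_def])
  finally show "(LINT p|\<eta>. f p) = (LINT u|lborel. q u)" .
qed

end

section \<open>Adapted coordinates\<close>

context coordinate_split
begin

lemma card_split: "CARD('m) = CARD('n) + CARD('k)"
proof -
  have "card (range \<iota> \<union> range \<kappa>) = CARD('n) + CARD('k)"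
    using card_Un_disjoint[OF _ _ disj] card_image[OF inj_\<iota>] card_image[OF inj_\<kappa>] by simp
  then show ?thesis by (simp add: cover)
qed

lemma join_axis: "join 0 (axis b 1) = axis (\<kappa> b) 1" "join (axis a 1) 0 = axis (\<iota> a) 1"
  by (rule split_eqI, simp_all add: axis_def inj_eq[OF inj_\<kappa>] inj_eq[OF inj_\<iota>])+

lemma linear_join_fibre: "linear (join 0)" and linear_join_base: "linear (\<lambda>y. join y 0)"
  by (rule linearI; rule split_eqI; simp)+

lemma join_sum: "join y t = join y 0 + join 0 t"
  by (rule split_eqI) simp_all

lemma bounded_linear_split:
  "bounded_linear base" "bounded_linear fib" "bounded_linear (join 0)" "bounded_linear (\<lambda>y. join y 0)"
  using linear_base linear_fib linear_join_fibre linear_join_base by (simp_all add: linear_conv_bounded_linear)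

lemma Cn_on_join:
  assumes "open S" "Cn_on n S p" "Cn_on n S q"
  shows "Cn_on n S (\<lambda>x. join (p x) (q x))"
  by (subst join_sum, intro Cn_on_add Cn_on_compose_linear[OF assms(1) bounded_linear_split(4)] Cn_on_compose_linear[OF assms(1) bounded_linear_split(3)] assms)

lemma has_derivative_join:
  "((\<lambda>t. join y t) has_derivative join 0) (at t)"
  "((\<lambda>y. join y t) has_derivative (\<lambda>y. join y 0)) (at y)"
proof -
  have "((\<lambda>t. join y 0 + join 0 t) has_derivative (\<lambda>h. 0 + join 0 h)) (at t)"
    by (intro has_derivative_add has_derivative_const bounded_linear_imp_has_derivative bounded_linear_split)
  then show "((\<lambda>t. join y t) has_derivative join 0) (at t)" by (simp flip: join_sum)
  have "((\<lambda>y. join y 0 + join 0 t) has_derivative (\<lambda>h. join h 0 + 0)) (at y)"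
    by (intro has_derivative_add has_derivative_const bounded_linear_imp_has_derivative bounded_linear_split)
  then show "((\<lambda>y. join y t) has_derivative (\<lambda>y. join y 0)) (at y)" by (simp flip: join_sum)
qed

text \<open>The kernel of a surjective map embeds into the space of fibre coordinates.\<close>

lemma complementary_map_exists:
  fixes L :: "real^'m \<Rightarrow> real^'n"
  assumes L: "linear L" "surj L"
  shows "\<exists>T :: real^'m \<Rightarrow> real^'k. linear T \<and> inj (\<lambda>x. join (L x) (T x))"
proof -
  obtain R where R: "linear R" "L \<circ> R = id" using linear_surjective_right_inverse[OF L] by blast
  then have injR: "inj R" by (metis inj_on_id inj_on_imageI2)
  let ?K = "{x. L x = 0}"
  have K: "subspace ?K" by (rule linear_subspace_kernel[OF L(1)])
  have subR: "subspace (range R)" by (rule linear_subspace_image[OF R(1) subspace_UNIV])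
  have "x = 0" if "L x = 0" "x = R y" for x y
  proof -
    have "L (R y) = y" using R(2) by (simp add: fun_eq_iff)
    then show ?thesis using that linear_0[OF R(1)] by simp
  qed
  then have "?K \<inter> range R \<subseteq> {0}" by auto
  then have "dim (?K \<inter> range R) = 0" by (simp add: dim_eq_0)
  moreover have "dim (range R) = CARD('n)" using dim_image_eq[OF R(1), of UNIV] injR by simp
  moreover have "dim {x + y |x y. x \<in> ?K \<and> y \<in> range R} + dim (?K \<inter> range R) = dim ?K + dim (range R)"
    by (rule dim_sums_Int[OF K subR])
  moreover have "dim {x + y |x y. x \<in> ?K \<and> y \<in> range R} \<le> CARD('m)"
    using dim_subset_UNIV[of "{x + y |x y. x \<in> ?K \<and> y \<in> range R}"] by simp
  ultimately have "dim ?K \<le> CARD('k)" using card_split by linarith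
  then have "dim ?K \<le> dim (UNIV :: (real^'k) set)" by simp
  from isometry_subset_subspace[OF K subspace_UNIV this]
  obtain T :: "real^'m \<Rightarrow> real^'k" where T: "linear T" "\<And>x. x \<in> ?K \<Longrightarrow> norm (T x) = norm x" by metis
  have lin: "linear (\<lambda>x. join (L x) (T x))"
    by (rule linearI)
      (simp_all add: linear_add[OF L(1)] linear_add[OF T(1)] linear_scale[OF L(1)] linear_scale[OF T(1)] join_add join_scaleR)
  have "x = 0" if "join (L x) (T x) = 0" for x
  proof -
    have "base (join (L x) (T x)) = 0" "fib (join (L x) (T x)) = 0" using that linear_0[OF linear_base] linear_0[OF linear_fib] by simp_all
    then have "L x = 0" "T x = 0" by simp_all
    then show ?thesis using T(2)[of x] by simp
  qed
  then have "inj (\<lambda>x. join (L x) (T x))" using linear_injective_0[OF lin] by blast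
  with T(1) show ?thesis by blast
qed

end

text \<open>
  The submersion is of class $C^{n+1}$; in adapted coordinates the densities of the fibre measures
  involve its first derivatives and are of class $C^n$.
\<close>

locale riemannian_submersion = M: riemannian A g + N: riemannian B h + coordinate_split \<iota> \<kappa>
  for A :: "('a::{t2_space, second_countable_topology}, 'm::finite) chart set" and g
    and B :: "('b::{t2_space, second_countable_topology}, 'n::finite) chart set" and h
    and \<iota> :: "'n \<Rightarrow> 'm" and \<kappa> :: "'k::finite \<Rightarrow> 'm" +
  fixes \<rho> :: "'a \<Rightarrow> 'b" and n :: nat
  assumes continuous_\<rho>: "continuous_on UNIV \<rho>"
    and smooth: "\<And>c d. c \<in> A \<Longrightarrow> d \<in> B \<Longrightarrow>
      Cn_on (Suc n) (coord c ` (chart_dom c \<inter> \<rho> -` chart_dom d)) (\<lambda>x. coord d (\<rho> (chart_inv c x)))"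
    and submersion: "submersion A B \<rho>"
begin

lemma open_vimage_\<rho>: "open V \<Longrightarrow> open (\<rho> -` V)"
  using continuous_\<rho> by (rule open_vimage[rotated])

lemma open_chart_pair:
  assumes "c \<in> A" "d \<in> B"
  shows "open (chart_dom c \<inter> \<rho> -` chart_dom d)" "open (coord c ` (chart_dom c \<inter> \<rho> -` chart_dom d))"
proof -
  show o: "open (chart_dom c \<inter> \<rho> -` chart_dom d)"
    by (intro open_Int M.open_chart_dom open_vimage_\<rho> N.open_chart_dom assms)
  show "open (coord c ` (chart_dom c \<inter> \<rho> -` chart_dom d))" by (rule M.open_coord_image[OF assms(1) o]) simp
qed

lemma \<rho>_has_derivative:
  assumes "c \<in> A" "d \<in> B" "p \<in> chart_dom c" "\<rho> p \<in> chart_dom d"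
  shows "((\<lambda>x. coord d (\<rho> (chart_inv c x))) has_derivative differential c d \<rho> p) (at (coord c p))"
  using Cn_on_has_derivative[OF smooth[OF assms(1,2)], of "coord c p"] assms(3,4)
  by (simp add: differential_def o_def)

lemma surj_differential:
  assumes "c \<in> A" "d \<in> B" "p \<in> chart_dom c" "\<rho> p \<in> chart_dom d"
  shows "surj (differential c d \<rho> p)"
  using submersion assms by (auto simp: submersion_def)

end

text \<open>
  Coordinates \<open>\<Phi>\<close> of the same class as \<open>\<rho>\<close>, in which \<open>\<rho>\<close> is the projection to the base coordinates.
  They need not belong to the smooth atlas, so they are kept as a reparametrization of one.
\<close>

locale patch = riemannian_submersion A g B h \<iota> \<kappa> \<rho> n
  for A :: "('a::{t2_space, second_countable_topology}, 'm::finite) chart set" and g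
    and B :: "('b::{t2_space, second_countable_topology}, 'n::finite) chart set" and h
    and \<iota> :: "'n \<Rightarrow> 'm" and \<kappa> :: "'k::finite \<Rightarrow> 'm" and \<rho> n +
  fixes c d V \<Omega> \<Phi> \<Psi>
  assumes c: "c \<in> A" and d: "d \<in> B" and open_V: "open V" and V: "V \<subseteq> chart_dom c" "\<And>p. p \<in> V \<Longrightarrow> \<rho> p \<in> chart_dom d"
    and open_\<Omega>: "open \<Omega>" and hom: "homeomorphism \<Omega> (coord c ` V) \<Phi> \<Psi>" and \<Phi>: "Cn_on (Suc n) \<Omega> \<Phi>"
    and \<Psi>: "Cn_on (Suc n) (coord c ` V) \<Psi>"
    and base_\<rho>: "\<And>z. z \<in> \<Omega> \<Longrightarrow> coord d (\<rho> (chart_inv c (\<Phi> z))) = base z"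
    and inj_D\<Phi>: "\<And>z. z \<in> \<Omega> \<Longrightarrow> inj (frechet_derivative \<Phi> (at z))"

text \<open>
  Around each point, the coordinates of the image point can be completed to coordinates of the
  domain by a linear function of the given ones.
\<close>

lemma (in riemannian_submersion) patch_exists_charts:
  assumes c: "c \<in> A" "p \<in> chart_dom c" and d: "d \<in> B" "\<rho> p \<in> chart_dom d"
  shows "\<exists>V \<Omega> \<Phi> \<Psi>. p \<in> V \<and> patch A g B h \<iota> \<kappa> \<rho> n c d V \<Omega> \<Phi> \<Psi>"
proof -
  let ?O = "coord c ` (chart_dom c \<inter> \<rho> -` chart_dom d)"
  let ?r = "\<lambda>x. coord d (\<rho> (chart_inv c x))"
  let ?L = "differential c d \<rho> p"
  note O = open_chart_pair(2)[OF c(1) d(1)]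
  have L: "(?r has_derivative ?L) (at (coord c p))" by (rule \<rho>_has_derivative[OF c(1) d(1) c(2) d(2)])
  obtain T where T: "linear T" "inj (\<lambda>x. join (?L x) (T x))"
    using complementary_map_exists[OF has_derivative_linear[OF L] surj_differential[OF c(1) d(1) c(2) d(2)]] by blast
  have blT: "bounded_linear T" using T(1) by (simp add: linear_conv_bounded_linear)
  let ?q = "\<lambda>x. join (?r x) (T x)"
  have q: "Cn_on (Suc n) ?O ?q"
    by (rule Cn_on_join[OF O smooth[OF c(1) d(1)] Cn_on_linear[OF blT]])
  have x0: "coord c p \<in> ?O" using c d by auto
  have "(?q has_derivative (\<lambda>h. join (?L h) 0 + join 0 (T h))) (at (coord c p))"
    by (subst join_sum, intro has_derivative_add bounded_linear.has_derivative[OF bounded_linear_split(4)] bounded_linear.has_derivative[OF bounded_linear_split(3)]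
      bounded_linear_imp_has_derivative blT L)
  from frechet_derivative_at[OF this, symmetric]
  have "frechet_derivative ?q (at (coord c p)) = (\<lambda>h. join (?L h) (T h))" by (simp flip: join_sum)
  then have "inj (frechet_derivative ?q (at (coord c p)))" using T(2) by simp
  then obtain U V' G where G: "open U" "U \<subseteq> ?O" "coord c p \<in> U" "open V'" "homeomorphism U V' ?q G" "Cn_on (Suc n) V' G"
    by (rule Cn_inverse_function[OF O q x0])
  define V where "V = chart_dom c \<inter> coord c -` U"
  have V: "open V" unfolding V_def by (rule M.open_coord_preimage[OF c(1) G(1)])
  have cV: "coord c ` V = U" using G(2) by (auto simp: V_def)
  have \<rho>V: "\<rho> p' \<in> chart_dom d" if "p' \<in> V" for p'
  proof -
    have p': "p' \<in> chart_dom c" "coord c p' \<in> ?O" using that G(2) by (auto simp: V_def)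
    then obtain p'' where p'': "p'' \<in> chart_dom c" "\<rho> p'' \<in> chart_dom d" "coord c p' = coord c p''" by auto
    then show ?thesis using M.coord_inj[OF c(1) p'(1) p''(1)] by simp
  qed
  have GU: "G z \<in> U" "?q (G z) = z" if "z \<in> V'" for z using G(5) that by (auto simp: homeomorphism_def)
  have "patch A g B h \<iota> \<kappa> \<rho> n c d V V' G ?q"
  proof (unfold_locales)
    show "homeomorphism V' (coord c ` V) G ?q" unfolding cV using G(5) by (rule homeomorphism_symD)
    show "Cn_on (Suc n) (coord c ` V) ?q" unfolding cV by (rule Cn_on_subset[OF q G(2)])
    show "coord d (\<rho> (chart_inv c (G z))) = base z" if "z \<in> V'" for z
      using arg_cong[OF GU(2)[OF that], of base] by simp
    show "inj (frechet_derivative G (at z))" if z: "z \<in> V'" for z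
    proof -
      have "G z \<in> ?O" using GU(1)[OF z] G(2) by blast
      from has_derivative_compose[OF Cn_on_has_derivative[OF G(6) z] Cn_on_has_derivative[OF q this]]
      have "((\<lambda>x. x) has_derivative (\<lambda>h. frechet_derivative ?q (at (G z)) (frechet_derivative G (at z) h))) (at z)"
        by (rule has_derivative_transform_within_open[OF _ G(4) z]) (rule GU(2))
      from has_derivative_unique[OF this has_derivative_ident]
      have "frechet_derivative ?q (at (G z)) (frechet_derivative G (at z) h) = h" for h by metis
      then show ?thesis by (rule inj_on_inverseI)
    qed
  qed (use c d V \<rho>V G in \<open>auto simp: V_def\<close>)
  moreover have "p \<in> V" using c G(3) by (simp add: V_def)
  ultimately show ?thesis by blast
qed

lemma (in riemannian_submersion) patch_exists:
  "\<exists>c d V \<Omega> \<Phi> \<Psi>. p \<in> V \<and> patch A g B h \<iota> \<kappa> \<rho> n c d V \<Omega> \<Phi> \<Psi>"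
  by (rule exI, rule exI, rule patch_exists_charts[OF M.chart_at N.chart_at])

context patch
begin

abbreviation "pt z \<equiv> chart_inv c (\<Phi> z)"
abbreviation "D\<Phi> z \<equiv> frechet_derivative \<Phi> (at z)"

lemma \<Phi>_image: "z \<in> \<Omega> \<Longrightarrow> \<Phi> z \<in> coord c ` V" and \<Psi>_\<Phi>: "z \<in> \<Omega> \<Longrightarrow> \<Psi> (\<Phi> z) = z"
  and \<Psi>_image: "x \<in> coord c ` V \<Longrightarrow> \<Psi> x \<in> \<Omega>" and \<Phi>_\<Psi>: "x \<in> coord c ` V \<Longrightarrow> \<Phi> (\<Psi> x) = x"
  and continuous_\<Psi>: "continuous_on (coord c ` V) \<Psi>" and continuous_\<Phi>: "continuous_on \<Omega> \<Phi>"
  using hom by (auto simp: homeomorphism_def)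

lemma \<Phi>_in_chart: "z \<in> \<Omega> \<Longrightarrow> \<Phi> z \<in> coord c ` chart_dom c"
  using \<Phi>_image V(1) by blast

lemma pt: assumes "z \<in> \<Omega>" shows "pt z \<in> V" "pt z \<in> chart_dom c" "\<rho> (pt z) \<in> chart_dom d" "coord c (pt z) = \<Phi> z"
proof -
  obtain p where p: "p \<in> V" "\<Phi> z = coord c p" using \<Phi>_image[OF assms] by blast
  then have "pt z = p" using M.chart_inv_coord[OF c] V(1) by auto
  then show "pt z \<in> V" "pt z \<in> chart_dom c" "\<rho> (pt z) \<in> chart_dom d" "coord c (pt z) = \<Phi> z" using p V by auto
qed

lemma pt_surj:
  assumes "p \<in> V"
  shows "\<Psi> (coord c p) \<in> \<Omega>" "pt (\<Psi> (coord c p)) = p" "base (\<Psi> (coord c p)) = coord d (\<rho> p)"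
proof -
  have i: "coord c p \<in> coord c ` V" using assms by blast
  show 1: "\<Psi> (coord c p) \<in> \<Omega>" by (rule \<Psi>_image[OF i])
  show 2: "pt (\<Psi> (coord c p)) = p" using \<Phi>_\<Psi>[OF i] M.chart_inv_coord[OF c] assms V(1) by auto
  show "base (\<Psi> (coord c p)) = coord d (\<rho> p)" using base_\<rho>[OF 1] 2 by simp
qed

lemma base_in_chart: "z \<in> \<Omega> \<Longrightarrow> base z \<in> coord d ` chart_dom d"
  using base_\<rho> pt(3) by (metis imageI)

lemma \<rho>_pt: "z \<in> \<Omega> \<Longrightarrow> \<rho> (pt z) = chart_inv d (base z)"
  using base_\<rho> N.chart_inv_coord[OF d pt(3)] by metis

lemma \<Phi>_has_derivative: "z \<in> \<Omega> \<Longrightarrow> (\<Phi> has_derivative D\<Phi> z) (at z)"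
  by (rule Cn_on_has_derivative[OF \<Phi>])

lemma linear_D\<Phi>: "z \<in> \<Omega> \<Longrightarrow> linear (D\<Phi> z)"
  using \<Phi>_has_derivative has_derivative_linear by blast

lemma det_D\<Phi>: "z \<in> \<Omega> \<Longrightarrow> det (matrix (D\<Phi> z)) \<noteq> 0"
  using det_nz_iff_inj[OF linear_D\<Phi>] inj_D\<Phi> by blast

lemma linear_frame:
  assumes "z \<in> \<Omega>" "c' \<in> A" "pt z \<in> chart_dom c'"
  shows "linear (\<lambda>v. trans_deriv c c' (pt z) (D\<Phi> z v))"
  using linear_compose[OF linear_D\<Phi>[OF assms(1)] M.linear_trans_deriv[OF c assms(2) pt(2)[OF assms(1)] assms(3)]]
  by (simp add: o_def)

lemma inj_frame:
  assumes "z \<in> \<Omega>" "c' \<in> A" "pt z \<in> chart_dom c'"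
  shows "inj (\<lambda>v. trans_deriv c c' (pt z) (D\<Phi> z v))"
  using inj_compose[OF M.inj_trans_deriv[OF c assms(2) pt(2)[OF assms(1)] assms(3)] inj_D\<Phi>[OF assms(1)]]
  by (simp add: o_def)

text \<open>
  The vectors $D\Phi(v)$ form a frame in which the differential of \<open>\<rho>\<close> is the projection \<open>base\<close>. Both
  charts are arbitrary, because the normal Jacobian and the normal lift refer to charts
  that are chosen for each point separately.
\<close>

lemma differential_lift:
  assumes z: "z \<in> \<Omega>" and c': "c' \<in> A" "pt z \<in> chart_dom c'" and d': "d' \<in> B" "\<rho> (pt z) \<in> chart_dom d'"
  shows "differential c' d' \<rho> (pt z) (trans_deriv c c' (pt z) (D\<Phi> z v)) = trans_deriv d d' (\<rho> (pt z)) (base v)"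
proof -
  have "((\<lambda>x. coord d' (\<rho> (chart_inv c x))) has_derivative (\<lambda>v. differential c' d' \<rho> (pt z) (trans_deriv c c' (pt z) v))) (at (coord c (pt z)))"
    by (rule M.has_derivative_change_chart) (use c c' pt[OF z] \<rho>_has_derivative[OF c'(1) d'(1) c'(2) d'(2)] in auto)
  then have "((\<lambda>x. coord d' (\<rho> (chart_inv c x))) has_derivative (\<lambda>v. differential c' d' \<rho> (pt z) (trans_deriv c c' (pt z) v))) (at (\<Phi> z))"
    by (simp only: pt(4)[OF z])
  from has_derivative_compose[OF \<Phi>_has_derivative[OF z] this]
  have 1: "((\<lambda>x. coord d' (\<rho> (pt x))) has_derivative (\<lambda>v. differential c' d' \<rho> (pt z) (trans_deriv c c' (pt z) (D\<Phi> z v)))) (at z)" .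
  have "((\<lambda>x. coord d' (chart_inv d x)) has_derivative trans_deriv d d' (\<rho> (pt z))) (at (base z))"
    using N.transition_has_derivative[OF d d'(1) pt(3)[OF z] d'(2)] base_\<rho>[OF z] by simp
  from has_derivative_compose[OF bounded_linear_imp_has_derivative[OF bounded_linear_split(1)] this]
  have "((\<lambda>x. coord d' (\<rho> (pt x))) has_derivative (\<lambda>v. trans_deriv d d' (\<rho> (pt z)) (base v))) (at z)"
    by (rule has_derivative_transform_within_open[OF _ open_\<Omega> z]) (simp add: \<rho>_pt)
  from has_derivative_unique[OF 1 this] show ?thesis by metis
qed

text \<open>The metric in the adapted coordinates, and the square of the density of its volume.\<close>

definition Q :: "real^'m \<Rightarrow> real^'m^'m" where
  "Q z = gram (\<lambda>v w. g c (pt z) (D\<Phi> z v) (D\<Phi> z w))"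

definition W2 :: "real^'m \<Rightarrow> real" where
  "W2 z = M.gdet c (\<Phi> z) * (det (matrix (D\<Phi> z)))\<^sup>2"

lemma det_Q: "z \<in> \<Omega> \<Longrightarrow> det (Q z) = W2 z"
proof -
  assume z: "z \<in> \<Omega>"
  have "bilinear (g c (pt z))" using M.metric_inner[OF c pt(2)[OF z]] by (simp add: inner_form_def)
  from det_gram_pullback[OF this linear_D\<Phi>[OF z]] show ?thesis by (simp add: Q_def W2_def M.gdet_def)
qed

lemma W2_pos: "z \<in> \<Omega> \<Longrightarrow> W2 z > 0"
  using M.gdet_pos[OF c \<Phi>_in_chart] det_D\<Phi> by (simp add: W2_def)

lemma Cn_on_D\<Phi>: "Cn_on n \<Omega> (\<lambda>z. D\<Phi> z v)"
  by (rule Cn_on_frechet[OF \<Phi>])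

lemma Cn_on_\<Phi>: "Cn_on n \<Omega> \<Phi>"
  by (rule Cn_on_SucD[OF \<Phi>])

lemma Cn_on_W2: "Cn_on n \<Omega> W2"
proof -
  have "Cn_on n \<Omega> (\<lambda>z. det (matrix (D\<Phi> z)))"
    by (rule Cn_on_det[OF open_\<Omega>]) (simp add: matrix_def Cn_on_nth[OF open_\<Omega> Cn_on_D\<Phi>])
  moreover have "Cn_on n \<Omega> (\<lambda>z. M.gdet c (\<Phi> z))"
    by (rule Cn_on_compose[OF open_\<Omega> M.open_chart_image[OF c] M.Cn_on_gdet[OF c] Cn_on_\<Phi>]) (use \<Phi>_in_chart in auto)
  ultimately show ?thesis unfolding W2_def[abs_def] by (intro Cn_on_mult Cn_on_power open_\<Omega>)
qed

lemma Cn_on_Q: "Cn_on n \<Omega> (\<lambda>z. Q z $ i $ j)"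
proof -
  let ?G = "\<lambda>z a b. g c (pt z) (axis a 1) (axis b 1)"
  have "Cn_on n \<Omega> (\<lambda>z. \<Sum>a\<in>UNIV. D\<Phi> z (axis i 1) $ a * (\<Sum>b\<in>UNIV. ?G z a b * D\<Phi> z (axis j 1) $ b))"
    by (intro Cn_on_sum Cn_on_mult open_\<Omega> Cn_on_nth[OF open_\<Omega> Cn_on_D\<Phi>]
        Cn_on_compose[OF open_\<Omega> M.open_chart_image[OF c] M.Cn_on_metric[OF c] Cn_on_\<Phi>]) (use \<Phi>_in_chart in auto)
  then show ?thesis
  proof (rule Cn_on_cong[OF open_\<Omega>, rotated])
    fix z assume "z \<in> \<Omega>"
    then have "bilinear (g c (pt z))" using M.metric_inner[OF c pt(2)] by (simp add: inner_form_def)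
    then have e: "g c (pt z) v w = (\<Sum>a\<in>UNIV. v $ a * (\<Sum>b\<in>UNIV. ?G z a b * w $ b))" for v w
      by (subst gram_mult) (simp_all add: inner_vec_def matrix_vector_mult_def gram_def)
    show "(\<Sum>a\<in>UNIV. D\<Phi> z (axis i 1) $ a * (\<Sum>b\<in>UNIV. ?G z a b * D\<Phi> z (axis j 1) $ b)) = Q z $ i $ j"
      using e[of "D\<Phi> z (axis i 1)" "D\<Phi> z (axis j 1)"] by (simp add: Q_def gram_def)
  qed
qed

definition slice :: "real^'n \<Rightarrow> (real^'k) set" where "slice y = {t. join y t \<in> \<Omega>}"

text \<open>
  Fixing the base coordinates parametrizes the part of a fibre that lies in the patch, and the
  inner products of the derivatives along the fibre coordinates form a block of \<open>Q\<close>.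
\<close>

lemma slice_parametrization:
  assumes l: "l \<in> chart_dom d"
  defines "y \<equiv> coord d l"
  shows "local_parametrization A (\<rho> -` {l}) (slice y) (\<lambda>t. pt (join y t))"
    and "(\<lambda>t. pt (join y t)) ` slice y = V \<inter> \<rho> -` {l}"
    and "t \<in> slice y \<Longrightarrow> volume_density A g (\<lambda>t. pt (join y t)) t = sqrt (det (\<chi> a b. Q (join y t) $ \<kappa> a $ \<kappa> b))"
proof -
  let ?\<sigma> = "\<lambda>t. pt (join y t)"
  have cj: "continuous_on X (join y)" for X
    by (intro continuous_at_imp_continuous_on ballI has_derivative_continuous[OF has_derivative_join(1)])
  have S: "open (slice y)"
    using open_vimage[OF open_\<Omega> cj[of UNIV]] by (simp add: slice_def vimage_def)
  have im: "?\<sigma> ` slice y = V \<inter> \<rho> -` {l}"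
  proof (intro equalityI subsetI)
    fix p assume "p \<in> ?\<sigma> ` slice y"
    then obtain t where "join y t \<in> \<Omega>" "p = pt (join y t)" by (auto simp: slice_def)
    then show "p \<in> V \<inter> \<rho> -` {l}" using pt(1) \<rho>_pt N.chart_inv_coord[OF d l] by (simp add: y_def)
  next
    fix p assume p: "p \<in> V \<inter> \<rho> -` {l}"
    let ?z = "\<Psi> (coord c p)"
    have "base ?z = y" "?z \<in> \<Omega>" "pt ?z = p" using pt_surj p by (auto simp: y_def)
    then have "join y (fib ?z) = ?z" using join_base_fib[of ?z] by simp
    with \<open>?z \<in> \<Omega>\<close> \<open>pt ?z = p\<close> show "p \<in> ?\<sigma> ` slice y"
      by (intro image_eqI[of _ _ "fib ?z"]) (simp_all add: slice_def)
  qed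
  then show "?\<sigma> ` slice y = V \<inter> \<rho> -` {l}" .
  have cpt: "continuous_on \<Omega> (\<lambda>z. pt z)"
    by (rule continuous_on_compose2[OF M.continuous_chart_inv[OF c] continuous_\<Phi>]) (use \<Phi>_in_chart in auto)
  have hom\<sigma>: "homeomorphism (slice y) (?\<sigma> ` slice y) ?\<sigma> (\<lambda>p. fib (\<Psi> (coord c p)))"
  proof (rule homeomorphismI)
    show c\<sigma>: "continuous_on (slice y) ?\<sigma>"
      by (rule continuous_on_compose2[OF cpt cj]) (auto simp: slice_def)
    have "continuous_on V (\<lambda>p. fib (\<Psi> (coord c p)))"
      by (intro bounded_linear.continuous_on[OF bounded_linear_split(2)] continuous_on_compose2[OF continuous_\<Psi>]
         continuous_on_subset[OF M.continuous_coord[OF c] V(1)]) auto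
    then show "continuous_on (?\<sigma> ` slice y) (\<lambda>p. fib (\<Psi> (coord c p)))" by (rule continuous_on_subset) (simp add: im)
    show left: "fib (\<Psi> (coord c (?\<sigma> t))) = t" if "t \<in> slice y" for t
      using that pt(4) \<Psi>_\<Phi> by (simp add: slice_def)
    show "(\<lambda>p. fib (\<Psi> (coord c p))) ` ?\<sigma> ` slice y \<subseteq> slice y" using left by auto
    show "?\<sigma> (fib (\<Psi> (coord c p))) = p" if "p \<in> ?\<sigma> ` slice y" for p using that left by auto
  qed simp
  have join_in: "join y t \<in> \<Omega>" if "t \<in> slice y" for t using that by (simp add: slice_def)
  show par: "local_parametrization A (\<rho> -` {l}) (slice y) ?\<sigma>"
    unfolding local_parametrization_def
  proof (intro conjI ballI)
    show "open (slice y)" by (rule S)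
    show "openin (top_of_set (\<rho> -` {l})) (?\<sigma> ` slice y)" unfolding im openin_open using open_V by (intro exI[of _ V]) auto
    show "\<exists>\<tau>. homeomorphism (slice y) (?\<sigma> ` slice y) ?\<sigma> \<tau>" using hom\<sigma> by blast
  next
    fix c' assume c': "c' \<in> A"
    let ?O = "slice y \<inter> ?\<sigma> -` chart_dom c'"
    have O: "open ?O"
      by (rule continuous_open_preimage[OF _ S M.open_chart_dom[OF c']]) (use hom\<sigma> in \<open>auto simp: homeomorphism_def\<close>)
    have 1: "Cn_on (Suc 0) ?O (\<lambda>t. \<Phi> (join y t))"
      by (rule Cn_on_compose[OF O open_\<Omega> Cn_on_le[OF \<Phi>] Cn_on_join[OF O Cn_on_const Cn_on_ident]]) (auto simp: slice_def)
    have "Cn_on (Suc 0) ?O (\<lambda>t. coord c' (chart_inv c (\<Phi> (join y t))))"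
    proof (rule Cn_on_compose[OF O M.open_transition_domain[OF c c'] M.Cn_on_transition[OF c c'] 1])
      show "(\<lambda>t. \<Phi> (join y t)) ` ?O \<subseteq> coord c ` (chart_dom c \<inter> chart_dom c')"
      proof
        fix x assume "x \<in> (\<lambda>t. \<Phi> (join y t)) ` ?O"
        then obtain t where t: "t \<in> slice y" "pt (join y t) \<in> chart_dom c'" "x = \<Phi> (join y t)" by auto
        then have "x = coord c (pt (join y t))" "pt (join y t) \<in> chart_dom c" using pt[OF join_in] by auto
        with t(2) show "x \<in> coord c ` (chart_dom c \<inter> chart_dom c')" by blast
      qed
    qed
    then show "Ck_on 1 ?O (coord c' \<circ> ?\<sigma>)"
      unfolding Ck_on_def o_def one_enat_def by (auto intro: Cn_on_le simp del: Cn_on.simps)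
    fix t assume t: "t \<in> ?O"
    let ?z = "join y t"
    have z: "?z \<in> \<Omega>" "pt ?z \<in> chart_dom c'" using t by (auto simp: slice_def)
    have "((\<lambda>x. coord c' (chart_inv c x)) has_derivative trans_deriv c c' (pt ?z)) (at (\<Phi> ?z))"
      using M.transition_has_derivative[OF c c' pt(2)[OF z(1)] z(2)] pt(4)[OF z(1)] by simp
    from has_derivative_compose[OF has_derivative_compose[OF has_derivative_join(1) \<Phi>_has_derivative[OF z(1)]] this]
    have "frechet_derivative (coord c' \<circ> ?\<sigma>) (at t) = (\<lambda>h. trans_deriv c c' (pt ?z) (D\<Phi> ?z (join 0 h)))"
      using frechet_derivative_at by (fastforce simp: o_def)
    moreover have "inj (\<lambda>h. trans_deriv c c' (pt ?z) (D\<Phi> ?z (join 0 h)))"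
    proof (rule injI)
      fix s t assume "trans_deriv c c' (pt ?z) (D\<Phi> ?z (join 0 s)) = trans_deriv c c' (pt ?z) (D\<Phi> ?z (join 0 t))"
      then have "fib (join 0 s) = fib (join 0 t)"
        using M.inj_trans_deriv[OF c c' pt(2)[OF z(1)] z(2)] inj_D\<Phi>[OF z(1)] by (simp add: inj_eq)
      then show "s = t" by simp
    qed
    ultimately show "inj (frechet_derivative (coord c' \<circ> ?\<sigma>) (at t))" by simp
  qed
  show "volume_density A g ?\<sigma> t = sqrt (det (\<chi> a b. Q (join y t) $ \<kappa> a $ \<kappa> b))" if t: "t \<in> slice y"
  proof -
    have z: "join y t \<in> \<Omega>" by (rule join_in[OF t])
    have "((\<lambda>t. \<Phi> (join y t)) has_derivative (\<lambda>h. D\<Phi> (join y t) (join 0 h))) (at t)"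
      by (rule has_derivative_compose[OF has_derivative_join(1) \<Phi>_has_derivative[OF z]])
    then have "((\<lambda>t. coord c (?\<sigma> t)) has_derivative (\<lambda>h. D\<Phi> (join y t) (join 0 h))) (at t)"
      by (rule has_derivative_transform_within_open[OF _ S t]) (simp add: pt(4) join_in)
    from frechet_derivative_at[OF this, symmetric] M.volume_density_chart(1)[OF par c t pt(2)[OF z]]
    show ?thesis by (simp add: gram_def Q_def join_axis)
  qed
qed

text \<open>
  The frame $D\Phi$ satisfies the hypotheses of \<open>fibre_density\<close>.
\<close>

lemma normal_jacobian_pt:
  assumes z: "z \<in> \<Omega>"
  shows "normal_jacobian A g B h \<rho> (pt z) = sqrt (det (\<chi> a b. Q z $ \<kappa> a $ \<kappa> b) / W2 z * N.gdet d (base z))"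
    and "det (\<chi> a b. Q z $ \<kappa> a $ \<kappa> b) > 0"
proof -
  let ?p = "pt z"
  define c' where "c' = chart_at A ?p"
  define d' where "d' = chart_at B (\<rho> ?p)"
  have c': "c' \<in> A" "?p \<in> chart_dom c'" and d': "d' \<in> B" "\<rho> ?p \<in> chart_dom d'"
    using M.chart_at N.chart_at by (simp_all add: c'_def d'_def)
  let ?L = "differential c' d' \<rho> ?p"
  let ?M = "\<lambda>v. trans_deriv c c' ?p (D\<Phi> z v)" and ?R = "trans_deriv d d' (\<rho> ?p)"
  note Mz = linear_frame[OF z c'] inj_frame[OF z c']
  have R: "linear ?R" "inj ?R"
    using N.linear_trans_deriv[OF d d'(1) pt(3)[OF z] d'(2)] N.inj_trans_deriv[OF d d'(1) pt(3)[OF z] d'(2)] by auto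
  have L: "linear ?L" using \<rho>_has_derivative[OF c'(1) d'(1) c'(2) d'(2)] by (rule has_derivative_linear)
  have Q': "gram (\<lambda>v w. g c' ?p (?M v) (?M w)) = Q z"
    unfolding Q_def M.metric_trans[OF c c'(1) pt(2)[OF z] c'(2)] ..
  have "gram (\<lambda>v w. h d' (\<rho> ?p) (?R v) (?R w)) = gram (h d (\<rho> ?p))"
    unfolding N.metric_trans[OF d d'(1) pt(3)[OF z] d'(2)] ..
  then have H': "det (gram (\<lambda>v w. h d' (\<rho> ?p) (?R v) (?R w))) = N.gdet d (base z)"
    by (simp add: N.gdet_def \<rho>_pt[OF z])
  note fd = fibre_density[OF M.metric_inner[OF c'] N.metric_inner[OF d'] Mz R L differential_lift[OF z c' d']]
  show "normal_jacobian A g B h \<rho> ?p = sqrt (det (\<chi> a b. Q z $ \<kappa> a $ \<kappa> b) / W2 z * N.gdet d (base z))"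
    using fd(1) unfolding Q' H' det_Q[OF z] by (simp add: normal_jacobian_def Let_def c'_def d'_def)
  show "det (\<chi> a b. Q z $ \<kappa> a $ \<kappa> b) > 0" using fd(2) unfolding Q' .
qed

lemma gdet_base_pos: "z \<in> \<Omega> \<Longrightarrow> N.gdet d (base z) > 0"
  by (rule N.gdet_pos[OF d base_in_chart])

lemma normal_jacobian_pos: "p \<in> V \<Longrightarrow> normal_jacobian A g B h \<rho> p > 0"
  using normal_jacobian_pt[OF pt_surj(1)] W2_pos[OF pt_surj(1)] gdet_base_pos[OF pt_surj(1)] pt_surj(2) by simp

lemma continuous_normal_jacobian: "continuous_on V (normal_jacobian A g B h \<rho>)"
proof -
  let ?z = "\<lambda>p. \<Psi> (coord c p)"
  let ?e = "\<lambda>z. sqrt (det (\<chi> a b. Q z $ \<kappa> a $ \<kappa> b) / W2 z * N.gdet d (base z))"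
  have cz: "continuous_on V ?z"
    by (intro continuous_on_compose2[OF continuous_\<Psi>] continuous_on_subset[OF M.continuous_coord[OF c] V(1)]) auto
  have "Cn_on 0 \<Omega> (\<lambda>z. det (\<chi> a b. Q z $ \<kappa> a $ \<kappa> b) / W2 z * N.gdet d (base z))"
  proof (intro Cn_on_mult Cn_on_divide Cn_on_det open_\<Omega>)
    show "Cn_on 0 \<Omega> (\<lambda>z. (\<chi> a b. Q z $ \<kappa> a $ \<kappa> b) $ i $ j)" for i j using Cn_on_le[OF Cn_on_Q, of 0 "\<kappa> i" "\<kappa> j"] by simp
    show "Cn_on 0 \<Omega> W2" by (rule Cn_on_le[OF Cn_on_W2]) simp
    show "Cn_on 0 \<Omega> (\<lambda>z. N.gdet d (base z))"
      by (rule Cn_on_compose[OF open_\<Omega> N.open_chart_image[OF d] N.Cn_on_gdet[OF d] Cn_on_linear[OF bounded_linear_split(1)]])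
        (use base_in_chart in auto)
  qed (use W2_pos in force)
  then have "continuous_on \<Omega> ?e" by (simp add: continuous_on_real_sqrt)
  from continuous_on_compose2[OF this cz] have "continuous_on V (\<lambda>p. ?e (?z p))" using pt_surj(1) by auto
  then show ?thesis
  proof (rule continuous_on_eq)
    show "?e (?z p) = normal_jacobian A g B h \<rho> p" if "p \<in> V" for p
      using normal_jacobian_pt(1)[OF pt_surj(1)[OF that]] pt_surj(2)[OF that] by simp
  qed
qed

end

section \<open>Integrals over the fibres\<close>

context riemannian_submersion
begin

lemma continuous_jacobian: "continuous_on UNIV (normal_jacobian A g B h \<rho>)"
  and jacobian_pos: "normal_jacobian A g B h \<rho> p > 0"
proof -
  have "continuous (at p) (normal_jacobian A g B h \<rho>) \<and> normal_jacobian A g B h \<rho> p > 0" for p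
  proof -
    obtain c d V \<Omega> \<Phi> \<Psi> where p: "p \<in> V" and P: "patch A g B h \<iota> \<kappa> \<rho> n c d V \<Omega> \<Phi> \<Psi>"
      using patch_exists[of p] by (elim exE conjE)
    interpret patch A g B h \<iota> \<kappa> \<rho> n c d V \<Omega> \<Phi> \<Psi> by (rule P)
    show ?thesis
      using continuous_normal_jacobian p open_V normal_jacobian_pos[OF p] by (simp add: continuous_on_eq_continuous_at)
  qed
  then show "continuous_on UNIV (normal_jacobian A g B h \<rho>)" "normal_jacobian A g B h \<rho> p > 0"
    by (simp_all add: continuous_at_imp_continuous_on)
qed

lemma fibre_is_volume: "M.is_volume TYPE('k) (\<rho> -` {l}) (riemannian_volume TYPE('k) A g (\<rho> -` {l}))"
proof (rule M.riemannian_volume_is_volume)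
  fix p assume p: "p \<in> \<rho> -` {l}"
  obtain c d V \<Omega> \<Phi> \<Psi> where pV: "p \<in> V" and P: "patch A g B h \<iota> \<kappa> \<rho> n c d V \<Omega> \<Phi> \<Psi>"
      using patch_exists[of p] by (elim exE conjE)
  interpret patch A g B h \<iota> \<kappa> \<rho> n c d V \<Omega> \<Phi> \<Psi> by (rule P)
  have "l \<in> chart_dom d" using V(2)[OF pV] p by simp
  note par = slice_parametrization(1,2)[OF this]
  have "p \<in> (\<lambda>t. pt (join (coord d l) t)) ` slice (coord d l)" unfolding par(2) using p pV by (rule IntI[rotated])
  with par(1) show "\<exists>W (\<sigma> :: real^'k \<Rightarrow> 'a). local_parametrization A (\<rho> -` {l}) W \<sigma> \<and> p \<in> \<sigma> ` W"
    by (intro exI conjI)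
qed

text \<open>
  Integration over a fibre is integration of the quotient by the normal Jacobian with respect to the
  Riemannian volume of the fibre; the continuity of the Jacobian makes it an admissible density.
\<close>

lemma fibre_density_integral:
  fixes f :: "'a \<Rightarrow> real"
  assumes f: "f \<in> borel_measurable borel"
  defines "q \<equiv> \<lambda>p. inverse (normal_jacobian A g B h \<rho> p) * f p"
  shows "integrable (fibre_measure TYPE('k) A g B h \<rho> l) f \<longleftrightarrow> integrable (riemannian_volume TYPE('k) A g (\<rho> -` {l})) q"
    and "(LINT p|fibre_measure TYPE('k) A g B h \<rho> l. f p) = (LINT p|riemannian_volume TYPE('k) A g (\<rho> -` {l}). q p)"
    and "q \<in> borel_measurable borel"
proof -
  let ?J = "\<lambda>p. inverse (normal_jacobian A g B h \<rho> p)"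
  let ?\<eta> = "riemannian_volume TYPE('k) A g (\<rho> -` {l})"
  have s: "sets ?\<eta> = sets (restrict_space borel (\<rho> -` {l}))" using fibre_is_volume by (simp add: M.is_volume_def)
  have J: "?J \<in> borel_measurable borel"
    using borel_measurable_continuous_onI[OF continuous_jacobian] by simp
  have m: "\<phi> \<in> borel_measurable ?\<eta>" if "\<phi> \<in> borel_measurable borel" for \<phi> :: "'a \<Rightarrow> real"
    by (subst measurable_cong_sets[OF s refl]) (rule measurable_restrict_space1[OF that])
  have nn: "AE p in ?\<eta>. 0 \<le> ?J p" by (rule AE_I2) (simp add: less_imp_le[OF jacobian_pos])
  show "integrable (fibre_measure TYPE('k) A g B h \<rho> l) f \<longleftrightarrow> integrable ?\<eta> q"
    unfolding fibre_measure_def q_def using integrable_density[OF m[OF f] m[OF J] nn] by simp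
  show "(LINT p|fibre_measure TYPE('k) A g B h \<rho> l. f p) = (LINT p|?\<eta>. q p)"
    unfolding fibre_measure_def q_def using integral_density[OF m[OF f] m[OF J] nn] by simp
  show "q \<in> borel_measurable borel" unfolding q_def using J f by simp
qed

lemma space_fibre: "space (fibre_measure TYPE('k) A g B h \<rho> l) = \<rho> -` {l}"
proof -
  have "sets (riemannian_volume TYPE('k) A g (\<rho> -` {l})) = sets (restrict_space borel (\<rho> -` {l}))"
    using fibre_is_volume by (simp add: M.is_volume_def)
  from sets_eq_imp_space_eq[OF this] show ?thesis by (simp add: fibre_measure_def space_restrict_space)
qed

lemma fibre_integral_outside:
  fixes f :: "'a \<Rightarrow> real"
  assumes supp: "\<And>p. p \<in> \<rho> -` {l} \<Longrightarrow> f p = 0"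
  shows "integrable (fibre_measure TYPE('k) A g B h \<rho> l) f" "(LINT p|fibre_measure TYPE('k) A g B h \<rho> l. f p) = 0"
proof -
  have z: "f p = 0" if "p \<in> space (fibre_measure TYPE('k) A g B h \<rho> l)" for p using that supp by (simp add: space_fibre)
  show "integrable (fibre_measure TYPE('k) A g B h \<rho> l) f"
    by (subst Bochner_Integration.integrable_cong[OF refl z]) simp_all
  show "(LINT p|fibre_measure TYPE('k) A g B h \<rho> l. f p) = 0"
    by (subst Bochner_Integration.integral_cong[OF refl z]) simp_all
qed


end

context patch
begin

text \<open>
  The function in adapted coordinates times the density of the total volume. If \<open>f\<close> has compact support
  in the patch, the extension by zero is as regular as on \<open>\<Omega>\<close>.
\<close>

definition coord_fun :: "('a \<Rightarrow> real) \<Rightarrow> real^'m \<Rightarrow> real" where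
  "coord_fun f z = (if z \<in> \<Omega> then f (pt z) * sqrt (W2 z) else 0)"

text \<open>
  The density of the fibre volume divided by the normal Jacobian is the density of the total volume
  divided by that of the base. The latter is constant on the fibre.
\<close>

lemma fibre_integral:
  fixes f :: "'a \<Rightarrow> real"
  assumes f: "f \<in> borel_measurable borel" and supp: "\<And>p. p \<notin> V \<Longrightarrow> f p = 0" and l: "l \<in> chart_dom d"
  defines "y \<equiv> coord d l"
  shows "integrable (fibre_measure TYPE('k) A g B h \<rho> l) f \<longleftrightarrow> integrable lborel (\<lambda>t. coord_fun f (join y t))"
    and "(LINT p|fibre_measure TYPE('k) A g B h \<rho> l. f p) = (LINT t|lborel. coord_fun f (join y t)) / sqrt (N.gdet d y)"
proof -
  let ?\<eta> = "riemannian_volume TYPE('k) A g (\<rho> -` {l})"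
  let ?J = "\<lambda>p. inverse (normal_jacobian A g B h \<rho> p)"
  let ?q = "\<lambda>p. ?J p * f p"
  note par = slice_parametrization[OF l, folded y_def]
  have supp': "?q p = 0" if "p \<in> \<rho> -` {l}" "p \<notin> (\<lambda>t. pt (join y t)) ` slice y" for p
    using that supp by (auto simp: par(2))
  have ip: "integrable ?\<eta> ?q \<longleftrightarrow> integrable lborel (\<lambda>t. indicator (slice y) t * (volume_density A g (\<lambda>t. pt (join y t)) t * ?q (pt (join y t))))"
      "(LINT p|?\<eta>. ?q p) = (LINT t|lborel. indicator (slice y) t * (volume_density A g (\<lambda>t. pt (join y t)) t * ?q (pt (join y t))))"
    by (rule M.integral_in_parametrization[OF fibre_is_volume par(1) fibre_density_integral(3)[OF f]], rule supp', assumption+)+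
  have e: "indicator (slice y) t * (volume_density A g (\<lambda>t. pt (join y t)) t * ?q (pt (join y t)))
      = coord_fun f (join y t) / sqrt (N.gdet d y)" for t
  proof (cases "t \<in> slice y")
    case True
    let ?z = "join y t"
    have z: "?z \<in> \<Omega>" using True by (simp add: slice_def)
    let ?k = "det (\<chi> a b. Q ?z $ \<kappa> a $ \<kappa> b)"
    have pos: "?k > 0" "W2 ?z > 0" "N.gdet d y > 0"
      using normal_jacobian_pt(2)[OF z] W2_pos[OF z] gdet_base_pos[OF z] by simp_all
    have e: "sqrt ?k * inverse (sqrt (?k / W2 ?z * N.gdet d y)) = sqrt (W2 ?z) / sqrt (N.gdet d y)"
      using pos by (simp add: real_sqrt_mult real_sqrt_divide divide_simps)
    have "volume_density A g (\<lambda>t. pt (join y t)) t * ?q (pt (join y t)) =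
        sqrt ?k * inverse (sqrt (?k / W2 ?z * N.gdet d y)) * f (pt ?z)"
      by (simp only: par(3)[OF True] normal_jacobian_pt(1)[OF z] base_join mult.assoc)
    also have "\<dots> = coord_fun f ?z / sqrt (N.gdet d y)" unfolding e using z by (simp add: coord_fun_def)
    finally show ?thesis using True by simp
  next
    case False
    then show ?thesis by (simp add: coord_fun_def slice_def)
  qed
  show "(LINT p|fibre_measure TYPE('k) A g B h \<rho> l. f p) = (LINT t|lborel. coord_fun f (join y t)) / sqrt (N.gdet d y)"
    unfolding fibre_density_integral(2)[OF f] ip(2) e by simp
  show "integrable (fibre_measure TYPE('k) A g B h \<rho> l) f \<longleftrightarrow> integrable lborel (\<lambda>t. coord_fun f (join y t))"
  proof (cases "N.gdet d y > 0")
    case True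
    then have "inverse (sqrt (N.gdet d y)) \<noteq> 0" by simp
    then show ?thesis
      unfolding fibre_density_integral(1)[OF f] ip(1) e divide_inverse by (simp only: integrable_mult_right_iff simp_thms)
  next
    case False
    have "y \<in> coord d ` chart_dom d" using l by (simp add: y_def)
    then show ?thesis using N.gdet_pos[OF d] False by blast
  qed
qed

end

section \<open>The normal lift\<close>

context patch
begin

text \<open>
  In adapted coordinates the lift of \<open>X\<close> is the solution \<open>u\<close> of a linear system: its base
  components are those of \<open>X\<close>, and \<open>Q u\<close> vanishes on the fibre directions.
\<close>

definition lift_matrix :: "real^'m \<Rightarrow> real^'m^'m" where
  "lift_matrix z = (\<chi> i j. if i \<in> range \<iota> then mat 1 $ i $ j else Q z $ i $ j)"

lemma det_lift_matrix:
  assumes "z \<in> \<Omega>" shows "det (lift_matrix z) \<noteq> 0"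
proof -
  have "det (transpose (lift_matrix z)) = det (\<chi> a b. transpose (lift_matrix z) $ \<kappa> a $ \<kappa> b)"
  proof (rule det_unit_columns[OF inj_\<kappa>])
    fix i j assume "j \<notin> range \<kappa>"
    then have "j \<in> range \<iota>" by (cases j rule: index_cases) auto
    then show "transpose (lift_matrix z) $ i $ j = (if i = j then 1 else 0)"
      by (auto simp: transpose_def lift_matrix_def mat_def)
  qed
  also have "(\<chi> a b. transpose (lift_matrix z) $ \<kappa> a $ \<kappa> b) = transpose (\<chi> a b. Q z $ \<kappa> a $ \<kappa> b)"
    by (simp add: transpose_def lift_matrix_def)
  finally show ?thesis using normal_jacobian_pt(2)[OF assms] by (simp only: det_transpose)
qed

definition lift :: "('b, 'n) vfield \<Rightarrow> real^'m \<Rightarrow> real^'m" where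
  "lift X z = matrix_inv (lift_matrix z) *v join (X d (\<rho> (pt z))) 0"

lemma lift_system:
  assumes "z \<in> \<Omega>"
  shows "lift_matrix z *v lift X z = join (X d (\<rho> (pt z))) 0"
    and "base (lift X z) = X d (\<rho> (pt z))" and "(Q z *v lift X z) $ \<kappa> b = 0"
proof -
  have "invertible (lift_matrix z)" using det_lift_matrix[OF assms] invertible_det_nz by blast
  then have "lift_matrix z ** matrix_inv (lift_matrix z) = mat 1"
    unfolding matrix_inv_def invertible_def by (rule someI_ex[THEN conjunct1])
  then show eq: "lift_matrix z *v lift X z = join (X d (\<rho> (pt z))) 0"
    by (simp add: lift_def matrix_vector_mul_assoc)
  have "(lift_matrix z *v u) $ \<iota> a = (mat 1 *v u) $ \<iota> a" for u a
    by (simp add: matrix_vector_mult_def lift_matrix_def)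
  then have "lift X z $ \<iota> a = X d (\<rho> (pt z)) $ a" for a
    using arg_cong[OF eq, of "\<lambda>v. v $ \<iota> a"] by simp
  then show "base (lift X z) = X d (\<rho> (pt z))" by (simp add: base_def vec_eq_iff)
  have "(lift_matrix z *v u) $ \<kappa> b = (Q z *v u) $ \<kappa> b" for u
    by (simp add: matrix_vector_mult_def lift_matrix_def)
  then show "(Q z *v lift X z) $ \<kappa> b = 0" using arg_cong[OF eq, of "\<lambda>v. v $ \<kappa> b"] by simp
qed

text \<open>
  A vector whose base components vanish is tangent to the fibre, and \<open>Q\<close> represents the metric. So the
  equations for \<open>lift X\<close> say that its image under $D\Phi$ is orthogonal to the fibre and is mapped to \<open>X\<close>.
\<close>

lemma normal_lift_pt:
  assumes X: "transforms B X" and z: "z \<in> \<Omega>" and c': "c' \<in> A" "pt z \<in> chart_dom c'"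
  shows "normal_lift g B \<rho> X c' (pt z) = trans_deriv c c' (pt z) (D\<Phi> z (lift X z))"
proof -
  let ?p = "pt z"
  define d' where "d' = chart_at B (\<rho> ?p)"
  have d': "d' \<in> B" "\<rho> ?p \<in> chart_dom d'" using N.chart_at by (simp_all add: d'_def)
  let ?L = "differential c' d' \<rho> ?p" and ?M = "\<lambda>v. trans_deriv c c' ?p (D\<Phi> z v)"
  let ?u = "lift X z"
  have \<alpha>: "inner_form (g c' ?p)" by (rule M.metric_inner[OF c'])
  then have bil: "bilinear (g c' ?p)" by (simp add: inner_form_def)
  have L: "linear ?L" using \<rho>_has_derivative[OF c'(1) d'(1) c'(2) d'(2)] by (rule has_derivative_linear)
  note Mz = linear_frame[OF z c'] inj_frame[OF z c']
  have LM: "?L (?M v) = trans_deriv d d' (\<rho> ?p) (base v)" for v by (rule differential_lift[OF z c' d'])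
  have Q': "gram (\<lambda>v w. g c' ?p (?M v) (?M w)) = Q z"
    unfolding Q_def M.metric_trans[OF c c'(1) pt(2)[OF z] c'(2)] ..
  have \<alpha>Q: "g c' ?p (?M v) (?M w) = v \<bullet> (Q z *v w)" for v w
    unfolding Q'[symmetric] by (rule gram_mult[OF bilinear_pullback[OF bil Mz(1)]])
  have orth: "g c' ?p (?M ?u) w = 0" if w: "?L w = 0" for w
  proof -
    obtain w' where w': "w = ?M w'" using linear_injective_imp_surjective[OF Mz] by blast
    have "base w' = 0"
      using w N.inj_trans_deriv[OF d d'(1) pt(3)[OF z] d'(2)] N.linear_trans_deriv[OF d d'(1) pt(3)[OF z] d'(2)]
      unfolding w' LM by (simp add: linear_injective_0)
    then have "w' $ \<iota> a = 0" for a by (simp add: base_def vec_eq_iff)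
    then have "w' \<bullet> (Q z *v ?u) = 0"
      using lift_system(3)[OF z] by (simp add: inner_vec_def sum_split)
    then have "g c' ?p w (?M ?u) = 0" unfolding w' \<alpha>Q .
    then show ?thesis using \<alpha> by (simp add: inner_form_def)
  qed
  have val: "?L (?M ?u) = X d' (\<rho> ?p)"
    unfolding LM lift_system(2)[OF z] by (rule transformsD[OF X d d'(1) pt(3)[OF z] d'(2), symmetric])
  show ?thesis
    unfolding normal_lift_def Let_def d'_def[symmetric]
  proof (rule the_equality)
    show "(\<forall>w. ?L w = 0 \<longrightarrow> g c' ?p (?M ?u) w = 0) \<and> ?L (?M ?u) = X d' (\<rho> ?p)" using orth val by simp
  next
    fix v assume v: "(\<forall>w. ?L w = 0 \<longrightarrow> g c' ?p v w = 0) \<and> ?L v = X d' (\<rho> ?p)"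
    let ?w = "v - ?M ?u"
    have "?L ?w = 0" using v val by (simp add: linear_diff[OF L])
    then have "g c' ?p v ?w = 0" "g c' ?p (?M ?u) ?w = 0" using v orth by blast+
    then have "g c' ?p ?w ?w = 0" by (simp only: bilinear_lsub[OF bil, of v "?M ?u" ?w])
    then have "?w = 0" using \<alpha> unfolding inner_form_def by (metis less_irrefl)
    then show "v = ?M ?u" by simp
  qed
qed

lemma normal_lift_chart:
  assumes X: "transforms B X" and z: "z \<in> \<Omega>"
  shows "normal_lift g B \<rho> X c (pt z) = D\<Phi> z (lift X z)"
  using normal_lift_pt[OF X z c pt(2)[OF z]] M.trans_deriv_self[OF c pt(2)[OF z]] by simp

lemma Cn_on_lift:
  assumes X: "smooth_vector_field B X"
  shows "Cn_on n \<Omega> (lift X)"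
proof (rule Cn_on_linear_system[OF open_\<Omega>])
  have "Cn_on n (coord d ` chart_dom d) (\<lambda>y. X d (chart_inv d y))"
    by (rule smooth_vector_fieldD(2)[OF X d])
  then have "Cn_on n \<Omega> (\<lambda>z. X d (chart_inv d (base z)))"
    by (rule Cn_on_compose[OF open_\<Omega> N.open_chart_image[OF d] _ Cn_on_linear[OF bounded_linear_split(1)]])
      (use base_in_chart in auto)
  then have "Cn_on n \<Omega> (\<lambda>z. X d (\<rho> (pt z)))" by (rule Cn_on_cong[OF open_\<Omega>, rotated]) (simp add: \<rho>_pt)
  then show "Cn_on n \<Omega> (\<lambda>z. join (X d (\<rho> (pt z))) 0)" by (rule Cn_on_join[OF open_\<Omega> _ Cn_on_const])
  show "Cn_on n \<Omega> (\<lambda>z. lift_matrix z $ i $ j)" for i j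
    using Cn_on_Q[of i j] by (cases "i \<in> range \<iota>") (simp_all add: lift_matrix_def)
qed (use det_lift_matrix lift_system(1) in auto)

lemma Cn_on_normal_lift:
  assumes X: "smooth_vector_field B X"
  shows "Cn_on n (coord c ` V) (\<lambda>x. normal_lift g B \<rho> X c (chart_inv c x))"
proof -
  have tX: "transforms B X" by (rule smooth_vector_fieldD(1)[OF X])
  have oV: "open (coord c ` V)" by (rule M.open_coord_image[OF c open_V V(1)])
  have \<Psi>n: "Cn_on n (coord c ` V) \<Psi>" by (rule Cn_on_SucD[OF \<Psi>])
  have im: "\<Psi> ` coord c ` V \<subseteq> \<Omega>" using \<Psi>_image by auto
  have "Cn_on n \<Omega> (\<lambda>z. \<Sum>i\<in>UNIV. (lift X z $ i) *\<^sub>R D\<Phi> z (axis i 1))"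
    by (intro Cn_on_sum Cn_on_scaleR open_\<Omega> Cn_on_nth[OF open_\<Omega> Cn_on_lift[OF X]] Cn_on_D\<Phi>)
  from Cn_on_compose[OF oV open_\<Omega> this \<Psi>n im] show ?thesis
  proof (rule Cn_on_cong[OF oV, rotated])
    fix x assume x: "x \<in> coord c ` V"
    then have z: "\<Psi> x \<in> \<Omega>" "\<Phi> (\<Psi> x) = x" using \<Psi>_image \<Phi>_\<Psi> by auto
    show "(\<Sum>i\<in>UNIV. (lift X (\<Psi> x) $ i) *\<^sub>R D\<Phi> (\<Psi> x) (axis i 1)) = normal_lift g B \<rho> X c (chart_inv c x)"
      using normal_lift_chart[OF tX z(1)] linear_axis_expansion[OF linear_D\<Phi>[OF z(1)], of "lift X (\<Psi> x)"] z(2) by simp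
  qed
qed

end

text \<open>
  In each chart the lift is the image of the same coordinate vector \<open>lift X\<close>.
\<close>

lemma (in riemannian_submersion) transforms_normal_lift:
  assumes X: "transforms B X"
  shows "transforms A (normal_lift g B \<rho> X)"
  unfolding transforms_def
proof (intro ballI)
  fix c' d' p assume cd: "c' \<in> A" "d' \<in> A" "p \<in> chart_dom c' \<inter> chart_dom d'"
  obtain c d V \<Omega> \<Phi> \<Psi> where p: "p \<in> V" and P: "patch A g B h \<iota> \<kappa> \<rho> n c d V \<Omega> \<Phi> \<Psi>"
    using patch_exists[of p] by (elim exE conjE)
  interpret patch A g B h \<iota> \<kappa> \<rho> n c d V \<Omega> \<Phi> \<Psi> by (rule P)
  let ?z = "\<Psi> (coord c p)"
  have z: "?z \<in> \<Omega>" "pt ?z = p" using pt_surj[OF p] by auto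
  have nl: "normal_lift g B \<rho> X e p = trans_deriv c e p (D\<Phi> ?z (lift X ?z))" if "e \<in> A" "p \<in> chart_dom e" for e
    using normal_lift_pt[OF X z(1), of e] that unfolding z(2) .
  have "p \<in> chart_dom c" using p V(1) by blast
  then show "normal_lift g B \<rho> X d' p = trans_deriv c' d' p (normal_lift g B \<rho> X c' p)"
    using nl cd M.trans_deriv_compose[OF c cd(1,2)] by simp
qed

lemma (in riemannian_submersion) normal_lift_differentiable:
  assumes n: "Suc 0 \<le> n" and X: "smooth_vector_field B X" and c: "c \<in> A" "p \<in> chart_dom c"
  shows "(\<lambda>x. normal_lift g B \<rho> X c (chart_inv c x)) differentiable (at (coord c p))"
proof -
  obtain V \<Omega> \<Phi> \<Psi> where p: "p \<in> V" and P: "patch A g B h \<iota> \<kappa> \<rho> n c (chart_at B (\<rho> p)) V \<Omega> \<Phi> \<Psi>"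
    using patch_exists_charts[OF c N.chart_at] by (elim exE conjE)
  interpret patch A g B h \<iota> \<kappa> \<rho> n c "chart_at B (\<rho> p)" V \<Omega> \<Phi> \<Psi> by (rule P)
  have "Cn_on (Suc 0) (coord c ` V) (\<lambda>x. normal_lift g B \<rho> X c (chart_inv c x))"
    by (rule Cn_on_le[OF Cn_on_normal_lift[OF X] n])
  then show ?thesis using p by auto
qed

section \<open>Functions supported in a patch\<close>

locale patch_function = patch A g B h \<iota> \<kappa> \<rho> n c d V \<Omega> \<Phi> \<Psi>
  for A :: "('a::{t2_space, second_countable_topology}, 'm::finite) chart set" and g
    and B :: "('b::{t2_space, second_countable_topology}, 'n::finite) chart set" and h
    and \<iota> :: "'n \<Rightarrow> 'm" and \<kappa> :: "'k::finite \<Rightarrow> 'm" and \<rho> n c d V \<Omega> \<Phi> \<Psi> +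
  fixes f :: "'a \<Rightarrow> real" and C
  assumes f: "Cn_fun n A f" and C: "compact C" "C \<subseteq> V" "\<And>p. p \<notin> C \<Longrightarrow> f p = 0"
begin

text \<open>
  A compact set of adapted coordinates that contains the support of \<open>f\<close>.
\<close>

definition K where "K = \<Psi> ` coord c ` C"

lemma K: "compact K" "z \<in> \<Omega> \<Longrightarrow> z \<notin> K \<Longrightarrow> f (pt z) = 0" "z \<notin> K \<Longrightarrow> coord_fun f z = 0"
proof -
  have "compact (coord c ` C)"
    by (rule compact_continuous_image[OF continuous_on_subset[OF M.continuous_coord[OF c]] C(1)]) (use C(2) V(1) in auto)
  then show "compact K" unfolding K_def
    by (rule compact_continuous_image[OF continuous_on_subset[OF continuous_\<Psi>], rotated]) (use C(2) in auto)
  show 1: "f (pt z) = 0" if "z \<in> \<Omega>" "z \<notin> K" for z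
  proof (rule C(3), rule notI)
    assume "pt z \<in> C"
    then have "\<Psi> (coord c (pt z)) \<in> K" unfolding K_def by blast
    then show False using that pt(4) \<Psi>_\<Phi> by simp
  qed
  show "z \<notin> K \<Longrightarrow> coord_fun f z = 0" using 1 by (simp add: coord_fun_def)
qed

lemma K_subset: "K \<subseteq> \<Omega>"
  unfolding K_def using \<Psi>_image C(2) by auto

text \<open>
  A function on \<open>\<Omega>\<close> with support in \<open>K\<close> is regular on all of the coordinate space, since \<open>\<Omega>\<close> and the
  complement of \<open>K\<close> are open and cover it.
\<close>

lemma extend_by_zero:
  assumes q: "Cn_on k \<Omega> q" and z: "\<And>z. z \<notin> K \<Longrightarrow> q z = 0"
  shows "Cn_on k UNIV q"
proof (rule Cn_on_local)
  fix z :: "real^'m"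
  show "\<exists>T. open T \<and> z \<in> T \<and> Cn_on k T q"
  proof (cases "z \<in> K")
    case True
    then show ?thesis using q open_\<Omega> K_subset by blast
  next
    case False
    have o: "open (- K)" using K(1) by (simp add: compact_imp_closed open_Compl)
    have "Cn_on k (- K) q" by (rule Cn_on_cong[OF o _ Cn_on_const[of _ _ 0]]) (simp add: z)
    then show ?thesis using o False by blast
  qed
qed

lemma Cn_on_f_pt: "Cn_on n \<Omega> (\<lambda>z. f (pt z))"
  by (rule Cn_on_compose[OF open_\<Omega> M.open_chart_image[OF c] _ Cn_on_\<Phi>])
    (use f c \<Phi>_in_chart in \<open>auto simp: Cn_fun_def\<close>)

lemma Cn_on_coord_fun: "Cn_on n UNIV (coord_fun f)"
proof (rule extend_by_zero)
  have "Cn_on n \<Omega> (\<lambda>z. f (pt z) * sqrt (W2 z))"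
    by (intro Cn_on_mult Cn_on_sqrt open_\<Omega> Cn_on_f_pt Cn_on_W2 W2_pos)
  then show "Cn_on n \<Omega> (coord_fun f)" by (rule Cn_on_cong[OF open_\<Omega>, rotated]) (simp add: coord_fun_def)
qed (rule K(3))

text \<open>
  The integral over the fibre, up to the density of the volume of the base.
\<close>

definition I :: "real^'n \<Rightarrow> real" where "I y = (LINT t|lborel. coord_fun f (join y t))"

lemma compact_fib_K: "compact (fib ` K)"
  by (rule compact_continuous_image[OF linear_continuous_on[OF bounded_linear_split(2)] K(1)])

lemma supp_join: "t \<notin> fib ` K \<Longrightarrow> join y t \<notin> K"
  by (metis fib_join image_eqI)

lemma Cn_on_coord_fun_join: "Cn_on n UNIV (\<lambda>p. coord_fun f (join (fst p) (snd p)))"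
  by (rule Cn_on_compose[OF open_UNIV open_UNIV Cn_on_coord_fun Cn_on_linear])
    (use linear_join in \<open>simp_all add: linear_conv_bounded_linear\<close>)

lemma Cn_on_I: "Cn_on n UNIV I"
  unfolding I_def[abs_def]
  using Cn_on_param_integral[OF compact_fib_K _ Cn_on_coord_fun_join] K(3)[OF supp_join] by simp

lemma f_measurable: "f \<in> borel_measurable borel"
  by (rule borel_measurable_continuous_onI[OF M.Cn_fun_continuous[OF f]])

lemma f_outside: "l \<notin> \<rho> ` C \<Longrightarrow> p \<in> \<rho> -` {l} \<Longrightarrow> f p = 0"
  using C(3) by (metis imageI vimage_singleton_eq)

lemma fibre_integral_eq_I:
  assumes "l \<in> chart_dom d"
  shows "(LINT p|fibre_measure TYPE('k) A g B h \<rho> l. f p) = I (coord d l) / sqrt (N.gdet d (coord d l))"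
  unfolding I_def by (rule fibre_integral(2)[OF f_measurable _ assms]) (use C in auto)

lemma compact_\<rho>C: "compact (\<rho> ` C)" "\<rho> ` C \<subseteq> chart_dom d"
  by (rule compact_continuous_image[OF continuous_on_subset[OF continuous_\<rho>] C(1)]) (use C(2) V(2) in auto)

lemma fibre_integrable: "integrable (fibre_measure TYPE('k) A g B h \<rho> l) f"
proof (cases "l \<in> chart_dom d")
  case True
  have "continuous_on UNIV (\<lambda>t. coord_fun f (join (coord d l) t))"
    by (rule continuous_on_compose2[OF Cn_on_continuous_on[OF Cn_on_coord_fun]])
      (auto intro!: continuous_at_imp_continuous_on has_derivative_continuous[OF has_derivative_join(1)])
  then have "integrable lborel (\<lambda>t. coord_fun f (join (coord d l) t))"
    by (rule compact_support_integrable[OF _ compact_fib_K]) (rule K(3)[OF supp_join])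
  then show ?thesis
    by (subst fibre_integral(1)[OF f_measurable _ True]) (use C in auto)
next
  case False
  then have "l \<notin> \<rho> ` C" using compact_\<rho>C(2) by blast
  from f_outside[OF this] show ?thesis by (rule fibre_integral_outside(1))
qed

lemma patch_fibre_integral_Cn:
  "Cn_fun n B (\<lambda>l. LINT p|fibre_measure TYPE('k) A g B h \<rho> l. f p)"
proof (rule N.Cn_fun_localI)
  fix l
  let ?F = "\<lambda>l. LINT p|fibre_measure TYPE('k) A g B h \<rho> l. f p"
  show "\<exists>d\<in>B. \<exists>V. open V \<and> l \<in> V \<and> V \<subseteq> chart_dom d \<and> Cn_on n (coord d ` V) (\<lambda>y. ?F (chart_inv d y))"
  proof (cases "l \<in> \<rho> ` C")
    case True
    note o = N.open_chart_image[OF d]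
    have "Cn_on n (coord d ` chart_dom d) (\<lambda>y. I y / sqrt (N.gdet d y))"
      by (intro Cn_on_divide Cn_on_sqrt o Cn_on_subset[OF Cn_on_I] N.Cn_on_gdet[OF d] N.gdet_pos[OF d])
        (use N.gdet_pos[OF d] in \<open>force+\<close>)
    then have "Cn_on n (coord d ` chart_dom d) (\<lambda>y. ?F (chart_inv d y))"
      by (rule Cn_on_cong[OF o, rotated])
        (simp add: fibre_integral_eq_I[OF N.chart_inv_in_dom[OF d]] N.coord_chart_inv[OF d])
    then show ?thesis using True compact_\<rho>C(2) d N.open_chart_dom[OF d] by blast
  next
    case False
    have "?F l' = 0" if "l' \<notin> \<rho> ` C" for l'
      by (rule fibre_integral_outside(2)) (rule f_outside[OF that])
    from N.locally_zero(1)[OF compact_imp_closed[OF compact_\<rho>C(1)] this False] show ?thesis .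
  qed
qed

end

section \<open>The derivative of a fibre integral\<close>

context patch_function
begin

lemma frechet_outside_K:
  fixes q :: "real^'m \<Rightarrow> real"
  assumes "\<And>z. z \<notin> K \<Longrightarrow> q z = 0" "z \<notin> K"
  shows "frechet_derivative q (at z) v = 0"
proof -
  have o: "open (- K)" using K(1) by (simp add: compact_imp_closed open_Compl)
  have "(q has_derivative (\<lambda>v. 0)) (at z)"
    by (rule has_derivative_transform_within_open[OF has_derivative_const o]) (use assms in auto)
  from frechet_derivative_at[OF this] show ?thesis by metis
qed

lemma join_integrand:
  assumes q: "Cn_on k UNIV q" and z: "\<And>z. z \<notin> K \<Longrightarrow> q z = (0::real)"
  shows "integrable lborel (\<lambda>t. q (join y t))"
proof (rule compact_support_integrable[OF _ compact_fib_K])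
  show "continuous_on UNIV (\<lambda>t. q (join y t))"
    by (rule continuous_on_compose2[OF Cn_on_continuous_on[OF q]])
      (auto intro!: continuous_at_imp_continuous_on has_derivative_continuous[OF has_derivative_join(1)])
  show "q (join y t) = 0" if "t \<notin> fib ` K" for t using z supp_join[OF that] by blast
qed

text \<open>The divergence theorem on the fibre.\<close>

lemma integral_fibre_derivative_eq_0:
  assumes q: "Cn_on (Suc 0) UNIV q" and z: "\<And>z. z \<notin> K \<Longrightarrow> q z = (0::real)"
  shows "(LINT t|lborel. frechet_derivative q (at (join y t)) (join 0 v)) = 0"
proof -
  have dq: "(q has_derivative frechet_derivative q (at z)) (at z)" for z using Cn_on_has_derivative[OF q] by simp
  have "((\<lambda>t. q (join y t)) has_derivative (\<lambda>v. frechet_derivative q (at (join y t)) (join 0 v))) (at t)" for t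
    by (rule has_derivative_compose[OF has_derivative_join(1) dq])
  from frechet_derivative_at[OF this]
  have e: "frechet_derivative q (at (join y t)) (join 0 v) = frechet_derivative (\<lambda>t. q (join y t)) (at t) v" for t
    by metis
  show ?thesis unfolding e
  proof (rule integral_directional_derivative_eq_0[OF _ compact_fib_K])
    show "Cn_on (Suc 0) UNIV (\<lambda>t. q (join y t))"
      by (rule Cn_on_compose[OF open_UNIV open_UNIV q Cn_on_join[OF open_UNIV Cn_on_const Cn_on_ident]]) simp
    show "q (join y t) = 0" if "t \<notin> fib ` K" for t using z supp_join[OF that] by blast
  qed
qed

context
  fixes X :: "('b, 'n) vfield"
  assumes n: "Suc 0 \<le> n" and X: "smooth_vector_field B X"
begin

abbreviation "Y \<equiv> normal_lift g B \<rho> X"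
abbreviation "U \<equiv> lift X"
abbreviation "\<phi> \<equiv> coord_fun f"

text \<open>
  The part of the integrand of the derivative formula in which \<open>f\<close> and \<open>X\<close> enter through the lift.
\<close>

definition integrand :: "'a \<Rightarrow> real" where
  "integrand p = derivative_along A Y f p + divergence A (volume_form g) Y p * f p"

lemma tX: "transforms B X" by (rule smooth_vector_fieldD(1)[OF X])

lemma tY: "transforms A Y" by (rule transforms_normal_lift[OF tX])

lemma \<phi>_C1: "Cn_on (Suc 0) UNIV \<phi>" by (rule Cn_on_le[OF Cn_on_coord_fun n])

lemma U_C1: "Cn_on (Suc 0) \<Omega> U" by (rule Cn_on_le[OF Cn_on_lift[OF X] n])

lemma d\<phi>: "(\<phi> has_derivative frechet_derivative \<phi> (at z)) (at z)"
  using Cn_on_has_derivative[OF \<phi>_C1] by simp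

lemma dU: "z \<in> \<Omega> \<Longrightarrow> (U has_derivative frechet_derivative U (at z)) (at z)"
  by (rule Cn_on_has_derivative[OF U_C1])

lemma f_chart_derivative:
  "z \<in> \<Omega> \<Longrightarrow> ((\<lambda>x. f (chart_inv c x)) has_derivative frechet_derivative (\<lambda>x. f (chart_inv c x)) (at (\<Phi> z))) (at (\<Phi> z))"
proof -
  assume z: "z \<in> \<Omega>"
  have "Cn_on (Suc 0) (coord c ` chart_dom c) (\<lambda>x. f (chart_inv c x))"
    by (rule Cn_on_le[OF _ n]) (use f c in \<open>simp add: Cn_fun_def\<close>)
  then show ?thesis by (rule Cn_on_has_derivative) (rule \<Phi>_in_chart[OF z])
qed

lemma integrand_outside: "p \<notin> C \<Longrightarrow> integrand p = 0"
  using M.locally_zero(2)[OF compact_imp_closed[OF C(1)] C(3)] C(3) by (simp add: integrand_def)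

text \<open>
  In adapted coordinates the lift is the field \<open>U\<close>. The divergence is carried over by
  \<open>coord_div_pullback\<close>, which requires \<open>\<Phi>\<close> and hence \<open>\<rho>\<close> to be of class $C^2$.
\<close>

lemma integrand_pt:
  assumes z: "z \<in> \<Omega>"
  shows "integrand (pt z) = frechet_derivative (\<lambda>z. f (pt z)) (at z) (U z) + coord_div W2 U z * f (pt z)"
proof -
  let ?f = "\<lambda>x. f (chart_inv c x)" and ?Y = "\<lambda>x. Y c (chart_inv c x)"
  have Yz: "Y c (pt x) = D\<Phi> x (U x)" if "x \<in> \<Omega>" for x by (rule normal_lift_chart[OF tX that])
  have "((\<lambda>z. f (pt z)) has_derivative (\<lambda>v. frechet_derivative ?f (at (\<Phi> z)) (D\<Phi> z v))) (at z)"
    by (rule has_derivative_compose[OF \<Phi>_has_derivative[OF z] f_chart_derivative[OF z]])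
  from frechet_derivative_at[OF this, symmetric]
  have "frechet_derivative (\<lambda>z. f (pt z)) (at z) (U z) = frechet_derivative ?f (at (\<Phi> z)) (D\<Phi> z (U z))" by simp
  moreover have "derivative_along A Y f (pt z) = frechet_derivative ?f (at (\<Phi> z)) (Y c (pt z))"
    using M.derivative_along_chart[OF c pt(2)[OF z] tY] f_chart_derivative[OF z] pt(4)[OF z]
    by (simp add: differentiableI)
  moreover have "divergence A (volume_form g) Y (pt z) = coord_div (M.gdet c) ?Y (\<Phi> z)"
    using M.divergence_chart[OF c pt(2)[OF z] tY normal_lift_differentiable[OF n X]] pt(4)[OF z] by simp
  moreover have "coord_div W2 U z = coord_div (M.gdet c) ?Y (\<Phi> z)"
  proof (rule coord_div_pullback[OF open_\<Omega> z])
    show "Cn_on (Suc (Suc 0)) \<Omega> \<Phi>" using n by (intro Cn_on_le[OF \<Phi>]) simp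
    show "det (matrix (D\<Phi> z)) \<noteq> 0" by (rule det_D\<Phi>[OF z])
    show "M.gdet c differentiable (at (\<Phi> z))"
      by (rule differentiableI[OF Cn_on_has_derivative[OF M.Cn_on_gdet[OF c] \<Phi>_in_chart[OF z]]])
    show "M.gdet c (\<Phi> z) \<noteq> 0" using M.gdet_pos[OF c \<Phi>_in_chart[OF z]] by simp
    show "?Y differentiable (at (\<Phi> z))"
      using normal_lift_differentiable[OF n X c pt(2)[OF z]] pt(4)[OF z] by simp
    show "U differentiable (at z)" using dU[OF z] by (rule differentiableI)
  qed (simp_all add: Yz W2_def)
  ultimately show ?thesis by (simp add: integrand_def Yz[OF z])
qed

text \<open>
  Let $W$ be \<open>W2\<close>. Multiplied with the density $W^{1/2}$ the expression $U(f) + f W^{-1/2} \operatorname{div}(W^{1/2} U)$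
  becomes $\operatorname{div}(W^{1/2} f U)$.
\<close>

lemma coord_fun_integrand:
  assumes z: "z \<in> \<Omega>"
  shows "coord_fun integrand z = frechet_derivative \<phi> (at z) (U z) + \<phi> z * tr (frechet_derivative U (at z))"
proof -
  let ?F = "\<lambda>z. f (pt z)"
  have dF: "(?F has_derivative frechet_derivative ?F (at z)) (at z)"
    by (rule Cn_on_has_derivative[OF Cn_on_le[OF Cn_on_f_pt n] z])
  have dW: "(W2 has_derivative frechet_derivative W2 (at z)) (at z)"
    by (rule Cn_on_has_derivative[OF Cn_on_le[OF Cn_on_W2 n] z])
  have pos: "W2 z > 0" by (rule W2_pos[OF z])
  from has_derivative_mult[OF dF has_derivative_sqrt[OF dW pos]]
  have "(\<phi> has_derivative (\<lambda>v. ?F z * (inverse (sqrt (W2 z)) / 2 * frechet_derivative W2 (at z) v)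
      + frechet_derivative ?F (at z) v * sqrt (W2 z))) (at z)"
    by (rule has_derivative_transform_within_open[OF _ open_\<Omega> z]) (simp add: coord_fun_def)
  from frechet_derivative_at[OF this, symmetric]
  have "frechet_derivative \<phi> (at z) (U z) =
    ?F z * (inverse (sqrt (W2 z)) / 2 * frechet_derivative W2 (at z) (U z)) + frechet_derivative ?F (at z) (U z) * sqrt (W2 z)"
    by simp
  moreover have "(e + (w / (2 * (s * s)) + t) * a) * s = a * (inverse s / 2 * w) + e * s + a * s * t"
    if "s > 0" for e w s t a :: real
    using that by (simp add: field_simps)
  from this[of "sqrt (W2 z)"] pos
  have "(frechet_derivative ?F (at z) (U z) + coord_div W2 U z * ?F z) * sqrt (W2 z) =
    ?F z * (inverse (sqrt (W2 z)) / 2 * frechet_derivative W2 (at z) (U z)) + frechet_derivative ?F (at z) (U z) * sqrt (W2 z)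
    + ?F z * sqrt (W2 z) * tr (frechet_derivative U (at z))"
    unfolding coord_div_def by simp
  ultimately show ?thesis
    using z by (simp add: coord_fun_def integrand_pt)
qed

lemma integrand_measurable: "integrand \<in> borel_measurable borel"
proof -
  let ?e = "\<lambda>z. (\<Sum>i\<in>UNIV. U z $ i * frechet_derivative \<phi> (at z) (axis i 1)) + \<phi> z * (\<Sum>i\<in>UNIV. frechet_derivative U (at z) (axis i 1) $ i)"
  have "continuous_on \<Omega> (\<lambda>z. frechet_derivative U (at z) v)" for v
    using Cn_on_continuous_on[OF Cn_on_frechet[OF U_C1]] .
  moreover have "continuous_on \<Omega> (\<lambda>z. frechet_derivative \<phi> (at z) v)" for v
    using continuous_on_subset[OF Cn_on_continuous_on[OF Cn_on_frechet[OF \<phi>_C1]] subset_UNIV] .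
  moreover have "continuous_on \<Omega> U" "continuous_on \<Omega> \<phi>" "continuous_on \<Omega> W2"
    using Cn_on_continuous_on[OF U_C1] continuous_on_subset[OF Cn_on_continuous_on[OF \<phi>_C1] subset_UNIV]
      Cn_on_continuous_on[OF Cn_on_W2] by auto
  ultimately have "continuous_on \<Omega> (\<lambda>z. ?e z / sqrt (W2 z))"
    by (intro continuous_intros continuous_on_component) (auto dest: W2_pos)
  moreover have "continuous_on V (\<lambda>p. \<Psi> (coord c p))"
    by (intro continuous_on_compose2[OF continuous_\<Psi>] continuous_on_subset[OF M.continuous_coord[OF c] V(1)]) auto
  ultimately have "continuous_on V (\<lambda>p. ?e (\<Psi> (coord c p)) / sqrt (W2 (\<Psi> (coord c p))))"
    by (rule continuous_on_compose2) (use pt_surj(1) in auto)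
  then have "continuous_on V integrand"
  proof (rule continuous_on_eq)
    fix p assume p: "p \<in> V"
    let ?z = "\<Psi> (coord c p)"
    have z: "?z \<in> \<Omega>" "pt ?z = p" using pt_surj[OF p] by auto
    have "linear (frechet_derivative \<phi> (at ?z))" using d\<phi> by (rule has_derivative_linear)
    from linear_axis_expansion[OF this, of "U ?z"]
    have "?e ?z = coord_fun integrand ?z" by (simp add: coord_fun_integrand[OF z(1)] tr_def)
    then show "?e ?z / sqrt (W2 ?z) = integrand p"
      using z W2_pos[OF z(1)] by (simp add: coord_fun_def)
  qed
  then have "(\<lambda>p. indicator V p *\<^sub>R integrand p) \<in> borel_measurable borel"
    by (rule borel_measurable_continuous_on_indicator[rotated]) (simp add: open_V)
  moreover have "(\<lambda>p. indicator V p *\<^sub>R integrand p) = integrand"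
    using integrand_outside C(2) by (auto simp: fun_eq_iff indicator_def)
  ultimately show ?thesis by simp
qed

text \<open>
  The components in the fibre directions of the vector field \<open>\<phi> U\<close>, extended by zero.
\<close>

definition fibre_part :: "'k \<Rightarrow> real^'m \<Rightarrow> real" where
  "fibre_part b z = (if z \<in> \<Omega> then \<phi> z * U z $ \<kappa> b else 0)"

lemma fibre_part_outside: "z \<notin> K \<Longrightarrow> fibre_part b z = 0"
  using K(3) by (simp add: fibre_part_def)

lemma fibre_part_C1: "Cn_on (Suc 0) UNIV (fibre_part b)"
proof (rule extend_by_zero)
  have "Cn_on (Suc 0) \<Omega> (\<lambda>z. \<phi> z * U z $ \<kappa> b)"
    by (intro Cn_on_mult Cn_on_nth open_\<Omega> U_C1 Cn_on_subset[OF \<phi>_C1 subset_UNIV])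
  then show "Cn_on (Suc 0) \<Omega> (fibre_part b)" by (rule Cn_on_cong[OF open_\<Omega>, rotated]) (simp add: fibre_part_def)
qed (rule fibre_part_outside)

text \<open>
  The integrand is $\partial_X \phi + \phi \operatorname{div} X$ up to a divergence in the fibre
  directions.
\<close>

lemma coord_fun_integrand_split:
  assumes l: "l \<in> chart_dom d"
  defines "y \<equiv> coord d l" and "DX \<equiv> frechet_derivative (\<lambda>y. X d (chart_inv d y)) (at (coord d l))"
  shows "coord_fun integrand (join y t) = frechet_derivative \<phi> (at (join y t)) (join (X d l) 0) + \<phi> (join y t) * tr DX
    + (\<Sum>b\<in>UNIV. frechet_derivative (fibre_part b) (at (join y t)) (join 0 (axis b 1)))"
proof (cases "join y t \<in> \<Omega>")
  case False
  then have k: "join y t \<notin> K" using K_subset by blast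
  have "frechet_derivative \<phi> (at (join y t)) v = 0" for v by (rule frechet_outside_K[OF K(3) k])
  moreover have "frechet_derivative (fibre_part b) (at (join y t)) v = 0" for b v
    by (rule frechet_outside_K[OF fibre_part_outside k])
  ultimately show ?thesis using False by (simp add: coord_fun_def)
next
  case True
  define z where "z = join y t"
  have z: "z \<in> \<Omega>" using True by (simp add: z_def)
  have bz: "base z = y" by (simp add: z_def)
  have yl: "y \<in> coord d ` chart_dom d" "chart_inv d y = l" using l N.chart_inv_coord[OF d l] by (simp_all add: y_def)
  let ?D\<phi> = "frechet_derivative \<phi> (at z)" and ?DU = "frechet_derivative U (at z)"
  have lin: "linear ?D\<phi>" using d\<phi> by (rule has_derivative_linear)
  have "U z = join (X d l) 0 + (\<Sum>b\<in>UNIV. (U z $ \<kappa> b) *\<^sub>R axis (\<kappa> b) 1)"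
  proof (rule split_eqI)
    have "base (U z) = X d l" using lift_system(2)[OF z] \<rho>_pt[OF z] bz yl(2) by simp
    then show "U z $ \<iota> a = (join (X d l) 0 + (\<Sum>b\<in>UNIV. (U z $ \<kappa> b) *\<^sub>R axis (\<kappa> b) 1)) $ \<iota> a" for a
      by (auto simp: base_def vec_eq_iff axis_def)
    show "U z $ \<kappa> b = (join (X d l) 0 + (\<Sum>b\<in>UNIV. (U z $ \<kappa> b) *\<^sub>R axis (\<kappa> b) 1)) $ \<kappa> b" for b
      by (simp add: axis_def inj_eq[OF inj_\<kappa>] if_distrib[of "\<lambda>t. _ * t"] cong: if_cong)
  qed
  then have "?D\<phi> (U z) = ?D\<phi> (join (X d l) 0 + (\<Sum>b\<in>UNIV. (U z $ \<kappa> b) *\<^sub>R axis (\<kappa> b) 1))" by simp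
  also have "\<dots> = ?D\<phi> (join (X d l) 0) + (\<Sum>b\<in>UNIV. U z $ \<kappa> b * ?D\<phi> (axis (\<kappa> b) 1))"
    by (simp add: linear_add[OF lin] linear_sum[OF lin] linear_scale[OF lin])
  finally have 1: "?D\<phi> (U z) = ?D\<phi> (join (X d l) 0) + (\<Sum>b\<in>UNIV. U z $ \<kappa> b * ?D\<phi> (axis (\<kappa> b) 1))" .
  have dUi: "((\<lambda>x. U x $ i) has_derivative (\<lambda>v. ?DU v $ i)) (at z)" for i
    by (rule bounded_linear.has_derivative[OF bounded_linear_vec_nth dU[OF z]])
  have "?DU (axis (\<iota> a) 1) $ \<iota> a = DX (axis a 1) $ a" for a
  proof -
    have "((\<lambda>y. X d (chart_inv d y)) has_derivative DX) (at (base z))"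
      using Cn_on_has_derivative[OF smooth_vector_fieldD(2)[OF X d, of "Suc 0"] yl(1)] by (simp add: DX_def y_def bz)
    from has_derivative_compose[OF bounded_linear_imp_has_derivative[OF bounded_linear_split(1)] this]
    have "((\<lambda>x. X d (chart_inv d (base x)) $ a) has_derivative (\<lambda>v. DX (base v) $ a)) (at z)"
      by (rule bounded_linear.has_derivative[OF bounded_linear_vec_nth])
    then have "((\<lambda>x. U x $ \<iota> a) has_derivative (\<lambda>v. DX (base v) $ a)) (at z)"
    proof (rule has_derivative_transform_within_open[OF _ open_\<Omega> z])
      fix x assume x: "x \<in> \<Omega>"
      show "X d (chart_inv d (base x)) $ a = U x $ \<iota> a"
        using lift_system(2)[OF x, of X] \<rho>_pt[OF x] by (simp add: base_def vec_eq_iff)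
    qed
    from has_derivative_unique[OF dUi this] have "?DU v $ \<iota> a = DX (base v) $ a" for v by metis
    moreover have "base (axis (\<iota> a) 1) = axis a 1" using join_axis(2)[of a] base_join by metis
    ultimately show ?thesis by simp
  qed
  then have 2: "tr ?DU = tr DX + (\<Sum>b\<in>UNIV. ?DU (axis (\<kappa> b) 1) $ \<kappa> b)"
    by (simp add: tr_def sum_split)
  have 3: "frechet_derivative (fibre_part b) (at z) (axis (\<kappa> b) 1) = \<phi> z * ?DU (axis (\<kappa> b) 1) $ \<kappa> b + ?D\<phi> (axis (\<kappa> b) 1) * U z $ \<kappa> b" for b
  proof -
    have "(fibre_part b has_derivative (\<lambda>v. \<phi> z * ?DU v $ \<kappa> b + ?D\<phi> v * U z $ \<kappa> b)) (at z)"
      by (rule has_derivative_transform_within_open[OF has_derivative_mult[OF d\<phi> dUi] open_\<Omega> z]) (simp add: fibre_part_def)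
    from frechet_derivative_at[OF this, symmetric] show ?thesis by simp
  qed
  show ?thesis
    unfolding z_def[symmetric] coord_fun_integrand[OF z] 1 2 join_axis 3
    by (simp add: sum.distrib sum_distrib_left algebra_simps)
qed

text \<open>
  The divergence in the fibre directions integrates to zero, and $\partial_X \phi$ integrates to the
  derivative of the integral.
\<close>

lemma integral_coord_fun_integrand:
  assumes l: "l \<in> chart_dom d"
  defines "y \<equiv> coord d l" and "DX \<equiv> frechet_derivative (\<lambda>y. X d (chart_inv d y)) (at (coord d l))"
  shows "integrable lborel (\<lambda>t. coord_fun integrand (join y t))"
    and "(LINT t|lborel. coord_fun integrand (join y t)) = frechet_derivative I (at y) (X d l) + I y * tr DX"
    and "(I has_derivative frechet_derivative I (at y)) (at y)"
proof -
  note sp = coord_fun_integrand_split[OF l, folded y_def DX_def]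
  have i1: "integrable lborel (\<lambda>t. frechet_derivative \<phi> (at (join y t)) v)" for v
    by (rule join_integrand[OF Cn_on_frechet[OF \<phi>_C1]]) (rule frechet_outside_K[OF K(3)])
  have i2: "integrable lborel (\<lambda>t. \<phi> (join y t))" by (rule join_integrand[OF \<phi>_C1 K(3)])
  have i3: "integrable lborel (\<lambda>t. frechet_derivative (fibre_part b) (at (join y t)) v)" for b v
    by (rule join_integrand[OF Cn_on_frechet[OF fibre_part_C1]]) (rule frechet_outside_K[OF fibre_part_outside])
  have i4: "integrable lborel (\<lambda>t. \<Sum>b\<in>UNIV. frechet_derivative (fibre_part b) (at (join y t)) (join 0 (axis b 1)))"
    by (intro Bochner_Integration.integrable_sum i3)
  have i2': "integrable lborel (\<lambda>t. \<phi> (join y t) * tr DX)" using i2 by simp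
  show "integrable lborel (\<lambda>t. coord_fun integrand (join y t))"
    unfolding sp by (intro Bochner_Integration.integrable_add i1 i2' i4)
  have "(LINT t|lborel. coord_fun integrand (join y t)) =
      (LINT t|lborel. frechet_derivative \<phi> (at (join y t)) (join (X d l) 0)) + I y * tr DX
      + (\<Sum>b\<in>UNIV. LINT t|lborel. frechet_derivative (fibre_part b) (at (join y t)) (join 0 (axis b 1)))"
    unfolding sp I_def
    by (simp add: Bochner_Integration.integral_add[OF Bochner_Integration.integrable_add[OF i1 i2'] i4]
      Bochner_Integration.integral_add[OF i1 i2'] Bochner_Integration.integral_sum[OF i3])
  also have "\<dots> = (LINT t|lborel. frechet_derivative \<phi> (at (join y t)) (join (X d l) 0)) + I y * tr DX"
    by (simp add: integral_fibre_derivative_eq_0[OF fibre_part_C1 fibre_part_outside])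
  finally have int: "(LINT t|lborel. coord_fun integrand (join y t)) =
      (LINT t|lborel. frechet_derivative \<phi> (at (join y t)) (join (X d l) 0)) + I y * tr DX" .
  let ?\<phi> = "\<lambda>p. \<phi> (join (fst p) (snd p))"
  have "Cn_on (Suc 0) UNIV ?\<phi>" by (rule Cn_on_le[OF Cn_on_coord_fun_join n])
  from has_derivative_param_integral(1)[OF compact_fib_K _ this, of y] K(3)[OF supp_join]
  have dI: "(I has_derivative (\<lambda>v. LINT t|lborel. frechet_derivative ?\<phi> (at (y, t)) (v, 0))) (at y)"
    by (simp add: I_def[abs_def])
  have "frechet_derivative ?\<phi> (at (y, t)) (v, 0) = frechet_derivative \<phi> (at (join y t)) (join v 0)" for v t
  proof -
    have "bounded_linear (\<lambda>p. join (fst p) (snd p))" using linear_join by (simp add: linear_conv_bounded_linear)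
    from has_derivative_compose[OF bounded_linear_imp_has_derivative[OF this] d\<phi>]
    have "(?\<phi> has_derivative (\<lambda>p. frechet_derivative \<phi> (at (join (fst (y, t)) (snd (y, t)))) (join (fst p) (snd p)))) (at (y, t))" .
    from frechet_derivative_at[OF this, symmetric] show ?thesis by simp
  qed
  with dI frechet_derivative_at[OF dI, symmetric] int
  show "(I has_derivative frechet_derivative I (at y)) (at y)"
    and "(LINT t|lborel. coord_fun integrand (join y t)) = frechet_derivative I (at y) (X d l) + I y * tr DX"
    by simp_all
qed

lemma integrand_integrable: "integrable (fibre_measure TYPE('k) A g B h \<rho> l) integrand"
proof (cases "l \<in> chart_dom d")
  case True
  show ?thesis
    by (subst fibre_integral(1)[OF integrand_measurable _ True])
      (use integrand_outside C(2) integral_coord_fun_integrand(1)[OF True] in auto)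
next
  case False
  then have "l \<notin> \<rho> ` C" using compact_\<rho>C(2) by blast
  then have "integrand p = 0" if "p \<in> \<rho> -` {l}" for p using that integrand_outside by blast
  then show ?thesis by (rule fibre_integral_outside(1))
qed

text \<open>
  By the quotient rule for $I\, G^{-1/2}$, where $G^{1/2}$ is the density of the base, the derivative
  $\partial_X I$ is accompanied by the logarithmic derivative of $G^{1/2}$. Together with the
  trace of $DX$ left over from the integrand this is the divergence of \<open>X\<close>.
\<close>

lemma patch_derivative:
  "derivative_along B X (\<lambda>l. LINT p|fibre_measure TYPE('k) A g B h \<rho> l. f p) l =
    (LINT p|fibre_measure TYPE('k) A g B h \<rho> l. integrand p)
    - divergence B (volume_form h) X l * (LINT p|fibre_measure TYPE('k) A g B h \<rho> l. f p)"
proof -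
  let ?\<mu> = "fibre_measure TYPE('k) A g B h \<rho>"
  let ?F = "\<lambda>l. LINT p|?\<mu> l. f p"
  have z: "?F l' = 0" if "l' \<notin> \<rho> ` C" for l' by (rule fibre_integral_outside(2)) (rule f_outside[OF that])
  show ?thesis
  proof (cases "l \<in> chart_dom d")
    case True
    let ?y = "coord d l" and ?X = "\<lambda>y. X d (chart_inv d y)"
    let ?G = "N.gdet d"
    have y: "?y \<in> coord d ` chart_dom d" using True by blast
    have pos: "?G ?y > 0" by (rule N.gdet_pos[OF d y])
    have dG: "(?G has_derivative frechet_derivative ?G (at ?y)) (at ?y)"
      by (rule Cn_on_has_derivative[OF N.Cn_on_gdet[OF d] y])
    note dI = integral_coord_fun_integrand(3)[OF True]
    from has_derivative_divide[OF dI has_derivative_sqrt[OF dG pos]] pos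
    have "((\<lambda>y. I y / sqrt (?G y)) has_derivative
      (\<lambda>v. - I ?y * (inverse (sqrt (?G ?y)) * (inverse (sqrt (?G ?y)) / 2 * frechet_derivative ?G (at ?y) v) * inverse (sqrt (?G ?y)))
        + frechet_derivative I (at ?y) v / sqrt (?G ?y))) (at ?y)" by simp
    then have D: "((\<lambda>y. ?F (chart_inv d y)) has_derivative
      (\<lambda>v. - I ?y * (inverse (sqrt (?G ?y)) * (inverse (sqrt (?G ?y)) / 2 * frechet_derivative ?G (at ?y) v) * inverse (sqrt (?G ?y)))
        + frechet_derivative I (at ?y) v / sqrt (?G ?y))) (at ?y)" (is "(_ has_derivative ?D) _")
      by (rule has_derivative_transform_within_open[OF _ N.open_chart_image[OF d] y])
        (simp add: fibre_integral_eq_I[OF N.chart_inv_in_dom[OF d]] N.coord_chart_inv[OF d])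
    have LHS: "derivative_along B X ?F l = ?D (X d l)"
      unfolding N.derivative_along_chart[OF d True tX differentiableI[OF D]] frechet_derivative_at[OF D, symmetric] ..
    have diffX: "(\<lambda>y. X e (chart_inv e y)) differentiable (at (coord e l))" if "e \<in> B" "l \<in> chart_dom e" for e
      using smooth_vector_fieldD(2)[OF X that(1), of "Suc 0"] that(2) by auto
    have div: "divergence B (volume_form h) X l = frechet_derivative ?G (at ?y) (X d l) / (2 * ?G ?y) + tr (frechet_derivative ?X (at ?y))"
      using N.divergence_chart[OF d True tX diffX] N.chart_inv_coord[OF d True] by (simp add: coord_div_def)
    have "(LINT p|?\<mu> l. integrand p) = (LINT t|lborel. coord_fun integrand (join ?y t)) / sqrt (?G ?y)"
      by (rule fibre_integral(2)[OF integrand_measurable _ True]) (use integrand_outside C(2) in auto)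
    then have int: "(LINT p|?\<mu> l. integrand p) = (frechet_derivative I (at ?y) (X d l) + I ?y * tr (frechet_derivative ?X (at ?y))) / sqrt (?G ?y)"
      by (simp add: integral_coord_fun_integrand(2)[OF True])
    have "- i * (inverse s * (inverse s / 2 * w) * inverse s) + e / s = (e + i * t) / s - (w / (2 * (s * s)) + t) * (i / s)"
      if "s > 0" for i s w e t :: real
      using that by (simp add: field_simps)
    from this[of "sqrt (?G ?y)"] pos show ?thesis
      unfolding LHS div int fibre_integral_eq_I[OF True] by simp
  next
    case False
    then have l: "l \<notin> \<rho> ` C" using compact_\<rho>C(2) by blast
    have "derivative_along B X ?F l = 0"
      by (rule N.locally_zero(2)[OF compact_imp_closed[OF compact_\<rho>C(1)] z l])
    moreover have "(LINT p|?\<mu> l. integrand p) = 0"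
      by (rule fibre_integral_outside(2)) (use integrand_outside l in blast)
    ultimately show ?thesis using z[OF l] by simp
  qed
qed

end

end

section \<open>Globalization\<close>

context oriented_manifold
begin

lemma bump_exists:
  assumes c: "c \<in> A" and V: "open V" "V \<subseteq> chart_dom c" and p: "p \<in> V"
  shows "\<exists>b C. Cn_fun n A b \<and> (\<forall>q. 0 \<le> b q) \<and> 0 < b p \<and> compact C \<and> C \<subseteq> V \<and> (\<forall>q. q \<notin> C \<longrightarrow> b q = 0)"
proof -
  let ?x = "coord c p"
  have oV: "open (coord c ` V)" by (rule open_coord_image[OF c V])
  then obtain e where e: "e > 0" "cball ?x e \<subseteq> coord c ` V" using p open_contains_cball by blast
  let ?u = "\<lambda>x. e\<^sup>2 - (x - ?x) \<bullet> (x - ?x)"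
  define b where "b q = (if q \<in> V then max 0 (?u (coord c q)) ^ Suc n else 0)" for q
  define C where "C = chart_inv c ` cball ?x e"
  have e': "cball ?x e \<subseteq> coord c ` chart_dom c" using e(2) V(2) by blast
  have C: "compact C" unfolding C_def
    by (rule compact_continuous_image[OF continuous_on_subset[OF continuous_chart_inv[OF c] e']]) simp
  have CV: "C \<subseteq> V"
  proof
    fix q assume "q \<in> C"
    then obtain x where x: "x \<in> cball ?x e" "q = chart_inv c x" unfolding C_def by blast
    then obtain q' where "q' \<in> V" "x = coord c q'" using e(2) by blast
    then show "q \<in> V" using x chart_inv_coord[OF c] V(2) by auto
  qed
  have out: "b q = 0" if "q \<notin> C" for q
  proof (cases "q \<in> V")
    case True
    have "coord c q \<notin> cball ?x e"
    proof
      assume "coord c q \<in> cball ?x e"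
      then have "chart_inv c (coord c q) \<in> C" unfolding C_def by blast
      then show False using that chart_inv_coord[OF c] True V(2) by auto
    qed
    then have "e < norm (coord c q - ?x)" by (simp add: dist_norm norm_minus_commute)
    then have "e\<^sup>2 \<le> (norm (coord c q - ?x))\<^sup>2" using e(1) by (intro power_mono) auto
    then have "?u (coord c q) \<le> 0" by (simp add: power2_norm_eq_inner)
    then show ?thesis by (simp add: b_def)
  qed (simp add: b_def)
  have "Cn_fun n A b"
  proof (rule Cn_fun_localI)
    fix q
    show "\<exists>c\<in>A. \<exists>V. open V \<and> q \<in> V \<and> V \<subseteq> chart_dom c \<and> Cn_on n (coord c ` V) (\<lambda>x. b (chart_inv c x))"
    proof (cases "q \<in> V")
      case True
      have "Cn_on n (coord c ` V) (\<lambda>x. x - ?x)" by (intro Cn_on_diff Cn_on_ident Cn_on_const oV)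
      from Cn_on_diff[OF oV Cn_on_const Cn_on_bilinear[OF bounded_bilinear_inner oV this this]]
      have "Cn_on n (coord c ` V) ?u" .
      from Cn_on_compose[OF oV open_UNIV Cn_on_max_power this]
      have "Cn_on n (coord c ` V) (\<lambda>x. max 0 (?u x) ^ Suc n)" by simp
      then have "Cn_on n (coord c ` V) (\<lambda>x. b (chart_inv c x))"
      proof (rule Cn_on_cong[OF oV, rotated])
        fix x assume "x \<in> coord c ` V"
        then obtain q' where "q' \<in> V" "x = coord c q'" by blast
        then show "max 0 (?u x) ^ Suc n = b (chart_inv c x)" using chart_inv_coord[OF c] V(2) by (auto simp: b_def)
      qed
      then show ?thesis using c V True by blast
    next
      case False
      then have "q \<notin> C" using CV by blast
      from locally_zero(1)[OF compact_imp_closed[OF C] out this] show ?thesis .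
    qed
  qed
  moreover have "\<forall>q. 0 \<le> b q" by (simp add: b_def)
  moreover have "0 < b p" using p e(1) by (simp add: b_def)
  ultimately show ?thesis using C CV out by blast
qed

end

context riemannian_submersion
begin

text \<open>
  The regularity of \<open>f\<close> is part of \<open>patch_function\<close>.
\<close>

definition supported_in_patch :: "('a \<Rightarrow> real) \<Rightarrow> bool" where
  "supported_in_patch f \<longleftrightarrow> (\<exists>c d V \<Omega> \<Phi> \<Psi> C. patch_function A g B h \<iota> \<kappa> \<rho> n c d V \<Omega> \<Phi> \<Psi> f C)"

text \<open>
  Finitely many bump functions \<open>b i\<close>, each supported in a patch, have a sum \<open>\<beta>\<close> that is positive on the
  support of \<open>f\<close>. The summands are $(f / \beta)\, b_i$.
\<close>

lemma patch_decomposition: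
  assumes f: "Cn_fun n A f" and supp: "compactly_supported f"
  shows "\<exists>J :: 'a set. \<exists>u. finite J \<and> (\<forall>i\<in>J. supported_in_patch (u i)) \<and> f = (\<lambda>p. \<Sum>i\<in>J. u i p)"
proof -
  define S where "S = closure {p. f p \<noteq> 0}"
  have S: "compact S" "\<And>p. p \<notin> S \<Longrightarrow> f p = 0"
    using supp closure_subset[of "{p. f p \<noteq> 0}"] by (auto simp: S_def compactly_supported_def)
  have "\<forall>i. \<exists>b. Cn_fun n A b \<and> (\<forall>q. 0 \<le> b q) \<and> 0 < b i \<and>
      (\<forall>u. Cn_fun n A u \<longrightarrow> supported_in_patch (\<lambda>q. u q * b q))"
  proof
    fix i
    obtain c d V \<Omega> \<Phi> \<Psi> where p: "i \<in> V" and P: "patch A g B h \<iota> \<kappa> \<rho> n c d V \<Omega> \<Phi> \<Psi>"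
      using patch_exists[of i] by (elim exE conjE)
    interpret patch A g B h \<iota> \<kappa> \<rho> n c d V \<Omega> \<Phi> \<Psi> by (rule P)
    obtain b C where b: "Cn_fun n A b" "\<forall>q. 0 \<le> b q" "0 < b i" "compact C" "C \<subseteq> V" "\<forall>q. q \<notin> C \<longrightarrow> b q = 0"
      using M.bump_exists[OF c open_V V(1) p, of n] by (elim exE conjE)
    have "supported_in_patch (\<lambda>q. u q * b q)" if u: "Cn_fun n A u" for u
    proof -
      have "patch_function A g B h \<iota> \<kappa> \<rho> n c d V \<Omega> \<Phi> \<Psi> (\<lambda>q. u q * b q) C"
        by unfold_locales (use M.Cn_fun_mult[OF u b(1)] b in auto)
      then show ?thesis unfolding supported_in_patch_def by (intro exI)
    qed
    with b show "\<exists>b. Cn_fun n A b \<and> (\<forall>q. 0 \<le> b q) \<and> 0 < b i \<and>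
      (\<forall>u. Cn_fun n A u \<longrightarrow> supported_in_patch (\<lambda>q. u q * b q))" by blast
  qed
  then obtain b where b: "\<And>i. Cn_fun n A (b i)" "\<And>i q. 0 \<le> b i q" "\<And>i. 0 < b i i"
      "\<And>i u. Cn_fun n A u \<Longrightarrow> supported_in_patch (\<lambda>q. u q * b i q)" by metis
  have o: "open {q. 0 < b i q}" for i
    by (rule open_Collect_less[OF continuous_on_const M.Cn_fun_continuous[OF b(1)]])
  have "S \<subseteq> (\<Union>i\<in>S. {q. 0 < b i q})" using b(3) by blast
  then obtain J where J: "J \<subseteq> S" "finite J" "S \<subseteq> (\<Union>i\<in>J. {q. 0 < b i q})"
    by (rule compactE_image[OF S(1) o])
  define \<beta> where "\<beta> q = (\<Sum>i\<in>J. b i q)" for q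
  have \<beta>: "\<beta> q > 0" if q: "q \<in> S" for q
  proof -
    obtain i where "i \<in> J" "0 < b i q" using subsetD[OF J(3) q] by blast
    then show ?thesis unfolding \<beta>_def using J(2) b(2) by (intro sum_pos2[of J i]) auto
  qed
  let ?w = "\<lambda>q. f q / \<beta> q"
  have w: "Cn_fun n A ?w"
  proof (rule M.Cn_fun_divide[OF f _ compact_imp_closed[OF S(1)] _ S(2)])
    show "Cn_fun n A \<beta>" unfolding \<beta>_def[abs_def] by (rule M.Cn_fun_sum) (rule b(1))
    show "\<beta> q \<noteq> 0" if "q \<in> S" for q using \<beta>[OF that] by simp
  qed
  \<comment> \<open>Where the sum of the bump functions vanishes, so does the function, and division by zero yields zero.\<close>
  have "f q = (\<Sum>i\<in>J. ?w q * b i q)" for q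
  proof (cases "q \<in> S")
    case True
    have "(\<Sum>i\<in>J. ?w q * b i q) = ?w q * \<beta> q" by (simp only: \<beta>_def sum_distrib_left)
    then show ?thesis using \<beta>[OF True] by simp
  next
    case False
    then show ?thesis using S(2) by simp
  qed
  then have "finite J \<and> (\<forall>i\<in>J. supported_in_patch (\<lambda>q. ?w q * b i q)) \<and> f = (\<lambda>q. \<Sum>i\<in>J. ?w q * b i q)"
    using J(2) b(4)[OF w] by blast
  then show ?thesis by (intro exI)
qed

lemma supported_in_patchD:
  assumes "supported_in_patch f"
  defines "F \<equiv> \<lambda>l. LINT p|fibre_measure TYPE('k) A g B h \<rho> l. f p"
  shows "Cn_fun n A f" "integrable (fibre_measure TYPE('k) A g B h \<rho> l) f" "Cn_fun n B F"
    and "Suc 0 \<le> n \<Longrightarrow> smooth_vector_field B X \<Longrightarrow> integrable (fibre_measure TYPE('k) A g B h \<rho> l)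
      (\<lambda>p. derivative_along A (normal_lift g B \<rho> X) f p + divergence A (volume_form g) (normal_lift g B \<rho> X) p * f p)"
    and "Suc 0 \<le> n \<Longrightarrow> smooth_vector_field B X \<Longrightarrow> derivative_along B X F l =
      (LINT p|fibre_measure TYPE('k) A g B h \<rho> l.
        derivative_along A (normal_lift g B \<rho> X) f p + divergence A (volume_form g) (normal_lift g B \<rho> X) p * f p)
      - divergence B (volume_form h) X l * F l"
proof -
  obtain c d V \<Omega> \<Phi> \<Psi> C where P: "patch_function A g B h \<iota> \<kappa> \<rho> n c d V \<Omega> \<Phi> \<Psi> f C"
    using assms(1) unfolding supported_in_patch_def by (elim exE)
  interpret patch_function A g B h \<iota> \<kappa> \<rho> n c d V \<Omega> \<Phi> \<Psi> f C by (rule P)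
  have e: "integrand X = (\<lambda>p. derivative_along A (normal_lift g B \<rho> X) f p + divergence A (volume_form g) (normal_lift g B \<rho> X) p * f p)"
    if "Suc 0 \<le> n" "smooth_vector_field B X"
    by (rule ext) (rule integrand_def[OF that])
  show "Cn_fun n A f" by (rule f)
  show "integrable (fibre_measure TYPE('k) A g B h \<rho> l) f" by (rule fibre_integrable)
  show "Cn_fun n B F" unfolding F_def by (rule patch_fibre_integral_Cn)
  show "integrable (fibre_measure TYPE('k) A g B h \<rho> l)
      (\<lambda>p. derivative_along A (normal_lift g B \<rho> X) f p + divergence A (volume_form g) (normal_lift g B \<rho> X) p * f p)"
    if "Suc 0 \<le> n" "smooth_vector_field B X"
    using integrand_integrable[OF that] unfolding e[OF that] .
  show "derivative_along B X F l =
      (LINT p|fibre_measure TYPE('k) A g B h \<rho> l.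
        derivative_along A (normal_lift g B \<rho> X) f p + divergence A (volume_form g) (normal_lift g B \<rho> X) p * f p)
      - divergence B (volume_form h) X l * F l"
    if "Suc 0 \<le> n" "smooth_vector_field B X"
    using patch_derivative[OF that] unfolding e[OF that] F_def .
qed

lemma fibre_integral_Cn:
  assumes f: "Cn_fun n A f" "compactly_supported f"
  shows "Cn_fun n B (\<lambda>l. LINT p|fibre_measure TYPE('k) A g B h \<rho> l. f p)"
proof -
  obtain J :: "'a set" and u where u: "finite J" "\<And>i. i \<in> J \<Longrightarrow> supported_in_patch (u i)" "f = (\<lambda>p. \<Sum>i\<in>J. u i p)"
    using patch_decomposition[OF f] by blast
  have "(LINT p|fibre_measure TYPE('k) A g B h \<rho> l. f p) = (\<Sum>i\<in>J. LINT p|fibre_measure TYPE('k) A g B h \<rho> l. u i p)" for l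
    unfolding u(3) by (rule Bochner_Integration.integral_sum) (rule supported_in_patchD(2)[OF u(2)])
  moreover have "Cn_fun n B (\<lambda>l. \<Sum>i\<in>J. LINT p|fibre_measure TYPE('k) A g B h \<rho> l. u i p)"
    by (rule N.Cn_fun_sum) (rule supported_in_patchD(3)[OF u(2)])
  ultimately show ?thesis by simp
qed

lemma fibre_integral_derivative:
  assumes f: "Cn_fun n A f" "compactly_supported f" and n: "Suc 0 \<le> n" and X: "smooth_vector_field B X"
  shows "derivative_along B X (\<lambda>l. LINT p|fibre_measure TYPE('k) A g B h \<rho> l. f p) l =
    (LINT p|fibre_measure TYPE('k) A g B h \<rho> l. derivative_along A (normal_lift g B \<rho> X) f p +
      (divergence A (volume_form g) (normal_lift g B \<rho> X) p - divergence B (volume_form h) X l) * f p)"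
proof -
  let ?\<mu> = "fibre_measure TYPE('k) A g B h \<rho>" and ?Y = "normal_lift g B \<rho> X"
  let ?div = "divergence A (volume_form g) ?Y" and ?k = "divergence B (volume_form h) X l"
  obtain J :: "'a set" and u where u: "finite J" "\<And>i. i \<in> J \<Longrightarrow> supported_in_patch (u i)" "f = (\<lambda>p. \<Sum>i\<in>J. u i p)"
    using patch_decomposition[OF f] by blast
  note D = supported_in_patchD[OF u(2)]
  have u1: "Cn_fun (Suc 0) A (u i)" if "i \<in> J" for i by (rule M.Cn_fun_le[OF D(1)[OF that] n])
  have F1: "Cn_fun (Suc 0) B (\<lambda>l. LINT p|?\<mu> l. u i p)" if "i \<in> J" for i by (rule N.Cn_fun_le[OF D(3)[OF that] n])
  have F: "(\<lambda>l. LINT p|?\<mu> l. f p) = (\<lambda>l. \<Sum>i\<in>J. LINT p|?\<mu> l. u i p)"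
    unfolding u(3) by (intro ext Bochner_Integration.integral_sum D(2))
  have i1: "integrable (?\<mu> l) (\<lambda>p. derivative_along A ?Y (u i) p + ?div p * u i p)" if "i \<in> J" for i
    by (rule D(4)[OF that n X])
  have i2: "integrable (?\<mu> l) (\<lambda>p. ?k * u i p)" if "i \<in> J" for i using D(2)[OF that] by simp
  have "derivative_along B X (\<lambda>l. LINT p|?\<mu> l. f p) l = (\<Sum>i\<in>J. derivative_along B X (\<lambda>l. LINT p|?\<mu> l. u i p) l)"
    unfolding F by (rule N.derivative_along_sum) (rule F1)
  also have "\<dots> = (\<Sum>i\<in>J. (LINT p|?\<mu> l. derivative_along A ?Y (u i) p + ?div p * u i p) - ?k * (LINT p|?\<mu> l. u i p))"
    by (rule sum.cong[OF refl]) (rule D(5)[OF _ n X])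
  also have "\<dots> = (\<Sum>i\<in>J. LINT p|?\<mu> l. (derivative_along A ?Y (u i) p + ?div p * u i p) - ?k * u i p)"
    by (rule sum.cong[OF refl]) (simp add: Bochner_Integration.integral_diff[OF i1 i2])
  also have "\<dots> = (LINT p|?\<mu> l. (\<Sum>i\<in>J. (derivative_along A ?Y (u i) p + ?div p * u i p) - ?k * u i p))"
    by (rule Bochner_Integration.integral_sum[symmetric]) (intro Bochner_Integration.integrable_diff i1 i2)
  also have "\<dots> = (LINT p|?\<mu> l. derivative_along A ?Y f p + (?div p - ?k) * f p)"
  proof (rule Bochner_Integration.integral_cong[OF refl])
    fix p
    have "derivative_along A ?Y f p = (\<Sum>i\<in>J. derivative_along A ?Y (u i) p)"
      unfolding u(3) by (rule M.derivative_along_sum) (rule u1)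
    then show "(\<Sum>i\<in>J. (derivative_along A ?Y (u i) p + ?div p * u i p) - ?k * u i p) = derivative_along A ?Y f p + (?div p - ?k) * f p"
      by (simp add: u(3) sum.distrib sum_subtractf sum_distrib_left left_diff_distrib)
  qed
  finally show ?thesis .
qed

end

theorem theorem1p5:
  fixes A :: "('a::{t2_space, second_countable_topology}, 'm::finite) chart set"
    and g :: "('a, 'm) metric"
    and B :: "('b::{t2_space, second_countable_topology}, 'n::finite) chart set"
    and h :: "('b, 'n) metric"
    and \<rho> :: "'a \<Rightarrow> 'b"
    and f :: "'a \<Rightarrow> real"
    and m r :: enat
    and \<mu> :: "'b \<Rightarrow> 'a measure"
    and F :: "'b \<Rightarrow> real"
  assumes "oriented_atlas A" and "riemannian_metric A g"
    and "oriented_atlas B" and "riemannian_metric B h"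
    and "CARD('n) < CARD('m)"
    and "CARD('k::finite) = CARD('m) - CARD('n)"
    and "Ck_map m A B \<rho>" and "submersion A B \<rho>"
    and "1 \<le> r" and "r \<le> m"
    and "Ck_fun r A f" and "compactly_supported f"
    and "\<And>l. \<mu> l = fibre_measure TYPE('k) A g B h \<rho> l"
    and "\<And>l. F l = (\<integral>x. f x \<partial>\<mu> l)"
  shows "Ck_fun (min r (m - 1)) B F \<and>
    (2 \<le> m \<longrightarrow>
      (\<forall>X. smooth_vector_field B X \<longrightarrow>
        (\<forall>l. derivative_along B X F l =
          (\<integral>x. derivative_along A (normal_lift g B \<rho> X) f x +
              (divergence A (volume_form g) (normal_lift g B \<rho> X) x
                - divergence B (volume_form h) X l) * f x \<partial>\<mu> l))))"
proof -
  obtain \<iota> :: "'n \<Rightarrow> 'm" and \<kappa> :: "'k \<Rightarrow> 'm" where split: "coordinate_split \<iota> \<kappa>"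
    using coordinate_split_exists[OF assms(5,6)] by blast
  have F: "F = (\<lambda>l. LINT p|fibre_measure TYPE('k) A g B h \<rho> l. f p)" using assms(13,14) by (simp add: fun_eq_iff)
  have sub: "riemannian_submersion A g B h \<iota> \<kappa> \<rho> n" if n: "enat (Suc n) \<le> m" for n
  proof -
    have "Cn_on (Suc n) (coord c ` (chart_dom c \<inter> \<rho> -` chart_dom d)) (\<lambda>x. coord d (\<rho> (chart_inv c x)))"
      if "c \<in> A" "d \<in> B" for c d
    proof -
      have "Ck_on m (coord c ` (chart_dom c \<inter> \<rho> -` chart_dom d)) (coord d \<circ> \<rho> \<circ> chart_inv c)"
        using assms(7) that unfolding Ck_map_def by blast
      then have "Cn_on (Suc n) (coord c ` (chart_dom c \<inter> \<rho> -` chart_dom d)) (coord d \<circ> \<rho> \<circ> chart_inv c)"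
        using n unfolding Ck_on_def by blast
      then show ?thesis by (simp only: o_def)
    qed
    moreover have "continuous_on UNIV \<rho>" using assms(7) unfolding Ck_map_def by blast
    ultimately show ?thesis
      using assms(1-4,8) split
      by (intro riemannian_submersion.intro riemannian.intro oriented_manifold.intro riemannian_axioms.intro
          riemannian_submersion_axioms.intro)
  qed
  have f: "Cn_fun n A f" if "enat n \<le> r" for n using assms(11) that by (simp add: Ck_fun_iff)
  have "Cn_fun n B F" if n: "enat n \<le> min r (m - 1)" for n
  proof -
    \<comment> \<open>For natural numbers the truncated difference would not imply this if $m$ were zero.\<close>
    have "enat (Suc n) \<le> m"
    proof (cases m)
      case (enat k)
      have "1 \<le> m" using assms(9,10) by (rule order_trans)
      then show ?thesis using n enat by (auto simp: one_enat_def)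
    qed simp
    from riemannian_submersion.fibre_integral_Cn[OF sub[OF this] f assms(12)] n show ?thesis by (simp add: F)
  qed
  then have "Ck_fun (min r (m - 1)) B F" by (simp add: Ck_fun_iff)
  moreover have "derivative_along B X F l = (\<integral>x. derivative_along A (normal_lift g B \<rho> X) f x +
      (divergence A (volume_form g) (normal_lift g B \<rho> X) x - divergence B (volume_form h) X l) * f x \<partial>\<mu> l)"
    if m: "2 \<le> m" and X: "smooth_vector_field B X" for X l
  proof -
    have "enat (Suc (Suc 0)) \<le> m" using m by (cases m) (simp_all add: numeral_eq_enat)
    moreover have "Cn_fun (Suc 0) A f" using f[of 1] assms(9) by (simp add: one_enat_def)
    ultimately show ?thesis
      using riemannian_submersion.fibre_integral_derivative[OF sub _ assms(12) _ X] by (simp add: F assms(13))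
  qed
  ultimately show ?thesis by blast
qed

end
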